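(* Let $\mathbf{a}$ and $\mathbf{b}$ be infinite disjoint subsets of $\mathbb{D}$ which satisfy Blaschke's condition and such that $\lim\mathbf{a}\not\subset\lim\mathbf{b}$ and $\lim\mathbf{b}\not\subset\lim\mathbf{a}$. Then there exists a unique minimal geodesic of the Grassmann manifold $\mathrm{Gr}(H^2)$ which joins $\mathcal{Z}_{\mathbf{a}}$ and $\mathcal{Z}_{\mathbf{b}}$. That is, there exists a unique self-adjoint operator $X_{\mathbf{ab}}$ on $H^2$ with $\|X_{\mathbf{ab}}\|\le\pi/2$ which is co-diagonal with respect to both $\mathcal{Z}_{\mathbf{a}}$ and $\mathcal{Z}_{\mathbf{b}}$ (that is, $X_{\mathbf{ab}}\mathcal{Z}_{\mathbf{a}}\subset\mathcal{Z}_{\mathbf{a}}^\perp$, $X_{\mathbf{ab}}\mathcal{Z}_{\mathbf{a}}^\perp\subset\mathcal{Z}_{\mathbf{a}}$, $X_{\mathbf{ab}}\mathcal{Z}_{\mathbf{b}}\subset\mathcal{Z}_{\mathbf{b}}^\perp$, $X_{\mathbf{ab}}\mathcal{Z}_{\mathbf{b}}^\perp\subset\mathcal{Z}_{\mathbf{b}}$) and satisfies $$e^{iX_{\mathbf{ab}}}\mathcal{Z}_{\mathbf{a}}=\mathcal{Z}_{\mathbf{b}}.$$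
   Context: $H^2$ is the Hardy space of the unit disk $\mathbb{D}$. A set $\mathbf{a}=\{a_k:k\ge1\}\subset\mathbb{D}$ satisfies Blaschke's condition if $\sum_k(1-|a_k|)<\infty$. $\mathcal{Z}_{\mathbf{a}}=\{f\in H^2:f(a)=0\text{ for all }a\in\mathbf{a}\}$, similarly for $\mathbf{b}$. $\lim\mathbf{a}=\overline{\mathbf{a}}\setminus\mathbf{a}\subset\mathbb{T}$. $\mathrm{Gr}(H^2)$ is the manifold of closed subspaces of $H^2$ (identified with orthogonal projections), where the length of a curve of projections $P(t)$ is $\int\|\dot P(t)\|\,dt$ (operator norm). A geodesic joining $\mathcal{S}$ and $\mathcal{T}$ is a curve $\delta(t)=e^{itX}\mathcal{S}$, $t\in[0,1]$, with $X=X^*$ co-diagonal with respect to $\mathcal{S}$ ($X\mathcal{S}\subset\mathcal{S}^\perp$, $X\mathcal{S}^\perp\subset\mathcal{S}$) and $e^{iX}\mathcal{S}=\mathcal{T}$; it is minimal if $\|X\|\le\pi/2$ (such geodesics have minimal length). *)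

theory Defs
  imports "HOL-Complex_Analysis.Complex_Analysis" "HOL-Library.FuncSet"
begin

section \<open>The Hardy space of the unit disk\<close>

definition taylor :: "(complex \<Rightarrow> complex) \<Rightarrow> nat \<Rightarrow> complex" where
  "taylor f n = (deriv ^^ n) f 0 / fact n"

text \<open>
  \<open>H\<^sup>2\<close>: the holomorphic functions on the unit disk with square summable Taylor coefficients.
  HOL functions are total, so a function on the disk is represented by its extension by zero;
  this makes equality in the type coincide with equality on the disk.
\<close>

typedef hardy2 =
  "{f :: complex \<Rightarrow> complex. f holomorphic_on ball 0 1 \<and> summable (\<lambda>n. (cmod (taylor f n))\<^sup>2)
      \<and> (\<forall>z. z \<notin> ball 0 1 \<longrightarrow> f z = 0)}"
  morphisms hardy_eval Abs_hardy2
proof -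
  have "(deriv ^^ n) (\<lambda>z. 0 :: complex) 0 = 0" for n
    by (induction n) auto
  then show ?thesis
    by (intro exI[of _ "\<lambda>z. 0"]) (auto simp: taylor_def)
qed

setup_lifting type_definition_hardy2

lemma taylor_zero: "taylor (\<lambda>z. 0) n = 0"
proof -
  have "(deriv ^^ n) (\<lambda>z. 0 :: complex) 0 = 0"
    by (induction n) auto
  then show ?thesis by (simp add: taylor_def)
qed

lemma taylor_add:
  assumes "f holomorphic_on ball 0 1" "g holomorphic_on ball 0 1"
  shows "taylor (\<lambda>z. f z + g z) n = taylor f n + taylor g n"
  using higher_deriv_add[OF assms, of 0 n] by (simp add: taylor_def add_divide_distrib)

lemma taylor_cmult:
  assumes "f holomorphic_on ball 0 1"
  shows "taylor (\<lambda>z. c * f z) n = c * taylor f n"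
  using higher_deriv_cmult[OF assms, of 0 n c] by (simp add: taylor_def)

lemma cmod_add_square_le: "(cmod (a + b))\<^sup>2 \<le> 2 * ((cmod a)\<^sup>2 + (cmod b)\<^sup>2)"
proof -
  have "(cmod (a + b))\<^sup>2 \<le> (cmod a + cmod b)\<^sup>2"
    by (intro power_mono norm_triangle_ineq) auto
  also have "\<dots> \<le> 2 * ((cmod a)\<^sup>2 + (cmod b)\<^sup>2)"
    using sum_squares_bound[of "cmod a" "cmod b"] by (simp add: power2_sum)
  finally show ?thesis .
qed

lemma square_summable_add:
  assumes "summable (\<lambda>n. (cmod (a n))\<^sup>2)" "summable (\<lambda>n. (cmod (b n))\<^sup>2)"
  shows "summable (\<lambda>n. (cmod (a n + b n))\<^sup>2)"
  by (rule summable_comparison_test'[OF summable_mult[OF summable_add[OF assms], of 2], of 0])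
     (use cmod_add_square_le in simp)

lemma square_summable_cmult:
  assumes "summable (\<lambda>n. (cmod (a n))\<^sup>2)"
  shows "summable (\<lambda>n. (cmod (c * a n))\<^sup>2)"
  using summable_mult[OF assms, of "(cmod c)\<^sup>2"] by (simp add: norm_mult power_mult_distrib)

lemma square_summable_mult_cnj:
  assumes "summable (\<lambda>n. (cmod (a n))\<^sup>2)" "summable (\<lambda>n. (cmod (b n))\<^sup>2)"
  shows "summable (\<lambda>n. a n * cnj (b n))"
proof (rule summable_norm_cancel, rule summable_comparison_test'[OF summable_add[OF assms], of 0])
  fix n
  have "2 * (cmod (a n) * cmod (b n)) \<le> (cmod (a n))\<^sup>2 + (cmod (b n))\<^sup>2"
    using sum_squares_bound[of "cmod (a n)" "cmod (b n)"] by simp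
  moreover have "0 \<le> cmod (a n) * cmod (b n)" by simp
  ultimately have "cmod (a n) * cmod (b n) \<le> (cmod (a n))\<^sup>2 + (cmod (b n))\<^sup>2" by linarith
  then show "norm (norm (a n * cnj (b n))) \<le> (cmod (a n))\<^sup>2 + (cmod (b n))\<^sup>2"
    by (simp add: norm_mult)
qed

definition coeff_hardy :: "hardy2 \<Rightarrow> nat \<Rightarrow> complex" where
  "coeff_hardy f = taylor (hardy_eval f)"

lemma hardy_holomorphic: "hardy_eval f holomorphic_on ball 0 1"
  using hardy_eval[of f] by simp

lemma hardy_summable: "summable (\<lambda>n. (cmod (coeff_hardy f n))\<^sup>2)"
  using hardy_eval[of f] by (simp add: coeff_hardy_def)

lemma hardy_outside: "z \<notin> ball 0 1 \<Longrightarrow> hardy_eval f z = 0"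
  using hardy_eval[of f] by simp

lemma hardy_sums: "z \<in> ball 0 1 \<Longrightarrow> (\<lambda>n. coeff_hardy f n * z ^ n) sums hardy_eval f z"
  using holomorphic_power_series[OF hardy_holomorphic, of z f]
  by (simp add: coeff_hardy_def taylor_def)

lemma hardy_eqI: "(\<And>n. coeff_hardy f n = coeff_hardy g n) \<Longrightarrow> f = g"
proof -
  assume *: "\<And>n. coeff_hardy f n = coeff_hardy g n"
  have "hardy_eval f z = hardy_eval g z" for z
  proof (cases "z \<in> ball 0 1")
    case True
    from hardy_sums[OF True, of f] hardy_sums[OF True, of g] show ?thesis
      by (simp add: * sums_unique2)
  qed (simp add: hardy_outside)
  then show ?thesis by (metis hardy_eval_inject ext)
qed

lemma coeff_hardy_exists:
  assumes "summable (\<lambda>n. (cmod (c n))\<^sup>2)"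
  shows "\<exists>f. coeff_hardy f = c"
proof -
  define h where "h = (\<lambda>z::complex. \<Sum>n. c n * z ^ n)"
  define f where "f = (\<lambda>z. if z \<in> ball 0 1 then h z else 0)"
  have sm: "summable (\<lambda>n. c n * z ^ n)" if "z \<in> ball 0 1" for z
  proof -
    have "norm z < 1" using that by simp
    then have "norm z ^ 2 < 1 ^ 2" by (intro power_strict_mono) auto
    then have "summable (\<lambda>n. ((norm z)\<^sup>2) ^ n)" by (intro summable_geometric) simp
    moreover have "(\<lambda>n. ((norm z)\<^sup>2) ^ n) = (\<lambda>n. (cmod (cnj z ^ n))\<^sup>2)"
      unfolding norm_power complex_mod_cnj power_mult[symmetric] by (simp only: mult.commute)
    ultimately have "summable (\<lambda>n. (cmod (cnj z ^ n))\<^sup>2)" by simp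
    from square_summable_mult_cnj[OF assms this] show ?thesis by simp
  qed
  have sums: "(\<lambda>n. c n * (z - 0) ^ n) sums f z" if "z \<in> ball 0 1" for z
    using sm[OF that] that by (simp add: f_def h_def summable_sums)
  have hol: "f holomorphic_on ball 0 1"
    using power_series_holomorphic[of 0 1 c f] sums by blast
  have "conv_radius c \<ge> 1"
  proof (rule conv_radius_geI_ex)
    fix r :: real assume "0 < r" "ereal r < 1"
    then have "complex_of_real r \<in> ball 0 1" by simp
    from sm[OF this] show "\<exists>z. norm z = r \<and> summable (\<lambda>n. c n * z ^ n)"
      using \<open>0 < r\<close> by (intro exI[of _ "complex_of_real r"]) auto
  qed
  then have "fps_conv_radius (Abs_fps c) \<ge> 1"
    by (simp add: fps_conv_radius_def)
  then have cr: "fps_conv_radius (Abs_fps c) > 0"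
    by (rule less_le_trans[rotated]) simp
  have "f has_fps_expansion Abs_fps c"
    unfolding has_fps_expansion_def
  proof
    show "0 < fps_conv_radius (Abs_fps c)" by fact
    have "\<forall>\<^sub>F z in nhds (0::complex). z \<in> ball 0 1"
      by (rule eventually_nhds_in_open) auto
    then show "\<forall>\<^sub>F z in nhds 0. eval_fps (Abs_fps c) z = f z"
      by eventually_elim (simp add: f_def h_def eval_fps_def)
  qed
  then have tc: "taylor f n = c n" for n
    using fps_nth_fps_expansion[of f "Abs_fps c" n] by (simp add: taylor_def)
  have "f \<in> {f. f holomorphic_on ball 0 1 \<and> summable (\<lambda>n. (cmod (taylor f n))\<^sup>2)
      \<and> (\<forall>z. z \<notin> ball 0 1 \<longrightarrow> f z = 0)}"
    using hol assms by (simp add: tc) (simp add: f_def)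
  then have "coeff_hardy (Abs_hardy2 f) = c"
    by (simp add: coeff_hardy_def Abs_hardy2_inverse tc fun_eq_iff)
  then show ?thesis by blast
qed

instantiation hardy2 :: real_vector
begin

lift_definition zero_hardy2 :: hardy2 is "\<lambda>z. 0"
  by (simp add: taylor_zero)

lift_definition plus_hardy2 :: "hardy2 \<Rightarrow> hardy2 \<Rightarrow> hardy2" is "\<lambda>f g z. f z + g z"
  by (auto simp: taylor_add square_summable_add intro!: holomorphic_on_add)

lift_definition uminus_hardy2 :: "hardy2 \<Rightarrow> hardy2" is "\<lambda>f z. - f z"
proof -
  fix f :: "complex \<Rightarrow> complex"
  assume *: "f holomorphic_on ball 0 1 \<and> summable (\<lambda>n. (cmod (taylor f n))\<^sup>2)
    \<and> (\<forall>z. z \<notin> ball 0 1 \<longrightarrow> f z = 0)"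
  then have "taylor (\<lambda>z. - f z) n = - taylor f n" for n
    using taylor_cmult[of f "-1" n] by simp
  with * show "(\<lambda>z. - f z) holomorphic_on ball 0 1 \<and>
      summable (\<lambda>n. (cmod (taylor (\<lambda>z. - f z) n))\<^sup>2) \<and> (\<forall>z. z \<notin> ball 0 1 \<longrightarrow> - f z = 0)"
    by (auto intro!: holomorphic_on_minus)
qed

definition minus_hardy2 :: "hardy2 \<Rightarrow> hardy2 \<Rightarrow> hardy2" where
  "minus_hardy2 f g = f + (- g)"

lift_definition scaleR_hardy2 :: "real \<Rightarrow> hardy2 \<Rightarrow> hardy2" is "\<lambda>r f z. complex_of_real r * f z"
  by (auto simp: taylor_cmult square_summable_cmult intro!: holomorphic_on_mult)

instance
proof
  fix f g h :: hardy2 and a b :: real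
  show "f + g + h = f + (g + h)" by transfer (simp add: add.assoc)
  show "f + g = g + f" by transfer (simp add: add.commute)
  show "0 + f = f" by transfer simp
  show "- f + f = 0" by transfer simp
  show "f - g = f + - g" by (simp add: minus_hardy2_def)
  show "a *\<^sub>R (f + g) = a *\<^sub>R f + a *\<^sub>R g" by transfer (simp add: algebra_simps)
  show "(a + b) *\<^sub>R f = a *\<^sub>R f + b *\<^sub>R f" by transfer (simp add: algebra_simps)
  show "a *\<^sub>R b *\<^sub>R f = (a * b) *\<^sub>R f" by transfer (simp add: algebra_simps)
  show "1 *\<^sub>R f = f" by transfer simp
qed

end

lift_definition scaleC :: "complex \<Rightarrow> hardy2 \<Rightarrow> hardy2"  (infixr \<open>*\<^sub>C\<close> 75)
  is "\<lambda>c f z. c * f z"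
  by (auto simp: taylor_cmult square_summable_cmult intro!: holomorphic_on_mult)

lemma coeff_zero [simp]: "coeff_hardy 0 n = 0"
  by (simp add: coeff_hardy_def zero_hardy2.rep_eq taylor_zero)

lemma coeff_add [simp]: "coeff_hardy (f + g) n = coeff_hardy f n + coeff_hardy g n"
  by (simp add: coeff_hardy_def plus_hardy2.rep_eq taylor_add hardy_holomorphic)

lemma coeff_scaleC [simp]: "coeff_hardy (c *\<^sub>C f) n = c * coeff_hardy f n"
  by (simp add: coeff_hardy_def scaleC.rep_eq taylor_cmult hardy_holomorphic)

lemma scaleR_conv_scaleC: "r *\<^sub>R f = complex_of_real r *\<^sub>C f"
  unfolding hardy_eval_inject[symmetric] scaleC.rep_eq scaleR_hardy2.rep_eq ..

lemma coeff_scaleR [simp]: "coeff_hardy (r *\<^sub>R f) n = complex_of_real r * coeff_hardy f n"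
  by (simp add: scaleR_conv_scaleC)

lemma coeff_uminus [simp]: "coeff_hardy (- f) n = - coeff_hardy f n"
  using coeff_scaleR[of "-1" f n] by simp

lemma coeff_minus [simp]: "coeff_hardy (f - g) n = coeff_hardy f n - coeff_hardy g n"
  unfolding minus_hardy2_def coeff_add coeff_uminus by simp

text \<open>The complex inner product, linear in the first argument.\<close>

definition cinner :: "hardy2 \<Rightarrow> hardy2 \<Rightarrow> complex" where
  "cinner f g = (\<Sum>n. coeff_hardy f n * cnj (coeff_hardy g n))"

lemma cinner_summable: "summable (\<lambda>n. coeff_hardy f n * cnj (coeff_hardy g n))"
  by (intro square_summable_mult_cnj hardy_summable)

lemma cinner_commute: "cinner f g = cnj (cinner g f)"
proof -
  have "(\<lambda>n. coeff_hardy g n * cnj (coeff_hardy f n)) sums cinner g f"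
    unfolding cinner_def by (rule summable_sums[OF cinner_summable])
  then have "(\<lambda>n. cnj (coeff_hardy g n * cnj (coeff_hardy f n))) sums cnj (cinner g f)"
    by (simp only: sums_cnj)
  then have "(\<lambda>n. coeff_hardy f n * cnj (coeff_hardy g n)) sums cnj (cinner g f)"
    by (simp only: complex_cnj_mult complex_cnj_cnj mult.commute)
  then show ?thesis
    unfolding cinner_def[of f g] by (rule sums_unique[symmetric])
qed

lemma cinner_add_left: "cinner (f + g) h = cinner f h + cinner g h"
  unfolding cinner_def
  by (subst suminf_add[OF cinner_summable cinner_summable]) (simp add: algebra_simps)

lemma cinner_scaleC_left: "cinner (c *\<^sub>C f) g = c * cinner f g"
  unfolding cinner_def
  by (subst suminf_mult[OF cinner_summable, symmetric]) (simp add: algebra_simps)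

lemma cinner_self: "cinner f f = complex_of_real (\<Sum>n. (cmod (coeff_hardy f n))\<^sup>2)"
proof -
  have "(\<lambda>n. complex_of_real ((cmod (coeff_hardy f n))\<^sup>2))
      sums complex_of_real (\<Sum>n. (cmod (coeff_hardy f n))\<^sup>2)"
    by (intro sums_of_real summable_sums hardy_summable)
  then show ?thesis
    unfolding cinner_def complex_norm_square by (rule sums_unique[symmetric])
qed

text \<open>The underlying real Hilbert space structure; it has the same norm as the complex one.\<close>

instantiation hardy2 :: real_inner
begin

definition inner_hardy2 :: "hardy2 \<Rightarrow> hardy2 \<Rightarrow> real" where
  "inner_hardy2 f g = Re (cinner f g)"

definition norm_hardy2 :: "hardy2 \<Rightarrow> real" where
  "norm_hardy2 f = sqrt (inner f f)"

definition sgn_hardy2 :: "hardy2 \<Rightarrow> hardy2" where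
  "sgn_hardy2 f = f /\<^sub>R norm f"

definition dist_hardy2 :: "hardy2 \<Rightarrow> hardy2 \<Rightarrow> real" where
  "dist_hardy2 f g = norm (f - g)"

definition uniformity_hardy2 :: "(hardy2 \<times> hardy2) filter" where
  "uniformity_hardy2 = (INF e\<in>{0 <..}. principal {(x, y). dist x y < e})"

definition open_hardy2 :: "hardy2 set \<Rightarrow> bool" where
  "open_hardy2 U \<longleftrightarrow> (\<forall>x\<in>U. eventually (\<lambda>(x', y). x' = x \<longrightarrow> y \<in> U) uniformity)"

instance
proof
  fix f g h :: hardy2 and r :: real and U :: "hardy2 set"
  show "dist f g = norm (f - g)" by (simp add: dist_hardy2_def)
  show "sgn f = f /\<^sub>R norm f" by (simp add: sgn_hardy2_def)
  show "uniformity = (INF e\<in>{0 <..}. principal {(x, y :: hardy2). dist x y < e})"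
    by (simp add: uniformity_hardy2_def)
  show "open U \<longleftrightarrow> (\<forall>x\<in>U. \<forall>\<^sub>F (x', y) in uniformity. x' = x \<longrightarrow> y \<in> U)"
    by (simp add: open_hardy2_def)
  show "inner f g = inner g f"
    unfolding inner_hardy2_def by (subst cinner_commute) simp
  show "inner (f + g) h = inner f h + inner g h"
    by (simp add: inner_hardy2_def cinner_add_left)
  show "inner (r *\<^sub>R f) g = r * inner f g"
    by (simp add: inner_hardy2_def scaleR_conv_scaleC cinner_scaleC_left)
  show "0 \<le> inner f f"
    by (simp add: inner_hardy2_def cinner_self suminf_nonneg hardy_summable)
  show "inner f f = 0 \<longleftrightarrow> f = 0"
  proof
    assume "inner f f = 0"
    then have "(\<Sum>n. (cmod (coeff_hardy f n))\<^sup>2) = 0"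
      by (simp add: inner_hardy2_def cinner_self)
    then have "coeff_hardy f n = 0" for n
      by (subst (asm) suminf_eq_zero_iff[OF hardy_summable]) auto
    then show "f = 0" by (intro hardy_eqI) simp
  qed (simp add: inner_hardy2_def cinner_self)
  show "norm f = sqrt (inner f f)" by (simp add: norm_hardy2_def)
qed

end

lemma norm_hardy2_square: "(norm f)\<^sup>2 = (\<Sum>n. (cmod (coeff_hardy f n))\<^sup>2)"
  by (simp add: power2_norm_eq_inner inner_hardy2_def cinner_self)

lemma sum_coeff_le: "(\<Sum>n<N. (cmod (coeff_hardy f n))\<^sup>2) \<le> (norm f)\<^sup>2"
  unfolding norm_hardy2_square by (rule sum_le_suminf[OF hardy_summable]) auto

lemma coeff_le_norm: "cmod (coeff_hardy f n) \<le> norm f"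
proof -
  have "(cmod (coeff_hardy f n))\<^sup>2 \<le> (\<Sum>k<Suc n. (cmod (coeff_hardy f k))\<^sup>2)"
    by (simp add: sum_nonneg)
  also have "\<dots> \<le> (norm f)\<^sup>2" by (rule sum_coeff_le)
  finally show ?thesis by (simp add: power2_le_iff_abs_le)
qed

instance hardy2 :: banach
proof
  fix F :: "nat \<Rightarrow> hardy2"
  assume F: "Cauchy F"
  have "Cauchy (\<lambda>n. coeff_hardy (F n) k)" for k
  proof (rule CauchyI)
    fix e :: real assume "0 < e"
    from CauchyD[OF F this] obtain M
      where M: "\<And>m n. m \<ge> M \<Longrightarrow> n \<ge> M \<Longrightarrow> norm (F m - F n) < e" by blast
    have "norm (coeff_hardy (F m) k - coeff_hardy (F n) k) < e" if "m \<ge> M" "n \<ge> M" for m n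
      using coeff_le_norm[of "F m - F n" k] M[OF that] by simp
    then show "\<exists>M. \<forall>m\<ge>M. \<forall>n\<ge>M. norm (coeff_hardy (F m) k - coeff_hardy (F n) k) < e" by blast
  qed
  then have "\<forall>k. \<exists>l. (\<lambda>n. coeff_hardy (F n) k) \<longlonglongrightarrow> l"
    by (simp add: Cauchy_convergent_iff convergent_def)
  then obtain c where c: "\<And>k. (\<lambda>n. coeff_hardy (F n) k) \<longlonglongrightarrow> c k" by metis
  have bd: "\<exists>M. \<forall>m\<ge>M. \<forall>N. (\<Sum>k<N. (cmod (coeff_hardy (F m) k - c k))\<^sup>2) \<le> e\<^sup>2"
    if "e > 0" for e
  proof -
    from CauchyD[OF F that] obtain M
      where M: "\<And>m n. m \<ge> M \<Longrightarrow> n \<ge> M \<Longrightarrow> norm (F m - F n) < e" by blast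
    have "(\<Sum>k<N. (cmod (coeff_hardy (F m) k - c k))\<^sup>2) \<le> e\<^sup>2" if m: "m \<ge> M" for m N
    proof (rule tendsto_upperbound)
      show "(\<lambda>n. \<Sum>k<N. (cmod (coeff_hardy (F m) k - coeff_hardy (F n) k))\<^sup>2)
              \<longlonglongrightarrow> (\<Sum>k<N. (cmod (coeff_hardy (F m) k - c k))\<^sup>2)"
        by (intro tendsto_intros c)
      show "\<forall>\<^sub>F n in sequentially.
              (\<Sum>k<N. (cmod (coeff_hardy (F m) k - coeff_hardy (F n) k))\<^sup>2) \<le> e\<^sup>2"
      proof (rule eventually_sequentiallyI[of M])
        fix n assume "M \<le> n"
        have "(\<Sum>k<N. (cmod (coeff_hardy (F m) k - coeff_hardy (F n) k))\<^sup>2) \<le> (norm (F m - F n))\<^sup>2"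
          using sum_coeff_le[of "F m - F n" N] by simp
        also have "\<dots> \<le> e\<^sup>2"
          using M[OF m \<open>M \<le> n\<close>] by (intro power_mono) auto
        finally show "(\<Sum>k<N. (cmod (coeff_hardy (F m) k - coeff_hardy (F n) k))\<^sup>2) \<le> e\<^sup>2" .
      qed
    qed simp
    then show ?thesis by blast
  qed
  have sm: "summable (\<lambda>k. (cmod (c k))\<^sup>2)"
  proof -
    obtain M where M: "\<And>N. (\<Sum>k<N. (cmod (coeff_hardy (F M) k - c k))\<^sup>2) \<le> 1\<^sup>2"
      using bd[of 1] by auto
    have "summable (\<lambda>k. (cmod (coeff_hardy (F M) k - c k))\<^sup>2)"
      by (rule bounded_imp_summable[of _ 1]) (use M[of "Suc _"] in \<open>auto simp: lessThan_Suc_atMost\<close>)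
    from square_summable_add[OF square_summable_cmult[OF this, of "-1"] hardy_summable[of "F M"]]
    show ?thesis by simp
  qed
  from coeff_hardy_exists[OF this] obtain f where f: "coeff_hardy f = c" by blast
  have "F \<longlonglongrightarrow> f"
  proof (rule LIMSEQ_I)
    fix r :: real assume "0 < r"
    then have "r / 2 > 0" by simp
    from bd[OF this] obtain M
      where M: "\<And>m N. m \<ge> M \<Longrightarrow> (\<Sum>k<N. (cmod (coeff_hardy (F m) k - c k))\<^sup>2) \<le> (r / 2)\<^sup>2" by blast
    have "norm (F m - f) < r" if "m \<ge> M" for m
    proof -
      have "(norm (F m - f))\<^sup>2 \<le> (r / 2)\<^sup>2"
        unfolding norm_hardy2_square
        by (rule suminf_le_const[OF hardy_summable]) (use M[OF that] in \<open>simp add: f\<close>)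
      then have "norm (F m - f) \<le> r / 2"
        using \<open>0 < r\<close> by (simp add: power2_le_iff_abs_le)
      with \<open>0 < r\<close> show ?thesis by simp
    qed
    then show "\<exists>no. \<forall>n\<ge>no. norm (F n - f) < r" by blast
  qed
  then show "convergent F" by (auto simp: convergent_def)
qed

section \<open>Bounded complex-linear operators\<close>

text \<open>
  The Banach algebra of bounded operators on \<open>H\<^sup>2\<close>, with composition as product and the operator
  norm. Being an instance of \<^class>\<open>banach\<close> and \<^class>\<open>real_normed_algebra_1\<close>, it inherits
  the operator exponential from \<^const>\<open>exp\<close>.
\<close>

typedef hardy_op = "{T :: hardy2 \<Rightarrow>\<^sub>L hardy2. \<forall>c f. blinfun_apply T (c *\<^sub>C f) = c *\<^sub>C blinfun_apply T f}"
  morphisms blinfun_of_op Abs_hardy_op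
  by (rule exI[of _ 0]) (auto intro: hardy_eqI)

setup_lifting type_definition_hardy_op

lemma scaleC_add_right: "c *\<^sub>C (f + g) = c *\<^sub>C f + c *\<^sub>C g"
  by (rule hardy_eqI) (simp add: algebra_simps)

lemma scaleC_scaleR: "c *\<^sub>C (r *\<^sub>R f) = r *\<^sub>R (c *\<^sub>C f)"
  by (rule hardy_eqI) simp

lemma scaleC_minus_right: "c *\<^sub>C (- f) = - (c *\<^sub>C f)"
  by (rule hardy_eqI) simp

lemma scaleC_diff_right: "c *\<^sub>C (f - g) = c *\<^sub>C f - c *\<^sub>C g"
  by (rule hardy_eqI) (simp add: algebra_simps)

lemma scaleC_scaleC: "c *\<^sub>C d *\<^sub>C f = (c * d) *\<^sub>C f"
  by (rule hardy_eqI) simp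

lemma norm_scaleC: "norm (c *\<^sub>C f) = cmod c * norm f"
proof -
  have "(norm (c *\<^sub>C f))\<^sup>2 = (cmod c * norm f)\<^sup>2"
    by (simp add: norm_hardy2_square power_mult_distrib norm_mult
        suminf_mult[OF hardy_summable])
  then show ?thesis by (simp add: power2_eq_iff_nonneg)
qed

lemma bounded_linear_scaleC: "bounded_linear (\<lambda>f. c *\<^sub>C f)"
  by (rule bounded_linear_intro[where K = "cmod c"])
     (simp_all add: scaleC_add_right scaleC_scaleR norm_scaleC)

lemma hardy_op_eqI: "(\<And>f. blinfun_apply (blinfun_of_op S) f = blinfun_apply (blinfun_of_op T) f) \<Longrightarrow> S = T"
  by (metis blinfun_eqI blinfun_of_op_inject)

instantiation hardy_op :: real_vector
begin

lift_definition zero_hardy_op :: hardy_op is 0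
  by (auto intro: hardy_eqI)

lift_definition plus_hardy_op :: "hardy_op \<Rightarrow> hardy_op \<Rightarrow> hardy_op" is "(+)"
  by (simp add: blinfun.add_left scaleC_add_right)

lift_definition uminus_hardy_op :: "hardy_op \<Rightarrow> hardy_op" is uminus
  by (simp add: blinfun.minus_left scaleC_minus_right)

lift_definition minus_hardy_op :: "hardy_op \<Rightarrow> hardy_op \<Rightarrow> hardy_op" is "(-)"
  by (simp add: blinfun.diff_left scaleC_diff_right)

lift_definition scaleR_hardy_op :: "real \<Rightarrow> hardy_op \<Rightarrow> hardy_op" is "(*\<^sub>R)"
  by (simp add: blinfun.scaleR_left scaleC_scaleR)

instance
proof
  fix R S T :: hardy_op and a b :: real
  show "R + S + T = R + (S + T)" by transfer simp
  show "S + T = T + S" by transfer simp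
  show "0 + T = T" by transfer simp
  show "- T + T = 0" by transfer simp
  show "S - T = S + - T" by transfer simp
  show "a *\<^sub>R (S + T) = a *\<^sub>R S + a *\<^sub>R T" by transfer (simp add: scaleR_add_right)
  show "(a + b) *\<^sub>R T = a *\<^sub>R T + b *\<^sub>R T" by transfer (simp add: scaleR_add_left)
  show "a *\<^sub>R b *\<^sub>R T = (a * b) *\<^sub>R T" by transfer simp
  show "1 *\<^sub>R T = T" by transfer simp
qed

end

instantiation hardy_op :: real_normed_algebra_1
begin

lift_definition one_hardy_op :: hardy_op is id_blinfun
  by simp

lift_definition times_hardy_op :: "hardy_op \<Rightarrow> hardy_op \<Rightarrow> hardy_op" is blinfun_compose
  by simp

lift_definition norm_hardy_op :: "hardy_op \<Rightarrow> real" is norm .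

definition sgn_hardy_op :: "hardy_op \<Rightarrow> hardy_op" where
  "sgn_hardy_op T = T /\<^sub>R norm T"

definition dist_hardy_op :: "hardy_op \<Rightarrow> hardy_op \<Rightarrow> real" where
  "dist_hardy_op S T = norm (S - T)"

definition uniformity_hardy_op :: "(hardy_op \<times> hardy_op) filter" where
  "uniformity_hardy_op = (INF e\<in>{0 <..}. principal {(x, y). dist x y < e})"

definition open_hardy_op :: "hardy_op set \<Rightarrow> bool" where
  "open_hardy_op U \<longleftrightarrow> (\<forall>x\<in>U. eventually (\<lambda>(x', y). x' = x \<longrightarrow> y \<in> U) uniformity)"

instance
proof
  fix R S T :: hardy_op and a b :: real and U :: "hardy_op set"
  show "dist S T = norm (S - T)" by (simp add: dist_hardy_op_def)
  show "sgn T = T /\<^sub>R norm T" by (simp add: sgn_hardy_op_def)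
  show "uniformity = (INF e\<in>{0 <..}. principal {(x, y :: hardy_op). dist x y < e})"
    by (simp add: uniformity_hardy_op_def)
  show "open U \<longleftrightarrow> (\<forall>x\<in>U. \<forall>\<^sub>F (x', y) in uniformity. x' = x \<longrightarrow> y \<in> U)"
    by (simp add: open_hardy_op_def)
  show "R * S * T = R * (S * T)" by transfer (auto intro!: blinfun_eqI)
  show "(R + S) * T = R * T + S * T"
    by transfer (auto intro!: blinfun_eqI simp: blinfun.bilinear_simps)
  show "R * (S + T) = R * S + R * T"
    by transfer (auto intro!: blinfun_eqI simp: blinfun.bilinear_simps)
  show "a *\<^sub>R S * T = a *\<^sub>R (S * T)"
    by transfer (auto intro!: blinfun_eqI simp: blinfun.bilinear_simps)
  show "S * a *\<^sub>R T = a *\<^sub>R (S * T)"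
    by transfer (auto intro!: blinfun_eqI simp: blinfun.bilinear_simps)
  show "1 * T = T" by transfer (auto intro!: blinfun_eqI)
  show "T * 1 = T" by transfer (auto intro!: blinfun_eqI)
  have "summable (\<lambda>n::nat. (cmod (if n = 0 then 1 else 0))\<^sup>2)"
    by (rule summable_finite[of "{0}"]) auto
  from coeff_hardy_exists[OF this] obtain u :: hardy2
    where u: "coeff_hardy u = (\<lambda>n. if n = 0 then 1 else 0)" by blast
  have "u \<noteq> 0" using u by (metis coeff_zero zero_neq_one)
  show "(0 :: hardy_op) \<noteq> 1"
  proof transfer
    show "(0 :: hardy2 \<Rightarrow>\<^sub>L hardy2) \<noteq> id_blinfun"
    proof
      assume "(0 :: hardy2 \<Rightarrow>\<^sub>L hardy2) = id_blinfun"
      then have "blinfun_apply 0 u = blinfun_apply id_blinfun u" by (rule arg_cong)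
      with \<open>u \<noteq> 0\<close> show False by simp
    qed
  qed
  show "norm T = 0 \<longleftrightarrow> T = 0" by transfer simp
  show "norm (S + T) \<le> norm S + norm T" by transfer (rule norm_triangle_ineq)
  show "norm (a *\<^sub>R T) = \<bar>a\<bar> * norm T" by transfer simp
  show "norm (S * T) \<le> norm S * norm T" by transfer (rule norm_blinfun_compose)
  show "norm (1 :: hardy_op) = 1"
  proof transfer
    show "norm (id_blinfun :: hardy2 \<Rightarrow>\<^sub>L hardy2) = 1"
    proof (rule antisym)
      show "norm (id_blinfun :: hardy2 \<Rightarrow>\<^sub>L hardy2) \<le> 1"
        by (rule norm_blinfun_bound) auto
      have "norm u \<le> norm (id_blinfun :: hardy2 \<Rightarrow>\<^sub>L hardy2) * norm u"
        using norm_blinfun[of "id_blinfun :: hardy2 \<Rightarrow>\<^sub>L hardy2" u] by simp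
      then show "1 \<le> norm (id_blinfun :: hardy2 \<Rightarrow>\<^sub>L hardy2)"
        using \<open>u \<noteq> 0\<close> by simp
    qed
  qed
qed

end

instance hardy_op :: banach
proof
  fix F :: "nat \<Rightarrow> hardy_op"
  assume F: "Cauchy F"
  have "Cauchy (\<lambda>n. blinfun_of_op (F n))"
    using F unfolding Cauchy_def dist_norm
    by (simp add: minus_hardy_op.rep_eq[symmetric] norm_hardy_op.rep_eq[symmetric])
  then obtain L where L: "(\<lambda>n. blinfun_of_op (F n)) \<longlonglongrightarrow> L"
    by (auto simp: Cauchy_convergent_iff convergent_def)
  have app: "(\<lambda>n. blinfun_apply (blinfun_of_op (F n)) f) \<longlonglongrightarrow> blinfun_apply L f" for f
    by (intro tendsto_intros L)
  have "blinfun_apply L (c *\<^sub>C f) = c *\<^sub>C blinfun_apply L f" for c f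
  proof (rule LIMSEQ_unique[OF app])
    have "(\<lambda>n. c *\<^sub>C blinfun_apply (blinfun_of_op (F n)) f) \<longlonglongrightarrow> c *\<^sub>C blinfun_apply L f"
      by (rule bounded_linear.tendsto[OF bounded_linear_scaleC app])
    then show "(\<lambda>n. blinfun_apply (blinfun_of_op (F n)) (c *\<^sub>C f)) \<longlonglongrightarrow> c *\<^sub>C blinfun_apply L f"
      using blinfun_of_op by simp
  qed
  then have "blinfun_of_op (Abs_hardy_op L) = L"
    by (simp add: Abs_hardy_op_inverse)
  then have "F \<longlonglongrightarrow> Abs_hardy_op L"
    using L unfolding LIMSEQ_iff
    by (simp add: norm_hardy_op.rep_eq minus_hardy_op.rep_eq)
  then show "convergent F" by (auto simp: convergent_def)
qed

definition op_apply :: "hardy_op \<Rightarrow> hardy2 \<Rightarrow> hardy2" where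
  "op_apply T = blinfun_apply (blinfun_of_op T)"

lift_definition scaleC_op :: "complex \<Rightarrow> hardy_op \<Rightarrow> hardy_op"
  is "\<lambda>c T. blinfun_compose (Blinfun (\<lambda>f. c *\<^sub>C f)) T"
  by (simp add: bounded_linear_Blinfun_apply[OF bounded_linear_scaleC] scaleC_scaleC mult.commute)

lemma op_apply_scaleC_op: "op_apply (scaleC_op c T) f = c *\<^sub>C op_apply T f"
  by (simp add: op_apply_def scaleC_op.rep_eq bounded_linear_Blinfun_apply[OF bounded_linear_scaleC])

definition self_adjoint :: "hardy_op \<Rightarrow> bool" where
  "self_adjoint X \<longleftrightarrow> (\<forall>f g. cinner (op_apply X f) g = cinner f (op_apply X g))"

section \<open>The Grassmann manifold and its geodesics\<close>

definition Gr :: "hardy2 set set" where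
  "Gr = {S. closed S \<and> 0 \<in> S \<and> (\<forall>f\<in>S. \<forall>g\<in>S. f + g \<in> S) \<and> (\<forall>c. \<forall>f\<in>S. c *\<^sub>C f \<in> S)}"

definition ortho :: "hardy2 set \<Rightarrow> hardy2 set" where
  "ortho S = {g. \<forall>f\<in>S. cinner f g = 0}"

definition co_diagonal :: "hardy_op \<Rightarrow> hardy2 set \<Rightarrow> bool" where
  "co_diagonal X S \<longleftrightarrow> op_apply X ` S \<subseteq> ortho S \<and> op_apply X ` ortho S \<subseteq> S"

definition exp_i :: "hardy_op \<Rightarrow> hardy_op" where
  "exp_i X = exp (scaleC_op \<i> X)"

text \<open>
  A geodesic from \<open>S\<close> to \<open>T\<close> is a curve \<open>\<delta>(t) = e\<^sup>i\<^sup>t\<^sup>X S\<close> with \<open>X\<close> self-adjoint and co-diagonal with respect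
  to \<open>S\<close>, and it is minimal if \<open>X\<close> can be chosen with \<open>\<parallel>X\<parallel> \<le> \<pi>/2\<close>.
  Curves parametrized by \<open>[0,1]\<close> are taken in the extensional function space, so that
  equality of curves is equality on \<open>[0,1]\<close>.
\<close>

definition geodesic_with :: "hardy_op \<Rightarrow> (real \<Rightarrow> hardy2 set) \<Rightarrow> hardy2 set \<Rightarrow> hardy2 set \<Rightarrow> bool" where
  "geodesic_with X \<delta> S T \<longleftrightarrow>
     \<delta> \<in> {0..1} \<rightarrow>\<^sub>E Gr \<and> self_adjoint X \<and> co_diagonal X S \<and>
     (\<forall>t\<in>{0..1}. \<delta> t = op_apply (exp_i (t *\<^sub>R X)) ` S) \<and> op_apply (exp_i X) ` S = T"

definition geodesic :: "(real \<Rightarrow> hardy2 set) \<Rightarrow> hardy2 set \<Rightarrow> hardy2 set \<Rightarrow> bool" where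
  "geodesic \<delta> S T \<longleftrightarrow> (\<exists>X. geodesic_with X \<delta> S T)"

definition minimal_geodesic :: "(real \<Rightarrow> hardy2 set) \<Rightarrow> hardy2 set \<Rightarrow> hardy2 set \<Rightarrow> bool" where
  "minimal_geodesic \<delta> S T \<longleftrightarrow> (\<exists>X. geodesic_with X \<delta> S T \<and> norm X \<le> pi / 2)"

section \<open>Zero sets\<close>

text \<open>Unordered summation over the set itself; its convergence forces \<open>A\<close> to be countable.\<close>

definition blaschke :: "complex set \<Rightarrow> bool" where
  "blaschke A \<longleftrightarrow> (\<lambda>a. 1 - cmod a) summable_on A"

definition lim_set :: "complex set \<Rightarrow> complex set" where
  "lim_set A = closure A - A"

definition zero_space :: "complex set \<Rightarrow> hardy2 set" where
  "zero_space A = {f. \<forall>a\<in>A. hardy_eval f a = 0}"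

end

theory Submission
  imports Defs
begin

text \<open>
  Two closed subspaces \<open>S\<close>, \<open>T\<close> with \<open>S \<inter> T\<^sup>\<bottom> = S\<^sup>\<bottom> \<inter> T = 0\<close> are joined by a unique minimal geodesic. If
  \<open>E\<close>, \<open>F\<close> are the reflections in \<open>S\<close>, \<open>T\<close>, then a co-diagonal \<open>X\<close> with \<open>e\<^sup>i\<^sup>X S = T\<close> satisfies
  \<open>e\<^sup>2\<^sup>i\<^sup>X = F E\<close>, and \<open>-1\<close> is not an eigenvalue of the unitary \<open>F E\<close>. Since \<open>1 + F E = e\<^sup>i\<^sup>X \<cdot> 2 cos X\<close> and
  \<open>cos X \<ge> 0\<close>, the operator \<open>e\<^sup>i\<^sup>X\<close> is the unitary part of the polar decomposition of \<open>1 + F E\<close>, and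
  \<open>X\<close> is recovered as \<open>arcsin (sin X)\<close>.

  For zero sets, let \<open>\<zeta>\<close> be a limit point of \<open>a\<close> that is not one of \<open>b\<close>. The expansion of
  \<open>f \<in> Z\<^sub>b\<^sup>\<bottom>\<close> in the Takenaka-Malmquist basis converges uniformly near \<open>\<zeta>\<close>, also outside the disk, so \<open>f\<close>
  extends holomorphically across \<open>\<zeta>\<close>. If \<open>f\<close> also vanishes on \<open>a\<close>, its zeros accumulate at \<open>\<zeta>\<close> and
  \<open>f = 0\<close>.
\<close>

section \<open>Operators on the Hardy space\<close>

text \<open>The hypotheses only say that \<open>-1\<close> is not an eigenvalue of
  \<open>F E\<close>; it may still lie in the spectrum. So \<open>1 + F E\<close> is injective with
  dense range but need not be invertible, and \<open>X\<close> cannot be taken as a continuous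
  logarithm of \<open>F E\<close>, whose cut would pass through the spectrum. The polar
  decomposition avoids this: its unitary part is an isometry defined on a dense range and extended
  by continuity, and identities for it are checked after multiplication by the injective positive
  factor, which is then cancelled. The spectrum of the unitary part lies in the closed right half of
  the circle, where the angle is a continuous function of the sine. Hence \<open>arcsin\<close> on a
  closed interval suffices, and its range yields the bound \<open>pi / 2\<close>. The two
  non-inclusions of limit sets play symmetric roles: each one annihilates one of the two
  intersections of a zero space with the complement of the other.\<close>

lemma op_eqI: "(\<And>f. op_apply S f = op_apply T f) \<Longrightarrow> S = T"
  unfolding op_apply_def by (rule hardy_op_eqI)

lemma op_apply_add_right: "op_apply T (f + g) = op_apply T f + op_apply T g"
  by (simp add: op_apply_def blinfun.add_right)

lemma op_apply_diff_right: "op_apply T (f - g) = op_apply T f - op_apply T g"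
  by (simp add: op_apply_def blinfun.diff_right)

lemma op_apply_scaleC_right: "op_apply T (c *\<^sub>C f) = c *\<^sub>C op_apply T f"
  using blinfun_of_op by (simp add: op_apply_def)

lemma op_apply_0_right [simp]: "op_apply T 0 = 0"
  by (simp add: op_apply_def blinfun.zero_right)

lemma op_apply_add [simp]: "op_apply (S + T) f = op_apply S f + op_apply T f"
  by (simp add: op_apply_def plus_hardy_op.rep_eq blinfun.add_left)

lemma op_apply_diff [simp]: "op_apply (S - T) f = op_apply S f - op_apply T f"
  by (simp add: op_apply_def minus_hardy_op.rep_eq blinfun.diff_left)

lemma op_apply_minus [simp]: "op_apply (- T) f = - op_apply T f"
  by (simp add: op_apply_def uminus_hardy_op.rep_eq blinfun.minus_left)

lemma op_apply_scaleR [simp]: "op_apply (r *\<^sub>R T) f = r *\<^sub>R op_apply T f"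
  by (simp add: op_apply_def scaleR_hardy_op.rep_eq blinfun.scaleR_left)

lemma op_apply_0 [simp]: "op_apply 0 f = 0"
  by (simp add: op_apply_def zero_hardy_op.rep_eq)

lemma op_apply_1 [simp]: "op_apply 1 f = f"
  by (simp add: op_apply_def one_hardy_op.rep_eq)

lemma op_apply_mult [simp]: "op_apply (S * T) f = op_apply S (op_apply T f)"
  by (simp add: op_apply_def times_hardy_op.rep_eq)

lemma norm_op_apply: "norm (op_apply T f) \<le> norm T * norm f"
  by (simp add: op_apply_def norm_hardy_op.rep_eq norm_blinfun)

lemma norm_op_bound: "0 \<le> M \<Longrightarrow> (\<And>f. norm (op_apply T f) \<le> M * norm f) \<Longrightarrow> norm T \<le> M"
  by (simp add: op_apply_def norm_hardy_op.rep_eq norm_blinfun_bound)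

lemma bounded_linear_op_apply: "bounded_linear (op_apply T)"
  by (simp add: op_apply_def blinfun.bounded_linear_right)

lemma bounded_linear_op_apply_left: "bounded_linear (\<lambda>T. op_apply T f)"
  by (rule bounded_linear_intro[where K = "norm f"])
     (use norm_op_apply in \<open>simp_all add: mult.commute\<close>)

lemma op_exists:
  assumes "\<And>f g. F (f + g) = F f + F g" "\<And>c f. F (c *\<^sub>C f) = c *\<^sub>C F f"
    "\<And>f. norm (F f) \<le> K * norm f"
  obtains T where "\<And>f. op_apply T f = F f"
proof
  have bl: "bounded_linear F"
    by (rule bounded_linear_intro[where K = K])
       (use assms in \<open>simp_all add: scaleR_conv_scaleC mult.commute\<close>)
  show "op_apply (Abs_hardy_op (Blinfun F)) f = F f" for f
    by (simp add: op_apply_def Abs_hardy_op_inverse bounded_linear_Blinfun_apply[OF bl] assms)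
qed

lemma op_apply_scaleC_op_1 [simp]: "op_apply (scaleC_op c 1) f = c *\<^sub>C f"
  by (simp add: op_apply_scaleC_op)

lemma scaleC_one [simp]: "1 *\<^sub>C f = f"
  by (rule hardy_eqI) simp

lemma scaleC_zero [simp]: "0 *\<^sub>C f = 0"
  by (rule hardy_eqI) simp

lemma scaleC_zero_right [simp]: "c *\<^sub>C (0::hardy2) = 0"
  by (rule hardy_eqI) simp

lemma scaleC_add_left: "(c + d) *\<^sub>C f = c *\<^sub>C f + d *\<^sub>C f"
  by (rule hardy_eqI) (simp add: algebra_simps)

lemma scaleC_diff_left: "(c - d) *\<^sub>C f = c *\<^sub>C f - d *\<^sub>C f"
  by (rule hardy_eqI) (simp add: algebra_simps)

lemma hardy_eval_0 [simp]: "hardy_eval 0 z = 0"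
  by (simp add: zero_hardy2.rep_eq)

lemma hardy_eval_add [simp]: "hardy_eval (f + g) z = hardy_eval f z + hardy_eval g z"
  by (simp add: plus_hardy2.rep_eq)

lemma hardy_eval_scaleC [simp]: "hardy_eval (c *\<^sub>C f) z = c * hardy_eval f z"
  by (simp add: scaleC.rep_eq)

lemma hardy_eval_diff [simp]: "hardy_eval (f - g) z = hardy_eval f z - hardy_eval g z"
  unfolding minus_hardy2_def by (simp only: hardy_eval_add uminus_hardy2.rep_eq) simp

text \<open>The operators form a real normed algebra; multiplication by the central elements
  \<open>sc c\<close> supplies the complex scalars within it.\<close>

abbreviation sc :: "complex \<Rightarrow> hardy_op" where
  "sc c \<equiv> scaleC_op c 1"

lemma scaleC_op_conv_sc: "scaleC_op c T = sc c * T"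
  by (rule op_eqI) (simp add: op_apply_scaleC_op)

lemma sc_commute: "T * sc c = sc c * T"
  by (rule op_eqI) (simp add: op_apply_scaleC_right)

lemma sc_mult: "sc (c * d) = sc c * sc d"
  by (rule op_eqI) (simp add: scaleC_scaleC)

lemma sc_add: "sc (c + d) = sc c + sc d"
  by (rule op_eqI) (simp add: scaleC_add_left)

lemma sc_diff: "sc (c - d) = sc c - sc d"
  by (rule op_eqI) (simp add: scaleC_diff_left)

lemma sc_0 [simp]: "sc 0 = 0" and sc_1 [simp]: "sc 1 = 1"
  by (auto intro: op_eqI)

lemma sc_minus: "sc (- c) = - sc c"
  using sc_diff[of 0 c] by simp

lemma sc_of_real: "sc (complex_of_real r) = r *\<^sub>R 1"
  by (rule op_eqI) (simp add: scaleR_conv_scaleC)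

lemma ex_nonzero: "\<exists>f::hardy2. f \<noteq> 0"
proof (rule ccontr)
  assume "\<nexists>f::hardy2. f \<noteq> 0"
  then have "(0::hardy_op) = 1" by (intro op_eqI) simp
  then show False by simp
qed

lemma norm_sc: "norm (sc c) = cmod c"
proof (rule antisym)
  show "norm (sc c) \<le> cmod c"
    by (rule norm_op_bound) (simp_all add: norm_scaleC)
  obtain x :: hardy2 where "x \<noteq> 0" using ex_nonzero by blast
  then show "cmod c \<le> norm (sc c)"
    using norm_op_apply[of "sc c" x] by (simp add: norm_scaleC)
qed

lemma sc_II: "sc \<i> * sc \<i> = - 1"
  by (simp flip: sc_mult add: sc_minus)

section \<open>Inner product and adjoints\<close>

lemma cinner_add_right: "cinner f (g + h) = cinner f g + cinner f h"
  by (metis cinner_add_left cinner_commute complex_cnj_add)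

lemma cinner_scaleC_right: "cinner f (c *\<^sub>C g) = cnj c * cinner f g"
  by (metis cinner_commute cinner_scaleC_left complex_cnj_mult)

lemma cinner_norm: "cinner f f = complex_of_real ((norm f)\<^sup>2)"
  by (simp add: cinner_self norm_hardy2_square)

lemma cinner_diff_left: "cinner (f - g) h = cinner f h - cinner g h"
  using cinner_add_left[of "f - g" g h] by simp

lemma cinner_diff_right: "cinner f (g - h) = cinner f g - cinner f h"
  using cinner_add_right[of f "g - h" h] by simp

lemma cinner_zero [simp]: "cinner 0 f = 0" "cinner f 0 = 0"
  by (simp_all add: cinner_def)

lemma cinner_eq_0D: "(\<And>f. cinner f g = 0) \<Longrightarrow> g = 0"
  using cinner_norm[of g] by simp

lemma norm_diff_square: "(norm (f - g))\<^sup>2 = (norm f)\<^sup>2 - 2 * Re (cinner f g) + (norm (g::hardy2))\<^sup>2"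
  by (simp add: power2_norm_eq_inner inner_diff_left inner_diff_right inner_commute
      inner_hardy2_def[of f g, symmetric])

text \<open>A unimodular multiple of \<open>f\<close> makes the inner product real and nonnegative,
  so the Cauchy-Schwarz inequality of the real inner product applies.\<close>

lemma cinner_le: "cmod (cinner f g) \<le> norm f * norm g"
proof (cases "cinner f g = 0")
  case False
  define c where "c = cnj (sgn (cinner f g))"
  have c: "cmod c = 1" using False by (simp add: c_def norm_sgn)
  have "c * cinner f g = complex_of_real (cmod (cinner f g))"
    using False complex_norm_square[of "cinner f g"]
    by (simp add: c_def sgn_eq power2_eq_square field_simps)
  then have "cmod (cinner f g) = inner (c *\<^sub>C f) g"
    by (simp add: inner_hardy2_def cinner_scaleC_left)
  also have "\<dots> \<le> norm (c *\<^sub>C f) * norm g" by (rule norm_cauchy_schwarz)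
  finally show ?thesis by (simp add: norm_scaleC c)
qed simp

lemma bounded_bilinear_cinner: "bounded_bilinear cinner"
proof
  show "\<exists>K. \<forall>a b. norm (cinner a b) \<le> norm a * norm b * K"
    using cinner_le by (intro exI[of _ 1]) simp
qed (simp_all add: cinner_add_left cinner_add_right scaleR_conv_scaleC cinner_scaleC_left
      cinner_scaleC_right scaleR_conv_of_real)

lemmas tendsto_cinner = bounded_bilinear.tendsto[OF bounded_bilinear_cinner]

text \<open>A relation rather than an operation: every adjoint that occurs is known explicitly and
  can be exhibited.\<close>

definition adj :: "hardy_op \<Rightarrow> hardy_op \<Rightarrow> bool" where
  "adj T T' \<longleftrightarrow> (\<forall>f g. cinner (op_apply T f) g = cinner f (op_apply T' g))"

lemma adjD: "adj T T' \<Longrightarrow> cinner (op_apply T f) g = cinner f (op_apply T' g)"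
  by (simp add: adj_def)

lemma self_adjoint_adj: "self_adjoint T \<longleftrightarrow> adj T T"
  by (simp add: self_adjoint_def adj_def)

lemma adj_sym: "adj T T' \<Longrightarrow> adj T' T"
  unfolding adj_def by (metis cinner_commute)

lemma adj_add: "adj S S' \<Longrightarrow> adj T T' \<Longrightarrow> adj (S + T) (S' + T')"
  by (simp add: adj_def cinner_add_left cinner_add_right)

lemma adj_diff: "adj S S' \<Longrightarrow> adj T T' \<Longrightarrow> adj (S - T) (S' - T')"
  by (simp add: adj_def cinner_diff_left cinner_diff_right)

lemma adj_mult: "adj S S' \<Longrightarrow> adj T T' \<Longrightarrow> adj (S * T) (T' * S')"
  by (simp add: adj_def)

lemma adj_sc: "adj (sc c) (sc (cnj c))"
  by (simp add: adj_def cinner_scaleC_left cinner_scaleC_right)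

lemma adj_0: "adj 0 0" and adj_1: "adj 1 1"
  by (simp_all add: adj_def)

lemma adj_tendsto:
  assumes "\<And>n. adj (S n) (S' n)" "S \<longlonglongrightarrow> T" "S' \<longlonglongrightarrow> T'"
  shows "adj T T'"
  unfolding adj_def
proof (intro allI)
  fix f g
  have *: "(\<lambda>n. cinner (op_apply (S n) f) g) \<longlonglongrightarrow> cinner (op_apply T f) g"
    by (intro tendsto_cinner bounded_linear.tendsto[OF bounded_linear_op_apply_left] tendsto_const assms)
  have "(\<lambda>n. cinner f (op_apply (S' n) g)) \<longlonglongrightarrow> cinner f (op_apply T' g)"
    by (intro tendsto_cinner bounded_linear.tendsto[OF bounded_linear_op_apply_left] tendsto_const assms)
  then show "cinner (op_apply T f) g = cinner f (op_apply T' g)"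
    using * unfolding adjD[OF assms(1)] by (rule LIMSEQ_unique[rotated])
qed

text \<open>The essential half of the C*-identity, from
  \<open>norm (T f) ^ 2 = cinner f (T' (T f))\<close> and Cauchy-Schwarz.\<close>

lemma norm_adj_mult:
  assumes "adj T T'"
  shows "(norm T)\<^sup>2 \<le> norm (T' * T)"
proof -
  have "norm (op_apply T f) \<le> sqrt (norm (T' * T)) * norm f" for f
  proof -
    have "complex_of_real ((norm (op_apply T f))\<^sup>2) = cinner f (op_apply (T' * T) f)"
      unfolding cinner_norm[symmetric] adjD[OF assms] by simp
    then have "(norm (op_apply T f))\<^sup>2 = cmod (cinner f (op_apply (T' * T) f))"
      by (metis abs_power2 norm_of_real)
    also have "\<dots> \<le> norm f * norm (op_apply (T' * T) f)" by (rule cinner_le)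
    also have "\<dots> \<le> norm f * (norm (T' * T) * norm f)"
      by (intro mult_left_mono norm_op_apply) simp
    finally have "(norm (op_apply T f))\<^sup>2 \<le> (sqrt (norm (T' * T)) * norm f)\<^sup>2"
      by (simp only: power_mult_distrib power2_eq_square[of "norm f"] real_sqrt_pow2[OF norm_ge_zero] mult_ac)
    then show ?thesis by (rule power2_le_imp_le) simp
  qed
  then have "norm T \<le> sqrt (norm (T' * T))" by (intro norm_op_bound) simp_all
  then have "(norm T)\<^sup>2 \<le> (sqrt (norm (T' * T)))\<^sup>2" by (intro power_mono) simp_all
  then show ?thesis by simp
qed

section \<open>Orthogonal projections onto closed subspaces\<close>

lemma GrD:
  assumes "S \<in> Gr"
  shows "closed S" "0 \<in> S" "\<And>f g. f \<in> S \<Longrightarrow> g \<in> S \<Longrightarrow> f + g \<in> S" "\<And>c f. f \<in> S \<Longrightarrow> c *\<^sub>C f \<in> S"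
    "\<And>f g. f \<in> S \<Longrightarrow> g \<in> S \<Longrightarrow> f - g \<in> S" "\<And>r f. f \<in> S \<Longrightarrow> r *\<^sub>R f \<in> S"
proof -
  show *: "closed S" "0 \<in> S" "\<And>f g. f \<in> S \<Longrightarrow> g \<in> S \<Longrightarrow> f + g \<in> S"
    "\<And>c f. f \<in> S \<Longrightarrow> c *\<^sub>C f \<in> S"
    using assms by (auto simp: Gr_def)
  show "r *\<^sub>R f \<in> S" if "f \<in> S" for r f using *(4) that by (simp add: scaleR_conv_scaleC)
  from this[of _ "-1"] show "f - g \<in> S" if "f \<in> S" "g \<in> S" for f g
    using *(3)[OF that(1), of "- g"] that by simp
qed

lemma ortho_minimizer:
  assumes S: "S \<in> Gr" and p: "p \<in> S" and min: "\<And>q. q \<in> S \<Longrightarrow> norm (f - p) \<le> norm (f - q)"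
  shows "f - p \<in> ortho S"
proof -
  have "cinner g (f - p) = 0" if g: "g \<in> S" for g
  proof (cases "g = 0")
    case False
    \<comment> \<open>With this \<open>c\<close> the point \<open>p + c *\<^sub>C g\<close> is
      nearest to \<open>f\<close> on the complex line through \<open>p\<close> in direction
      \<open>g\<close>. It lowers the squared distance by \<open>cmod c ^ 2 * norm g ^ 2\<close>,
      which minimality forces to vanish.\<close>
    define c where "c = cinner (f - p) g / complex_of_real ((norm g)\<^sup>2)"
    have "norm (f - p) \<le> norm ((f - p) - c *\<^sub>C g)"
      using min[of "p + c *\<^sub>C g"] GrD[OF S] p g by (simp add: algebra_simps)
    then have "(norm (f - p))\<^sup>2 \<le> (norm ((f - p) - c *\<^sub>C g))\<^sup>2" by (intro power_mono) auto
    then have "2 * Re (cnj c * cinner (f - p) g) \<le> (cmod c)\<^sup>2 * (norm g)\<^sup>2"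
      unfolding norm_diff_square[of "f - p" "c *\<^sub>C g"]
      by (simp add: cinner_scaleC_right norm_scaleC power_mult_distrib)
    moreover have "cnj c * cinner (f - p) g = complex_of_real ((cmod c)\<^sup>2 * (norm g)\<^sup>2)"
      using False unfolding of_real_mult complex_norm_square
      by (simp add: c_def field_simps power2_eq_square)
    ultimately have "(cmod c)\<^sup>2 * (norm g)\<^sup>2 \<le> 0"
      by (simp add: mult.commute)
    moreover have "(cmod c)\<^sup>2 * (norm g)\<^sup>2 \<ge> 0" by simp
    ultimately have "c = 0" using False by (simp add: mult_le_0_iff)
    then have "cinner (f - p) g = 0" using False by (simp add: c_def)
    then show ?thesis using cinner_commute[of g "f - p"] by simp
  qed simp
  then show ?thesis by (simp add: ortho_def)
qed

lemma parallelogram: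
  fixes a b :: "'a::real_inner"
  shows "(norm (a - b))\<^sup>2 = 2 * (norm a)\<^sup>2 + 2 * (norm b)\<^sup>2 - 4 * (norm ((1/2) *\<^sub>R (a + b)))\<^sup>2"
  by (simp add: power2_norm_eq_inner algebra_simps inner_commute)

text \<open>A minimising sequence is Cauchy by the parallelogram law, because the midpoint of two
  terms lies in \<open>S\<close> and is no closer to \<open>f\<close> than the infimum
  \<open>d\<close>.\<close>

lemma projection_exists:
  assumes S: "S \<in> Gr"
  shows "\<exists>p\<in>S. f - p \<in> ortho S"
proof -
  define d where "d = infdist f S"
  have ne: "S \<noteq> {}" using GrD[OF S] by auto
  have d: "d \<le> norm (f - q)" if "q \<in> S" for q
    using infdist_le[OF that, of f] by (simp add: d_def dist_norm)
  have d0: "0 \<le> d" by (simp add: d_def infdist_nonneg)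
  \<comment> \<open>The slack is put on the squared distance because the parallelogram law compares
    squares.\<close>
  have "\<exists>q\<in>S. (norm (f - q))\<^sup>2 < d\<^sup>2 + 1 / real (Suc n)" for n
  proof -
    have "d < sqrt (d\<^sup>2 + 1 / real (Suc n))"
      using d0 by (intro real_less_rsqrt) auto
    then obtain q where "q \<in> S" "norm (f - q) < sqrt (d\<^sup>2 + 1 / real (Suc n))"
      using cInf_lessD[of "dist f ` S"] ne unfolding d_def infdist_def
      by (auto simp: dist_norm)
    moreover have "(norm (f - q))\<^sup>2 < (sqrt (d\<^sup>2 + 1 / real (Suc n)))\<^sup>2"
      using calculation by (intro power_strict_mono) auto
    ultimately show ?thesis by (intro bexI[of _ q]) (auto simp: add_nonneg_nonneg)
  qed
  then have "\<forall>n. \<exists>q. q \<in> S \<and> (norm (f - q))\<^sup>2 < d\<^sup>2 + 1 / real (Suc n)" by blast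
  from choice[OF this] obtain q
    where q: "\<And>n. q n \<in> S" "\<And>n. (norm (f - q n))\<^sup>2 < d\<^sup>2 + 1 / real (Suc n)" by blast
  have bd: "(norm (q m - q n))\<^sup>2 \<le> 2 / real (Suc m) + 2 / real (Suc n)" for m n
  proof -
    have "(1/2) *\<^sub>R (q m + q n) \<in> S" by (intro GrD(3,6)[OF S] q(1))
    moreover have "f - (1/2) *\<^sub>R (q m + q n) = (1/2) *\<^sub>R ((f - q m) + (f - q n))"
      by (rule hardy_eqI) (simp add: field_simps)
    ultimately have "d \<le> norm ((1/2) *\<^sub>R ((f - q m) + (f - q n)))" using d by fastforce
    then have "d\<^sup>2 \<le> (norm ((1/2) *\<^sub>R ((f - q m) + (f - q n))))\<^sup>2"
      using d0 by (intro power_mono)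
    moreover have "(f - q n) - (f - q m) = q m - q n" by simp
    ultimately show ?thesis
      using parallelogram[of "f - q n" "f - q m"] q(2)[of m] q(2)[of n]
      unfolding add.commute[of "f - q n"] by simp
  qed
  have "Cauchy q"
  proof (rule CauchyI)
    fix e :: real assume e: "0 < e"
    obtain N where N: "4 / e\<^sup>2 < real N" using reals_Archimedean2 by blast
    have "norm (q m - q n) < e" if "m \<ge> N" "n \<ge> N" for m n
    proof -
      have N0: "0 < real N" using N e by (meson divide_pos_pos less_trans zero_less_numeral zero_less_power)
      have "2 / real (Suc m) \<le> 2 / real N" "2 / real (Suc n) \<le> 2 / real N"
        using that N0 by (auto intro!: divide_left_mono)
      then have "(norm (q m - q n))\<^sup>2 \<le> 4 / real N" using bd[of m n] by simp
      also have "\<dots> < e\<^sup>2" using N N0 e by (simp add: field_simps)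
      finally show ?thesis using e by (auto intro: power2_less_imp_less)
    qed
    then show "\<exists>M. \<forall>m\<ge>M. \<forall>n\<ge>M. norm (q m - q n) < e" by blast
  qed
  then obtain p where p: "q \<longlonglongrightarrow> p" by (auto simp: Cauchy_convergent_iff convergent_def)
  have pS: "p \<in> S" using closed_sequentially[OF GrD(1)[OF S]] q p by blast
  have "(norm (f - p))\<^sup>2 \<le> d\<^sup>2 + 0"
  proof (rule LIMSEQ_le)
    show "(\<lambda>n. (norm (f - q n))\<^sup>2) \<longlonglongrightarrow> (norm (f - p))\<^sup>2" by (intro tendsto_intros p)
    show "(\<lambda>n. d\<^sup>2 + 1 / real (Suc n)) \<longlonglongrightarrow> d\<^sup>2 + 0"
      by (intro tendsto_intros LIMSEQ_Suc[OF lim_1_over_n])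
    show "\<exists>N. \<forall>n\<ge>N. (norm (f - q n))\<^sup>2 \<le> d\<^sup>2 + 1 / real (Suc n)"
      using q(2) less_imp_le by blast
  qed
  then have "norm (f - p) \<le> d" using d0 by (auto intro: power2_le_imp_le)
  then have "f - p \<in> ortho S"
    using d by (intro ortho_minimizer[OF S pS]) (meson order_trans)
  with pS show ?thesis by blast
qed

lemma orthoD: "g \<in> ortho S \<Longrightarrow> f \<in> S \<Longrightarrow> cinner f g = 0" "g \<in> ortho S \<Longrightarrow> f \<in> S \<Longrightarrow> cinner g f = 0"
  unfolding ortho_def using cinner_commute[of g f] by auto

lemma ortho_disjoint: "f \<in> S \<Longrightarrow> f \<in> ortho S \<Longrightarrow> f = 0"
  using orthoD(1)[of f S f] by (simp add: cinner_norm)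

lemma ortho_add: "f \<in> ortho S \<Longrightarrow> g \<in> ortho S \<Longrightarrow> f + g \<in> ortho S"
  and ortho_diff: "f \<in> ortho S \<Longrightarrow> g \<in> ortho S \<Longrightarrow> f - g \<in> ortho S"
  and ortho_scaleC: "f \<in> ortho S \<Longrightarrow> c *\<^sub>C f \<in> ortho S"
  by (simp_all add: ortho_def cinner_add_right cinner_diff_right cinner_scaleC_right)

definition proj :: "hardy2 set \<Rightarrow> hardy_op \<Rightarrow> bool" where
  "proj S P \<longleftrightarrow> (\<forall>f. op_apply P f \<in> S \<and> f - op_apply P f \<in> ortho S)"

lemma proj_unique:
  assumes S: "S \<in> Gr" and "p \<in> S" "f - p \<in> ortho S" "q \<in> S" "f - q \<in> ortho S"
  shows "p = q"
  using ortho_disjoint[OF GrD(5)[OF S, of p q]] ortho_diff[of "f - q" S "f - p"] assms by auto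

lemma proj_exists:
  assumes S: "S \<in> Gr"
  obtains P where "proj S P"
proof -
  obtain F where F: "\<And>f. F f \<in> S" "\<And>f. f - F f \<in> ortho S"
    using projection_exists[OF S] by metis
  note [simp] = GrD(3,4)[OF S]
  have "F (f + g) = F f + F g" for f g
    by (rule proj_unique[OF S, of _ "f + g"])
       (use F ortho_add[OF F(2)[of f] F(2)[of g]] in \<open>simp_all add: algebra_simps\<close>)
  moreover have "F (c *\<^sub>C f) = c *\<^sub>C F f" for c f
    by (rule proj_unique[OF S, of _ "c *\<^sub>C f"])
       (use F ortho_scaleC[OF F(2)[of f], of c] in \<open>simp_all add: scaleC_diff_right\<close>)
  moreover have "norm (F f) \<le> 1 * norm f" for f
  proof -
    have "(norm (f - F f))\<^sup>2 = (norm f)\<^sup>2 - (norm (F f))\<^sup>2"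
      using orthoD(2)[OF F(2)[of f] F(1)[of f]] norm_diff_square[of f "F f"]
      by (simp add: cinner_diff_left cinner_norm)
    then have "(norm (F f))\<^sup>2 \<le> (norm f)\<^sup>2" using zero_le_power2[of "norm (f - F f)"] by linarith
    then show ?thesis by (auto intro: power2_le_imp_le)
  qed
  ultimately obtain P where "\<And>f. op_apply P f = F f" using op_exists by blast
  then have "proj S P" using F by (simp add: proj_def)
  then show ?thesis by (rule that)
qed

lemma proj_in_iff:
  assumes "S \<in> Gr" "proj S P"
  shows "f \<in> S \<longleftrightarrow> op_apply P f = f"
proof
  show "f \<in> S" if "op_apply P f = f" using assms(2) that unfolding proj_def by metis
  have "f - f \<in> ortho S" by (simp add: ortho_def)
  then show "op_apply P f = f" if "f \<in> S"
    using assms(2) that unfolding proj_def by (blast intro: proj_unique[OF assms(1), of _ f])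
qed

lemma proj_ortho_iff:
  assumes "S \<in> Gr" "proj S P"
  shows "f \<in> ortho S \<longleftrightarrow> op_apply P f = 0"
proof
  show "f \<in> ortho S" if "op_apply P f = 0" using assms(2) that unfolding proj_def by (metis diff_zero)
  show "op_apply P f = 0" if "f \<in> ortho S"
    using assms(2) that GrD(2)[OF assms(1)] unfolding proj_def
    by (intro proj_unique[OF assms(1), of _ f]) simp_all
qed

lemma proj_idem:
  assumes "S \<in> Gr" "proj S P"
  shows "P * P = P"
  using assms(2) by (intro op_eqI) (simp add: proj_in_iff[OF assms, symmetric] proj_def)

lemma proj_adj:
  assumes "proj S P"
  shows "adj P P"
proof -
  have "cinner (op_apply P f) g = cinner (op_apply P f) (op_apply P g)" for f g
    using orthoD(1)[of "g - op_apply P g" S "op_apply P f"] assms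
    by (simp add: proj_def cinner_diff_right)
  moreover have "cinner f (op_apply P g) = cinner (op_apply P f) (op_apply P g)" for f g
    using orthoD(2)[of "f - op_apply P f" S "op_apply P g"] assms
    by (simp add: proj_def cinner_diff_left)
  ultimately show ?thesis by (simp add: adj_def)
qed

section \<open>Operators with dense range\<close>

lemma closure_range_iff:
  "f \<in> closure (range (op_apply C)) \<longleftrightarrow> (\<exists>g. (\<lambda>n. op_apply C (g n)) \<longlonglongrightarrow> f)"
proof
  assume "f \<in> closure (range (op_apply C))"
  then obtain x where x: "\<And>n. x n \<in> range (op_apply C)" "x \<longlonglongrightarrow> f"
    unfolding closure_sequential by blast
  then have "\<forall>n. \<exists>g. x n = op_apply C g" by (auto simp: image_iff)
  then obtain g where "\<forall>n. x n = op_apply C (g n)" by (rule choice[THEN exE])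
  then have "x = (\<lambda>n. op_apply C (g n))" by (simp add: fun_eq_iff)
  then show "\<exists>g. (\<lambda>n. op_apply C (g n)) \<longlonglongrightarrow> f" using x(2) by blast
next
  assume "\<exists>g. (\<lambda>n. op_apply C (g n)) \<longlonglongrightarrow> f"
  then obtain g where "(\<lambda>n. op_apply C (g n)) \<longlonglongrightarrow> f" ..
  then show "f \<in> closure (range (op_apply C))"
    unfolding closure_sequential by (intro exI[of _ "\<lambda>n. op_apply C (g n)"]) simp
qed

lemma closure_range_Gr: "closure (range (op_apply C)) \<in> Gr"
proof -
  have "f + g \<in> closure (range (op_apply C))"
    if "f \<in> closure (range (op_apply C))" "g \<in> closure (range (op_apply C))" for f g
  proof -
    from that obtain x y where "(\<lambda>n. op_apply C (x n)) \<longlonglongrightarrow> f" "(\<lambda>n. op_apply C (y n)) \<longlonglongrightarrow> g"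
      unfolding closure_range_iff by blast
    then have "(\<lambda>n. op_apply C (x n + y n)) \<longlonglongrightarrow> f + g"
      unfolding op_apply_add_right by (rule tendsto_add)
    then show ?thesis unfolding closure_range_iff by (rule exI[of _ "\<lambda>n. x n + y n"])
  qed
  moreover have "c *\<^sub>C f \<in> closure (range (op_apply C))" if "f \<in> closure (range (op_apply C))" for c f
  proof -
    from that obtain x where "(\<lambda>n. op_apply C (x n)) \<longlonglongrightarrow> f"
      unfolding closure_range_iff by blast
    then have "(\<lambda>n. op_apply C (c *\<^sub>C x n)) \<longlonglongrightarrow> c *\<^sub>C f"
      unfolding op_apply_scaleC_right by (rule bounded_linear.tendsto[OF bounded_linear_scaleC])
    then show ?thesis unfolding closure_range_iff by (rule exI[of _ "\<lambda>n. c *\<^sub>C x n"])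
  qed
  moreover have "0 \<in> closure (range (op_apply C))"
    unfolding closure_range_iff by (intro exI[of _ "\<lambda>n. 0"]) simp
  ultimately show ?thesis by (simp add: Gr_def)
qed

text \<open>The orthogonal complement of the range of a self-adjoint operator is its kernel.\<close>

lemma dense_range:
  assumes C: "adj C C" and inj: "\<And>f. op_apply C f = 0 \<Longrightarrow> f = 0"
  shows "closure (range (op_apply C)) = UNIV"
proof -
  let ?R = "closure (range (op_apply C))"
  have "g \<in> ?R" for g
  proof -
    obtain p where p: "p \<in> ?R" "g - p \<in> ortho ?R"
      using projection_exists[OF closure_range_Gr] by blast
    have "cinner f (op_apply C (g - p)) = 0" for f
    proof -
      have "op_apply C f \<in> ?R" by (intro subsetD[OF closure_subset] rangeI)
      then show ?thesis using orthoD(1)[OF p(2)] adjD[OF C, of f "g - p"] by simp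
    qed
    then have "op_apply C (g - p) = 0" by (rule cinner_eq_0D)
    then have "g - p = 0" by (rule inj)
    then show ?thesis using p(1) by simp
  qed
  then show ?thesis by blast
qed

text \<open>Cancellation of \<open>C\<close> on the right. It stands in for a bounded inverse of
  \<open>C\<close>, which need not exist in the application.\<close>

lemma op_eq_of_dense:
  assumes d: "closure (range (op_apply C)) = UNIV" and e: "S * C = T * C"
  shows "S = T"
proof (rule op_eqI)
  fix g
  obtain x where x: "(\<lambda>n. op_apply C (x n)) \<longlonglongrightarrow> g"
    using closure_range_iff[of g C] d by auto
  have "op_apply S (op_apply C (x n)) = op_apply T (op_apply C (x n))" for n
    using e by (metis op_apply_mult)
  then show "op_apply S g = op_apply T g"
    using bounded_linear.tendsto[OF bounded_linear_op_apply x, of S]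
      bounded_linear.tendsto[OF bounded_linear_op_apply x, of T] by (simp add: LIMSEQ_unique)
qed

text \<open>The assignment of \<open>A x\<close> to \<open>C x\<close> is well defined and isometric
  by hypothesis \<open>n\<close>, so it extends from the dense range of \<open>C\<close> to the
  whole space. This gives the isometric part of a polar decomposition.\<close>

lemma isometric_factor:
  assumes d: "closure (range (op_apply C)) = UNIV"
    and n: "\<And>f. norm (op_apply A f) = norm (op_apply C f)"
  obtains V where "V * C = A"
proof -
  \<comment> \<open>The closure of the graph of that assignment. Completeness makes it total; it
    preserves norms and is linear, and these two together make it single valued.\<close>
  define R where "R g h \<longleftrightarrow> (\<exists>x. (\<lambda>n. op_apply C (x n)) \<longlonglongrightarrow> g \<and> (\<lambda>n. op_apply A (x n)) \<longlonglongrightarrow> h)" for g h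
  have ex: "\<exists>h. R g h" for g
  proof -
    obtain x where x: "(\<lambda>n. op_apply C (x n)) \<longlonglongrightarrow> g"
      using closure_range_iff[of g C] d by auto
    then have "Cauchy (\<lambda>n. op_apply C (x n))" by (rule LIMSEQ_imp_Cauchy)
    then have "Cauchy (\<lambda>n. op_apply A (x n))"
      unfolding Cauchy_iff by (simp flip: op_apply_diff_right add: n)
    then obtain h where "(\<lambda>n. op_apply A (x n)) \<longlonglongrightarrow> h"
      by (auto simp: Cauchy_convergent_iff convergent_def)
    then show ?thesis using x unfolding R_def by blast
  qed
  have R_norm: "norm h = norm g" if "R g h" for g h
  proof -
    from that[unfolded R_def] obtain x
      where "(\<lambda>n. op_apply C (x n)) \<longlonglongrightarrow> g \<and> (\<lambda>n. op_apply A (x n)) \<longlonglongrightarrow> h" by (rule exE)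
    note x = this[THEN conjunct1] this[THEN conjunct2]
    show ?thesis
      using tendsto_norm[OF x(1)] tendsto_norm[OF x(2)] unfolding n by (rule LIMSEQ_unique[rotated])
  qed
  have R_comb: "R (a *\<^sub>C g + b *\<^sub>C g') (a *\<^sub>C h + b *\<^sub>C h')" if gh: "R g h" "R g' h'" for a b g h g' h'
  proof -
    from gh(1)[unfolded R_def] obtain x
      where "(\<lambda>n. op_apply C (x n)) \<longlonglongrightarrow> g \<and> (\<lambda>n. op_apply A (x n)) \<longlonglongrightarrow> h" by (rule exE)
    note x = this[THEN conjunct1] this[THEN conjunct2]
    from gh(2)[unfolded R_def] obtain y
      where "(\<lambda>n. op_apply C (y n)) \<longlonglongrightarrow> g' \<and> (\<lambda>n. op_apply A (y n)) \<longlonglongrightarrow> h'" by (rule exE)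
    note y = this[THEN conjunct1] this[THEN conjunct2]
    show ?thesis unfolding R_def
      by (rule exI[of _ "\<lambda>n. a *\<^sub>C x n + b *\<^sub>C y n"])
         (auto simp: op_apply_add_right op_apply_scaleC_right
           intro!: tendsto_add bounded_linear.tendsto[OF bounded_linear_scaleC] x y)
  qed
  have R_unique: "h = h'" if "R g h" "R g h'" for g h h'
  proof -
    have m: "1 *\<^sub>C f + (-1) *\<^sub>C f' = f - f'" for f f' by (rule hardy_eqI) simp
    from R_norm[OF R_comb[OF that, of 1 "-1"]] show ?thesis unfolding m by simp
  qed
  obtain F where F: "\<And>g. R g (F g)" using ex by metis
  obtain V where V: "\<And>g. op_apply V g = F g"
  proof (rule op_exists)
    show "F (f + g) = F f + F g" for f g using R_unique[OF F[of "f + g"]] R_comb[OF F[of f] F[of g], of 1 1] by simp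
    show "F (c *\<^sub>C f) = c *\<^sub>C F f" for c f using R_unique[OF F[of "c *\<^sub>C f"]] R_comb[OF F[of f] F[of f], of c 0] by simp
    show "norm (F f) \<le> 1 * norm f" for f using R_norm[OF F] by simp
  qed blast
  have "R (op_apply C f) (op_apply A f)" for f
    unfolding R_def by (intro exI[of _ "\<lambda>n. f"]) simp
  then have "V * C = A" using R_unique[OF F] by (intro op_eqI) (simp add: V)
  then show ?thesis by (rule that)
qed

section \<open>The continuous functional calculus\<close>

text \<open>Horner evaluation, as in \<open>poly\<close>. The coefficients act through the central
  \<open>sc c\<close>, which makes the evaluation multiplicative in \<open>p\<close>.\<close>

definition opoly :: "complex poly \<Rightarrow> hardy_op \<Rightarrow> hardy_op" where
  "opoly p Y = fold_coeffs (\<lambda>c T. sc c + Y * T) p 0"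

lemma opoly_0 [simp]: "opoly 0 Y = 0"
  by (simp add: opoly_def)

lemma opoly_pCons [simp]: "opoly (pCons c p) Y = sc c + Y * opoly p Y"
  by (cases "p = 0 \<and> c = 0") (auto simp: opoly_def)

lemma opoly_add [simp]: "opoly (p + q) Y = opoly p Y + opoly q Y"
  by (induction p q rule: poly_induct2) (simp_all add: sc_add algebra_simps)

lemma opoly_smult [simp]: "opoly (smult c p) Y = sc c * opoly p Y"
proof (induction p)
  case (pCons a p)
  have "Y * (sc c * opoly p Y) = sc c * (Y * opoly p Y)"
    by (simp only: sc_commute[of Y] flip: mult.assoc)
  with pCons show ?case by (simp add: sc_mult distrib_left)
qed simp

lemma opoly_diff [simp]: "opoly (p - q) Y = opoly p Y - opoly q Y"
  using opoly_add[of p "smult (-1) q" Y] unfolding opoly_smult by (simp add: sc_minus)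

lemma opoly_mult [simp]: "opoly (p * q) Y = opoly p Y * opoly q Y"
  by (induction p) (simp_all add: algebra_simps)

lemma opoly_commute: "Y * opoly p Y = opoly p Y * Y"
proof (induction p)
  case (pCons a p)
  have "Y * (Y * opoly p Y) = Y * opoly p Y * Y" using arg_cong[OF pCons(2), of "(*) Y"] by (simp only: mult.assoc)
  then show ?case by (simp only: opoly_pCons distrib_left distrib_right sc_commute)
qed simp

lemma adj_opoly: "adj Y Y \<Longrightarrow> adj (opoly p Y) (opoly (map_poly cnj p) Y)"
proof (induction p)
  case (pCons a p)
  have "adj (sc a + Y * opoly p Y) (sc (cnj a) + opoly (map_poly cnj p) Y * Y)"
    by (intro adj_add adj_mult adj_sc pCons)
  then show ?case by (simp add: map_poly_pCons opoly_commute)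
qed (simp add: adj_0)

text \<open>The spectrum lies in \<open>[a, b]\<close>, expressed through the quadratic form.\<close>

definition spec_in :: "hardy_op \<Rightarrow> real \<Rightarrow> real \<Rightarrow> bool" where
  "spec_in Y a b \<longleftrightarrow> adj Y Y \<and>
    (\<forall>f. a * (norm f)\<^sup>2 \<le> Re (cinner (op_apply Y f) f) \<and> Re (cinner (op_apply Y f) f) \<le> b * (norm f)\<^sup>2)"

lemma spec_in_adj: "spec_in Y a b \<Longrightarrow> adj Y Y"
  by (simp add: spec_in_def)

lemma spec_in_le: "spec_in Y a b \<Longrightarrow> a \<le> b"
proof -
  assume Y: "spec_in Y a b"
  obtain f :: hardy2 where "f \<noteq> 0" using ex_nonzero by blast
  moreover have "a * (norm f)\<^sup>2 \<le> b * (norm f)\<^sup>2"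
    using Y unfolding spec_in_def by (auto intro: order_trans)
  ultimately show ?thesis by simp
qed

text \<open>Cauchy-Schwarz applied to \<open>Y - c\<close>. It later converts a bound on the values
  of a function into an interval for the resulting operator.\<close>

lemma spec_in_near:
  assumes Y: "adj Y Y" and le: "norm (Y - sc (complex_of_real c)) \<le> r"
  shows "spec_in Y (c - r) (c + r)"
proof -
  have *: "\<bar>Re (cinner (op_apply Y f) f) - c * (norm f)\<^sup>2\<bar> \<le> r * (norm f)\<^sup>2" for f
  proof -
    let ?Z = "Y - sc (complex_of_real c)"
    have "Re (cinner (op_apply Y f) f) - c * (norm f)\<^sup>2 = Re (cinner (op_apply ?Z f) f)"
      by (simp add: cinner_diff_left cinner_scaleC_left cinner_norm flip: of_real_mult of_real_power)
    also have "\<bar>\<dots>\<bar> \<le> cmod (cinner (op_apply ?Z f) f)" by (rule abs_Re_le_cmod)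
    also have "\<dots> \<le> norm (op_apply ?Z f) * norm f" by (rule cinner_le)
    also have "\<dots> \<le> (r * norm f) * norm f"
      by (intro mult_right_mono order_trans[OF norm_op_apply] le) simp_all
    finally show ?thesis by (simp add: power2_eq_square mult.assoc)
  qed
  have "(c - r) * (norm f)\<^sup>2 \<le> Re (cinner (op_apply Y f) f) \<and>
      Re (cinner (op_apply Y f) f) \<le> (c + r) * (norm f)\<^sup>2" for f
    using *[of f] unfolding abs_le_iff left_diff_distrib distrib_right by linarith
  then show ?thesis using Y unfolding spec_in_def by blast
qed

text \<open>The form of \<open>Y - z\<close> at \<open>f\<close> is a real number from
  \<open>[a, b]\<close> minus \<open>z\<close>, times \<open>norm f ^ 2\<close>. Its modulus is
  bounded below by the gap between \<open>z\<close> and the interval if \<open>z\<close> is real,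
  and by the imaginary part of \<open>z\<close> otherwise; Cauchy-Schwarz passes the bound to the
  operator.\<close>

lemma spec_in_bounded_below:
  assumes Y: "spec_in Y a b" and z: "\<And>t. t \<in> {a..b} \<Longrightarrow> z \<noteq> complex_of_real t"
  shows "\<exists>e>0. \<forall>f. e * norm f \<le> norm (op_apply (Y - sc z) f)"
proof -
  let ?u = "\<lambda>f. Re (cinner (op_apply Y f) f)"
  have c: "cinner (op_apply (Y - sc z) f) f = complex_of_real (?u f) - z * complex_of_real ((norm f)\<^sup>2)" for f
  proof -
    have "cinner (op_apply Y f) f = cnj (cinner (op_apply Y f) f)"
      using adjD[OF spec_in_adj[OF Y], of f f] cinner_commute[of f "op_apply Y f"] by simp
    then have "cinner (op_apply Y f) f = complex_of_real (?u f)" by (simp add: complex_eq_iff)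
    then show ?thesis by (simp add: cinner_diff_left cinner_scaleC_left cinner_norm)
  qed
  have u: "a * (norm f)\<^sup>2 \<le> ?u f" "?u f \<le> b * (norm f)\<^sup>2" for f
    using Y by (auto simp: spec_in_def)
  have "\<exists>e>0. \<forall>f. e * (norm f)\<^sup>2 \<le> cmod (cinner (op_apply (Y - sc z) f) f)"
  proof (cases "Im z = 0")
    case True
    then have "Re z \<notin> {a..b}" using z[of "Re z"] by (auto simp: complex_eq_iff)
    then consider "Re z < a" | "Re z > b" by fastforce
    then show ?thesis
    proof cases
      case 1
      have "(a - Re z) * (norm f)\<^sup>2 \<le> cmod (cinner (op_apply (Y - sc z) f) f)" for f
      proof -
        have "(a - Re z) * (norm f)\<^sup>2 \<le> Re (cinner (op_apply (Y - sc z) f) f)"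
          unfolding c using u(1)[of f] by (simp add: left_diff_distrib)
        then show ?thesis by (rule order_trans[OF _ complex_Re_le_cmod])
      qed
      then show ?thesis using 1 by (intro exI[of _ "a - Re z"]) simp
    next
      case 2
      have "(Re z - b) * (norm f)\<^sup>2 \<le> cmod (cinner (op_apply (Y - sc z) f) f)" for f
      proof -
        have "(Re z - b) * (norm f)\<^sup>2 \<le> - Re (cinner (op_apply (Y - sc z) f) f)"
          unfolding c using u(2)[of f] by (simp add: left_diff_distrib)
        also have "\<dots> \<le> cmod (cinner (op_apply (Y - sc z) f) f)"
          using abs_Re_le_cmod[of "cinner (op_apply (Y - sc z) f) f"] by linarith
        finally show ?thesis .
      qed
      then show ?thesis using 2 by (intro exI[of _ "Re z - b"]) simp
    qed
  next
    case False
    have "\<bar>Im z\<bar> * (norm f)\<^sup>2 \<le> cmod (cinner (op_apply (Y - sc z) f) f)" for f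
    proof -
      have "\<bar>Im z\<bar> * (norm f)\<^sup>2 = \<bar>Im (cinner (op_apply (Y - sc z) f) f)\<bar>"
        unfolding c by (simp add: abs_mult flip: of_real_power)
      then show ?thesis by (simp only: abs_Im_le_cmod)
    qed
    then show ?thesis using False by (intro exI[of _ "\<bar>Im z\<bar>"]) simp
  qed
  then obtain e where e: "e > 0" "\<And>f. e * (norm f)\<^sup>2 \<le> cmod (cinner (op_apply (Y - sc z) f) f)" by blast
  have "e * norm f \<le> norm (op_apply (Y - sc z) f)" for f
  proof (cases "f = 0")
    case False
    have "(e * norm f) * norm f \<le> norm (op_apply (Y - sc z) f) * norm f"
      using order_trans[OF e(2)[of f] cinner_le] by (simp add: power2_eq_square mult.assoc)
    then show ?thesis using False by simp
  qed simp
  with e(1) show ?thesis by blast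
qed

text \<open>Every root of \<open>q\<close> lies off \<open>[a, b]\<close>, so each linear factor is
  bounded below at \<open>Y\<close>, and lower bounds multiply under composition.\<close>

lemma opoly_bounded_below:
  assumes Y: "spec_in Y a b"
  shows "\<lbrakk>q \<noteq> 0; \<And>t. t \<in> {a..b} \<Longrightarrow> poly q (complex_of_real t) \<noteq> 0\<rbrakk> \<Longrightarrow>
    \<exists>e>0. \<forall>f. e * norm f \<le> norm (op_apply (opoly q Y) f)"
proof (induction "degree q" arbitrary: q)
  case 0
  then obtain c where c: "q = [:c:]" "c \<noteq> 0" by (auto elim: degree_eq_zeroE)
  then show ?case by (intro exI[of _ "cmod c"]) (simp add: norm_scaleC)
next
  case (Suc n)
  have "\<exists>i\<in>{1..degree q}. coeff q i \<noteq> 0"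
    using Suc.hyps(2) by (intro bexI[of _ "degree q"]) auto
  then obtain z where z: "poly q z = 0"
    using fundamental_theorem_of_algebra[of "coeff q" "degree q"] by (auto simp: poly_altdef)
  then obtain r where r: "q = [:- z, 1:] * r" by (auto simp: poly_eq_0_iff_dvd)
  have r0: "r \<noteq> 0" using Suc.prems(1) r by auto
  then have "n = degree r"
    using Suc.hyps(2) r degree_mult_eq[of "[:- z, 1:]" r] by simp
  moreover have "poly r (complex_of_real t) \<noteq> 0" if "t \<in> {a..b}" for t
    using Suc.prems(2)[OF that] r by auto
  ultimately obtain e where e: "e > 0" "\<And>f. e * norm f \<le> norm (op_apply (opoly r Y) f)"
    using Suc.hyps(1)[of r] r0 by blast
  have "z \<noteq> complex_of_real t" if "t \<in> {a..b}" for t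
    using Suc.prems(2)[OF that] z by auto
  then obtain d where d: "d > 0" "\<And>f. d * norm f \<le> norm (op_apply (Y - sc z) f)"
    using spec_in_bounded_below[OF Y] by blast
  have q: "opoly q Y = (Y - sc z) * opoly r Y"
    unfolding r opoly_mult by (simp add: sc_minus)
  have "(d * e) * norm f \<le> norm (op_apply (opoly q Y) f)" for f
  proof -
    have "(d * e) * norm f \<le> d * norm (op_apply (opoly r Y) f)"
      using mult_left_mono[OF e(2)[of f], of d] d(1) by (simp add: mult.assoc)
    also have "\<dots> \<le> norm (op_apply (opoly q Y) f)" unfolding q op_apply_mult by (rule d(2))
    finally show ?thesis .
  qed
  then show ?case using d(1) e(1) by (intro exI[of _ "d * e"]) simp
qed

text \<open>
  \<open>\<parallel>p(Y)\<parallel>\<^sup>2\<close> is an approximate eigenvalue of \<open>p(Y)\<^sup>2\<close>, so \<open>p\<^sup>2 - \<parallel>p(Y)\<parallel>\<^sup>2\<close> must have a root in \<open>[a, b]\<close>: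
  otherwise all linear factors of this polynomial would be bounded below at \<open>Y\<close>.
\<close>

lemma norm_attained:
  assumes Y: "spec_in Y a b" and T: "adj (opoly p Y) (opoly p Y)"
  shows "\<exists>t\<in>{a..b}. (poly p (complex_of_real t))\<^sup>2 = complex_of_real ((norm (opoly p Y))\<^sup>2)"
proof (rule ccontr)
  assume neg: "\<not> ?thesis"
  let ?T = "opoly p Y"
  define n where "n = norm ?T"
  define q where "q = p * p - [:complex_of_real (n\<^sup>2):]"
  have nz: "poly q (complex_of_real t) \<noteq> 0" if "t \<in> {a..b}" for t
    using neg that by (auto simp: q_def n_def power2_eq_square)
  moreover have "q \<noteq> 0" using nz[of a] spec_in_le[OF Y] by auto
  ultimately obtain e where e: "e > 0" "\<And>f. e * norm f \<le> norm (op_apply (opoly q Y) f)"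
    using opoly_bounded_below[OF Y] by blast
  have q: "op_apply (opoly q Y) f = op_apply ?T (op_apply ?T f) - n\<^sup>2 *\<^sub>R f" for f
    by (simp add: q_def scaleR_conv_scaleC)
  \<comment> \<open>Expanding the square of \<open>q(Y) f\<close> with \<open>?T\<close>
    self-adjoint gives this estimate. It concerns \<open>n *\<^sub>R ?T\<close>, whose norm is
    \<open>n\<^sup>2\<close>, to avoid dividing by \<open>n\<close>, which may be zero.\<close>
  have *: "(norm (op_apply (n *\<^sub>R ?T) f))\<^sup>2 \<le> (n ^ 4 - e\<^sup>2) * (norm f)\<^sup>2" for f
  proof -
    let ?g = "op_apply ?T f"
    have "(e * norm f)\<^sup>2 \<le> (norm (op_apply ?T ?g - n\<^sup>2 *\<^sub>R f))\<^sup>2"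
      using e(1) e(2)[of f] unfolding q by (intro power_mono) auto
    also have "\<dots> = (norm (op_apply ?T ?g))\<^sup>2 - 2 * n\<^sup>2 * (norm ?g)\<^sup>2 + n ^ 4 * (norm f)\<^sup>2"
      unfolding norm_diff_square
      by (simp add: scaleR_conv_scaleC cinner_scaleC_right adjD[OF T] cinner_norm norm_scaleC
          power_mult_distrib flip: adjD[OF T, of f] of_real_mult of_real_power)
    also have "(norm (op_apply ?T ?g))\<^sup>2 \<le> (n * norm ?g)\<^sup>2"
      unfolding n_def by (intro power_mono norm_op_apply) simp
    finally show ?thesis by (simp add: power_mult_distrib algebra_simps)
  qed
  obtain f :: hardy2 where f: "f \<noteq> 0" using ex_nonzero by blast
  have "0 \<le> (n ^ 4 - e\<^sup>2) * (norm f)\<^sup>2" by (rule order_trans[OF zero_le_power2 *])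
  then have pos: "0 \<le> n ^ 4 - e\<^sup>2" using f by (simp add: zero_le_mult_iff)
  have "norm (n *\<^sub>R ?T) \<le> sqrt (n ^ 4 - e\<^sup>2)"
  proof (rule norm_op_bound)
    fix f
    have "(norm (op_apply (n *\<^sub>R ?T) f))\<^sup>2 \<le> (sqrt (n ^ 4 - e\<^sup>2) * norm f)\<^sup>2"
      using * pos by (simp only: power_mult_distrib real_sqrt_pow2)
    then show "norm (op_apply (n *\<^sub>R ?T) f) \<le> sqrt (n ^ 4 - e\<^sup>2) * norm f"
      by (rule power2_le_imp_le) (use pos in simp)
  qed (use pos in simp)
  then have "n\<^sup>2 \<le> sqrt (n ^ 4 - e\<^sup>2)" by (simp add: n_def power2_eq_square)
  then have "(n\<^sup>2)\<^sup>2 \<le> (sqrt (n ^ 4 - e\<^sup>2))\<^sup>2" by (intro power_mono) simp_all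
  then have "(n\<^sup>2)\<^sup>2 \<le> n ^ 4 - e\<^sup>2" using pos by simp
  then show False using e(1) by simp
qed

text \<open>The C*-identity passes to the self-adjoint \<open>r(Y)\<close>, and by
  \<open>norm_attained\<close> its norm is the value of \<open>cmod p ^ 2\<close> at a point of
  \<open>[a, b]\<close>. The continuity of the functional calculus rests on this estimate.\<close>

lemma opoly_norm_le:
  assumes Y: "spec_in Y a b" and M: "\<And>t. t \<in> {a..b} \<Longrightarrow> cmod (poly p (complex_of_real t)) \<le> M"
  shows "norm (opoly p Y) \<le> M"
proof -
  let ?p' = "map_poly cnj p"
  define r where "r = ?p' * p"
  have adj: "adj (opoly p Y) (opoly ?p' Y)" by (rule adj_opoly[OF spec_in_adj[OF Y]])
  have "adj (opoly r Y) (opoly r Y)"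
    unfolding r_def opoly_mult by (rule adj_mult[OF adj_sym[OF adj] adj])
  then obtain t where t: "t \<in> {a..b}"
    "(poly r (complex_of_real t))\<^sup>2 = complex_of_real ((norm (opoly r Y))\<^sup>2)"
    using norm_attained[OF Y] by blast
  have "poly r (complex_of_real t) = complex_of_real ((cmod (poly p (complex_of_real t)))\<^sup>2)"
    unfolding r_def complex_norm_square by simp
  with t(2) have "((cmod (poly p (complex_of_real t)))\<^sup>2)\<^sup>2 = (norm (opoly r Y))\<^sup>2"
    by (simp only: flip: of_real_power of_real_eq_iff[where 'a = complex])
  then have "norm (opoly r Y) = (cmod (poly p (complex_of_real t)))\<^sup>2"
    by (simp only: power2_eq_iff_nonneg norm_ge_zero zero_le_power2)
  then have "(norm (opoly p Y))\<^sup>2 \<le> (cmod (poly p (complex_of_real t)))\<^sup>2"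
    using norm_adj_mult[OF adj] by (simp add: r_def)
  then have "norm (opoly p Y) \<le> cmod (poly p (complex_of_real t))" by (rule power2_le_imp_le) simp
  with M[OF t(1)] show ?thesis by simp
qed

text \<open>
  The continuous functional calculus as a relation: \<open>fcalc a b Y f T\<close> says that \<open>T = f(Y)\<close>,
  for \<open>f\<close> continuous on an interval \<open>[a, b]\<close> containing the spectrum of \<open>Y\<close>.
\<close>

definition fcalc :: "real \<Rightarrow> real \<Rightarrow> hardy_op \<Rightarrow> (real \<Rightarrow> complex) \<Rightarrow> hardy_op \<Rightarrow> bool" where
  "fcalc a b Y f T \<longleftrightarrow> (\<exists>p. uniform_limit {a..b} (\<lambda>n t. poly (p n) (complex_of_real t)) f sequentially
     \<and> (\<lambda>n. opoly (p n) Y) \<longlonglongrightarrow> T)"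

lemma fcalcI:
  assumes "uniform_limit {a..b} (\<lambda>n t. poly (p n) (complex_of_real t)) f sequentially"
    "(\<lambda>n. opoly (p n) Y) \<longlonglongrightarrow> T"
  shows "fcalc a b Y f T"
  using assms unfolding fcalc_def by blast

lemma fcalcE:
  assumes "fcalc a b Y f T"
  obtains p where "uniform_limit {a..b} (\<lambda>n t. poly (p n) (complex_of_real t)) f sequentially"
    "(\<lambda>n. opoly (p n) Y) \<longlonglongrightarrow> T"
  using assms unfolding fcalc_def by blast

lemma fcalc_continuous: "fcalc a b Y f T \<Longrightarrow> continuous_on {a..b} f"
proof (erule fcalcE, rule uniform_limit_theorem)
  show "\<forall>\<^sub>F n in sequentially. continuous_on {a..b} (\<lambda>t. poly (p n) (complex_of_real t))" for p
    by (intro always_eventually allI continuous_intros)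
qed simp_all

lemma fcalc_bounded: "fcalc a b Y f T \<Longrightarrow> bounded (f ` {a..b})"
  by (intro compact_imp_bounded compact_continuous_image fcalc_continuous) auto

lemma fcalc_poly: "fcalc a b Y (\<lambda>t. poly p (complex_of_real t)) (opoly p Y)"
  by (rule fcalcI[where p = "\<lambda>n. p"]) (simp_all add: uniform_limit_const)

lemma fcalc_const: "fcalc a b Y (\<lambda>t. c) (sc c)"
  using fcalc_poly[of a b Y "[:c:]"] by simp

lemma fcalc_id: "fcalc a b Y complex_of_real Y"
  using fcalc_poly[of a b Y "[:0, 1:]"] by simp

lemma fcalc_add: "fcalc a b Y f S \<Longrightarrow> fcalc a b Y g T \<Longrightarrow> fcalc a b Y (\<lambda>t. f t + g t) (S + T)"
proof (elim fcalcE)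
  fix p q
  assume "uniform_limit {a..b} (\<lambda>n t. poly (p n) (complex_of_real t)) f sequentially"
    "uniform_limit {a..b} (\<lambda>n t. poly (q n) (complex_of_real t)) g sequentially"
    "(\<lambda>n. opoly (p n) Y) \<longlonglongrightarrow> S" "(\<lambda>n. opoly (q n) Y) \<longlonglongrightarrow> T"
  then show ?thesis
    by (intro fcalcI[where p = "\<lambda>n. p n + q n"]) (auto intro: uniform_limit_add tendsto_add)
qed

lemma fcalc_mult:
  assumes S: "fcalc a b Y f S" and T: "fcalc a b Y g T"
  shows "fcalc a b Y (\<lambda>t. f t * g t) (S * T)"
  using S T
proof (elim fcalcE)
  fix p q
  assume "uniform_limit {a..b} (\<lambda>n t. poly (p n) (complex_of_real t)) f sequentially"
    "uniform_limit {a..b} (\<lambda>n t. poly (q n) (complex_of_real t)) g sequentially"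
    "(\<lambda>n. opoly (p n) Y) \<longlonglongrightarrow> S" "(\<lambda>n. opoly (q n) Y) \<longlonglongrightarrow> T"
  then show ?thesis
    using fcalc_bounded[OF S] fcalc_bounded[OF T]
    by (intro fcalcI[where p = "\<lambda>n. p n * q n"]) (auto intro: uniform_lim_mult tendsto_mult)
qed

lemma fcalc_diff:
  assumes "fcalc a b Y f S" "fcalc a b Y g T"
  shows "fcalc a b Y (\<lambda>t. f t - g t) (S - T)"
  using fcalc_add[OF assms(1) fcalc_mult[OF fcalc_const[of _ _ _ "-1"] assms(2)]] by (simp add: sc_minus)

lemma fcalc_cong:
  assumes "fcalc a b Y f T" "\<And>t. t \<in> {a..b} \<Longrightarrow> f t = g t"
  shows "fcalc a b Y g T"
proof -
  obtain p where p: "uniform_limit {a..b} (\<lambda>n t. poly (p n) (complex_of_real t)) f sequentially"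
    "(\<lambda>n. opoly (p n) Y) \<longlonglongrightarrow> T"
    using assms(1) by (rule fcalcE)
  have "uniform_limit {a..b} (\<lambda>n t. poly (p n) (complex_of_real t)) g sequentially"
    using p(1) assms(2) by (simp add: uniform_limit_iff)
  then show ?thesis using p(2) by (rule fcalcI)
qed

text \<open>The estimate \<open>opoly_norm_le\<close> passed to the limit. In the form of a
  difference it contains uniqueness (\<open>M = 0\<close>) and spectral bounds (\<open>g\<close>
  constant).\<close>

lemma fcalc_norm_diff:
  assumes Y: "spec_in Y a b" and S: "fcalc a b Y f S" and T: "fcalc a b Y g T"
    and M: "\<And>t. t \<in> {a..b} \<Longrightarrow> cmod (f t - g t) \<le> M"
  shows "norm (S - T) \<le> M"
proof (rule field_le_epsilon)
  fix e :: real assume e: "0 < e"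
  obtain p where p: "uniform_limit {a..b} (\<lambda>n t. poly (p n) (complex_of_real t)) f sequentially"
    "(\<lambda>n. opoly (p n) Y) \<longlonglongrightarrow> S"
    using S by (rule fcalcE)
  obtain q where q: "uniform_limit {a..b} (\<lambda>n t. poly (q n) (complex_of_real t)) g sequentially"
    "(\<lambda>n. opoly (q n) Y) \<longlonglongrightarrow> T"
    using T by (rule fcalcE)
  have lim: "(\<lambda>n. norm (opoly (p n) Y - opoly (q n) Y)) \<longlonglongrightarrow> norm (S - T)"
    by (intro tendsto_intros p q)
  have "\<forall>\<^sub>F n in sequentially. norm (opoly (p n) Y - opoly (q n) Y) \<le> M + e"
    using uniform_limitD[OF p(1) half_gt_zero[OF e]] uniform_limitD[OF q(1) half_gt_zero[OF e]]
  proof eventually_elim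
    case (elim n)
    have "norm (opoly (p n - q n) Y) \<le> M + e"
    proof (rule opoly_norm_le[OF Y])
      fix t assume t: "t \<in> {a..b}"
      have "dist (poly (p n) (complex_of_real t)) (f t) < e / 2"
        "dist (poly (q n) (complex_of_real t)) (g t) < e / 2"
        using elim t by blast+
      then show "cmod (poly (p n - q n) (complex_of_real t)) \<le> M + e"
        using M[OF t] norm_triangle_ineq[of "poly (p n) t - f t - (poly (q n) t - g t)" "f t - g t"]
          norm_triangle_ineq4[of "poly (p n) t - f t" "poly (q n) t - g t"]
        by (simp add: dist_norm algebra_simps)
    qed
    then show ?case by simp
  qed
  then show "norm (S - T) \<le> M + e" by (rule tendsto_upperbound[OF lim]) simp
qed

lemma fcalc_unique:
  assumes "spec_in Y a b" "fcalc a b Y f S" "fcalc a b Y g T" "\<And>t. t \<in> {a..b} \<Longrightarrow> f t = g t"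
  shows "S = T"
  using fcalc_norm_diff[OF assms(1-3), of 0] assms(4) by simp

section \<open>Existence and further rules of the calculus\<close>

lemma poly_approx:
  fixes f :: "real \<Rightarrow> complex"
  assumes f: "continuous_on {a..b} f" and e: "0 < e"
  shows "\<exists>p. \<forall>t\<in>{a..b}. cmod (poly p (complex_of_real t) - f t) < e"
proof -
  \<comment> \<open>The real and the imaginary part of \<open>f\<close> are approximated separately,
    each to within half of \<open>e\<close>.\<close>
  have *: "\<exists>p. \<forall>t\<in>{a..b}. cmod (poly p (complex_of_real t) - complex_of_real (g t)) < e / 2"
    if g: "continuous_on {a..b} g" for g :: "real \<Rightarrow> real"
  proof -
    obtain h where h: "real_polynomial_function h" "\<And>t. t \<in> {a..b} \<Longrightarrow> \<bar>g t - h t\<bar> < e / 2"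
      using Stone_Weierstrass_real_polynomial_function[OF compact_Icc g half_gt_zero[OF e]] by blast
    obtain c n where c: "h = (\<lambda>x. \<Sum>i\<le>n. c i * x ^ i)"
      using h(1) real_polynomial_function_iff_sum by blast
    define p where "p = (\<Sum>i\<le>n. monom (complex_of_real (c i)) i)"
    have "poly p (complex_of_real t) = complex_of_real (h t)" for t
      by (simp add: p_def c poly_sum poly_monom)
    then have "cmod (poly p (complex_of_real t) - complex_of_real (g t)) = \<bar>g t - h t\<bar>" for t
      by (simp add: abs_minus_commute flip: of_real_diff)
    then show ?thesis using h(2) by (intro exI[of _ p]) simp
  qed
  obtain p where p: "\<And>t. t \<in> {a..b} \<Longrightarrow> cmod (poly p (complex_of_real t) - complex_of_real (Re (f t))) < e / 2"
    using *[of "\<lambda>t. Re (f t)"] continuous_on_Re[OF f] by blast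
  obtain q where q: "\<And>t. t \<in> {a..b} \<Longrightarrow> cmod (poly q (complex_of_real t) - complex_of_real (Im (f t))) < e / 2"
    using *[of "\<lambda>t. Im (f t)"] continuous_on_Im[OF f] by blast
  have "cmod (poly (p + smult \<i> q) (complex_of_real t) - f t) < e" if t: "t \<in> {a..b}" for t
  proof -
    have "poly (p + smult \<i> q) (complex_of_real t) - f t
        = poly (p + smult \<i> q) (complex_of_real t) - (complex_of_real (Re (f t)) + \<i> * complex_of_real (Im (f t)))"
      by (rule arg_cong[OF complex_eq])
    also have "\<dots> = (poly p t - complex_of_real (Re (f t))) + \<i> * (poly q t - complex_of_real (Im (f t)))"
      by (simp add: algebra_simps)
    also have "cmod \<dots> \<le> cmod (poly p t - complex_of_real (Re (f t))) + cmod (poly q t - complex_of_real (Im (f t)))"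
      by (rule order_trans[OF norm_triangle_ineq]) (simp add: norm_mult)
    finally show ?thesis using p[OF t] q[OF t] by simp
  qed
  then show ?thesis by blast
qed

lemma fcalc_exists:
  assumes Y: "spec_in Y a b" and f: "continuous_on {a..b} f"
  obtains T where "fcalc a b Y f T"
proof -
  have "\<forall>n. \<exists>p. \<forall>t\<in>{a..b}. cmod (poly p (complex_of_real t) - f t) < 1 / real (Suc n)"
    using poly_approx[OF f] by simp
  from choice[OF this] obtain p
    where p: "\<And>n t. t \<in> {a..b} \<Longrightarrow> cmod (poly (p n) (complex_of_real t) - f t) < 1 / real (Suc n)" by blast
  have small: "\<exists>N. \<forall>n\<ge>N. 1 / real (Suc n) < e" if "0 < e" for e
    using order_tendstoD(2)[OF LIMSEQ_Suc[OF lim_1_over_n] that]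
    by (auto simp: eventually_sequentially)
  have u: "uniform_limit {a..b} (\<lambda>n t. poly (p n) (complex_of_real t)) f sequentially"
  proof (rule uniform_limitI)
    fix e :: real assume "0 < e"
    from small[OF this] obtain N where "\<And>n. n \<ge> N \<Longrightarrow> 1 / real (Suc n) < e" by blast
    then show "\<forall>\<^sub>F n in sequentially. \<forall>t\<in>{a..b}. dist (poly (p n) (complex_of_real t)) (f t) < e"
      unfolding eventually_sequentially dist_norm using p less_trans by blast
  qed
  have "Cauchy (\<lambda>n. opoly (p n) Y)"
  proof (rule CauchyI)
    fix e :: real assume e: "0 < e"
    then have "0 < e / 3" by simp
    from small[OF this] obtain N where N: "\<And>n. n \<ge> N \<Longrightarrow> 1 / real (Suc n) < e / 3" by blast
    have "norm (opoly (p m) Y - opoly (p n) Y) < e" if mn: "m \<ge> N" "n \<ge> N" for m n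
    proof -
      have "norm (opoly (p m) Y - opoly (p n) Y) \<le> 2 * (e / 3)"
      proof (rule fcalc_norm_diff[OF Y fcalc_poly fcalc_poly])
        fix t assume t: "t \<in> {a..b}"
        have "cmod ((poly (p m) t - f t) - (poly (p n) t - f t)) \<le> 2 * (e / 3)"
          using p[OF t, of m] p[OF t, of n] N[OF mn(1)] N[OF mn(2)]
            norm_triangle_ineq4[of "poly (p m) t - f t" "poly (p n) t - f t"] by linarith
        then show "cmod (poly (p m) t - poly (p n) t) \<le> 2 * (e / 3)" by simp
      qed
      then show ?thesis using e by simp
    qed
    then show "\<exists>M. \<forall>m\<ge>M. \<forall>n\<ge>M. norm (opoly (p m) Y - opoly (p n) Y) < e" by blast
  qed
  then obtain T where "(\<lambda>n. opoly (p n) Y) \<longlonglongrightarrow> T" by (auto simp: Cauchy_convergent_iff convergent_def)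
  with u show ?thesis by (intro that fcalcI)
qed

text \<open>The definition of \<open>fcalc\<close> supplies some approximating sequence; here every
  one works. So polynomials chosen for one operator can be reused for another, as adjoints and
  intertwining relations require.\<close>

lemma opoly_tendsto:
  assumes Y: "spec_in Y a b" and T: "fcalc a b Y f T"
    and u: "uniform_limit {a..b} (\<lambda>n t. poly (p n) (complex_of_real t)) f sequentially"
  shows "(\<lambda>n. opoly (p n) Y) \<longlonglongrightarrow> T"
proof (rule tendstoI)
  fix e :: real assume e: "0 < e"
  show "\<forall>\<^sub>F n in sequentially. dist (opoly (p n) Y) T < e"
    using uniform_limitD[OF u half_gt_zero[OF e]]
  proof eventually_elim
    case (elim n)
    have "norm (opoly (p n) Y - T) \<le> e / 2"
      using elim by (intro fcalc_norm_diff[OF Y fcalc_poly T]) (auto simp: dist_norm less_imp_le)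
    then show ?case using e by (simp add: dist_norm)
  qed
qed

lemma fcalc_adj:
  assumes Y: "spec_in Y a b" and S: "fcalc a b Y f S" and T: "fcalc a b Y g T"
    and fg: "\<And>t. t \<in> {a..b} \<Longrightarrow> g t = cnj (f t)"
  shows "adj S T"
proof -
  obtain p where p: "uniform_limit {a..b} (\<lambda>n t. poly (p n) (complex_of_real t)) f sequentially"
    "(\<lambda>n. opoly (p n) Y) \<longlonglongrightarrow> S"
    using S by (rule fcalcE)
  have "uniform_limit {a..b} (\<lambda>n t. poly (map_poly cnj (p n)) (complex_of_real t)) g sequentially"
    using p(1) fg by (simp add: uniform_limit_iff dist_norm flip: complex_cnj_diff)
  then have "(\<lambda>n. opoly (map_poly cnj (p n)) Y) \<longlonglongrightarrow> T" by (rule opoly_tendsto[OF Y T])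
  then show ?thesis using p(2) by (intro adj_tendsto[OF adj_opoly[OF spec_in_adj[OF Y]]])
qed

lemma fcalc_spec_in:
  assumes Y: "spec_in Y a b" and X: "fcalc a b Y (\<lambda>t. complex_of_real (f t)) X"
    and f: "\<And>t. t \<in> {a..b} \<Longrightarrow> f t \<in> {c..d}"
  shows "spec_in X c d"
proof -
  \<comment> \<open>Values in \<open>[c, d]\<close> stay within half its length of its midpoint,
    which is the shape that \<open>spec_in_near\<close> expects.\<close>
  have "norm (X - sc (complex_of_real ((c + d) / 2))) \<le> (d - c) / 2"
  proof (rule fcalc_norm_diff[OF Y X fcalc_const])
    fix t assume "t \<in> {a..b}"
    from f[OF this] have "\<bar>f t - (c + d) / 2\<bar> \<le> (d - c) / 2" by (auto simp: abs_le_iff field_simps)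
    then show "cmod (complex_of_real (f t) - complex_of_real ((c + d) / 2)) \<le> (d - c) / 2"
      unfolding of_real_diff[symmetric] norm_of_real .
  qed
  from spec_in_near[OF fcalc_adj[OF Y X X] this] show ?thesis
    by (simp add: field_simps)
qed

text \<open>For a polynomial in place of \<open>g\<close> this is an induction. Polynomials close to
  \<open>g\<close> on \<open>[c, d]\<close>, composed with \<open>f\<close>, are close to the
  composition on \<open>[a, b]\<close>, which settles the general case.\<close>

lemma fcalc_compose:
  assumes Y: "spec_in Y a b" and X: "fcalc a b Y (\<lambda>t. complex_of_real (f t)) X"
    and f: "\<And>t. t \<in> {a..b} \<Longrightarrow> f t \<in> {c..d}" and Z: "fcalc c d X g Z"
  shows "fcalc a b Y (\<lambda>t. g (f t)) Z"
proof -
  have XS: "spec_in X c d" by (rule fcalc_spec_in[OF Y X f])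
  have pol: "fcalc a b Y (\<lambda>t. poly q (complex_of_real (f t))) (opoly q X)" for q
  proof (induction q)
    case 0
    then show ?case using fcalc_const[of a b Y 0] by simp
  next
    case (pCons k q)
    show ?case
      using fcalc_add[OF fcalc_const[of a b Y k] fcalc_mult[OF X pCons(2)]] by simp
  qed
  have "continuous_on {a..b} f"
    using continuous_on_Re[OF fcalc_continuous[OF X]] by simp
  then have "continuous_on {a..b} (\<lambda>t. g (f t))"
    using f by (intro continuous_on_compose2[OF fcalc_continuous[OF Z]]) auto
  then obtain W where W: "fcalc a b Y (\<lambda>t. g (f t)) W" using fcalc_exists[OF Y] by blast
  obtain q where q: "uniform_limit {c..d} (\<lambda>n t. poly (q n) (complex_of_real t)) g sequentially"
    "(\<lambda>n. opoly (q n) X) \<longlonglongrightarrow> Z"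
    using Z by (rule fcalcE)
  have "(\<lambda>n. opoly (q n) X) \<longlonglongrightarrow> W"
  proof (rule tendstoI)
    fix e :: real assume e: "0 < e"
    show "\<forall>\<^sub>F n in sequentially. dist (opoly (q n) X) W < e"
      using uniform_limitD[OF q(1) half_gt_zero[OF e]]
    proof eventually_elim
      case (elim n)
      have "norm (opoly (q n) X - W) \<le> e / 2"
        using elim f by (intro fcalc_norm_diff[OF Y pol W]) (auto simp: dist_norm less_imp_le)
      then show ?case using e by (simp add: dist_norm)
    qed
  qed
  with q(2) have "Z = W" by (rule LIMSEQ_unique)
  with W show ?thesis by simp
qed

section \<open>Positive roots, norms and exponentials\<close>

lemma positive_sqrt_unique:
  assumes S: "spec_in S 0 b" and T: "spec_in T 0 b" and eq: "S * S = T * T"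
  shows "S = T"
proof -
  have sq: "fcalc 0 b U (\<lambda>t. complex_of_real (t\<^sup>2)) (U * U)" for U
    using fcalc_mult[OF fcalc_id fcalc_id, of 0 b U] by (simp add: power2_eq_square)
  have in_sq: "t\<^sup>2 \<in> {0..b\<^sup>2}" if "t \<in> {0..b}" for t :: real
    using that by (auto intro: power_mono)
  \<comment> \<open>A positive operator is recovered from its square, since
    \<open>sqrt (t\<^sup>2) = t\<close> on \<open>[0, b]\<close>; operators with a common square
    therefore coincide.\<close>
  have root: "Z = U" if U: "spec_in U 0 b" and Z: "fcalc 0 (b\<^sup>2) (U * U) (\<lambda>t. complex_of_real (sqrt t)) Z" for U Z
    by (rule fcalc_unique[OF U fcalc_compose[OF U sq in_sq Z] fcalc_id]) auto
  have "continuous_on {0..b\<^sup>2} (\<lambda>t. complex_of_real (sqrt t))" by (intro continuous_intros)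
  with fcalc_spec_in[OF S sq in_sq]
  obtain Z where Z: "fcalc 0 (b\<^sup>2) (S * S) (\<lambda>t. complex_of_real (sqrt t)) Z"
    by (rule fcalc_exists)
  show ?thesis using root[OF S Z] root[OF T Z[unfolded eq]] by simp
qed

lemma spec_in_norm:
  assumes "adj X X" "norm X \<le> r"
  shows "spec_in X (- r) r"
  using spec_in_near[of X 0 r] assms by simp

lemma norm_spec_in:
  assumes "spec_in X (- r) r"
  shows "norm X \<le> r"
  using fcalc_norm_diff[OF assms fcalc_id fcalc_const[of _ _ _ 0], of r] by (simp add: abs_le_iff)

text \<open>Connects the exponential series of the Banach algebra with the calculus: its partial
  sums are polynomials in \<open>X\<close>, and the M-test gives uniform convergence on
  \<open>[a, b]\<close>.\<close>

lemma fcalc_exp_i: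
  assumes X: "spec_in X a b"
  shows "fcalc a b X (\<lambda>t. exp (\<i> * complex_of_real t)) (exp_i X)"
proof (rule fcalcI[where p = "\<lambda>n. \<Sum>k<n. monom (\<i> ^ k / fact k) k"])
  define r where "r = max \<bar>a\<bar> \<bar>b\<bar>"
  have "uniform_limit {a..b} (\<lambda>n t. \<Sum>k<n. (\<i> * complex_of_real t) ^ k /\<^sub>R fact k)
      (\<lambda>t. suminf (\<lambda>k. (\<i> * complex_of_real t) ^ k /\<^sub>R fact k)) sequentially"
  proof (rule Weierstrass_m_test_ev)
    have "norm ((\<i> * complex_of_real t) ^ k /\<^sub>R fact k) \<le> r ^ k /\<^sub>R fact k" if "t \<in> {a..b}" for t k
    proof -
      have "\<bar>t\<bar> ^ k \<le> r ^ k" using that by (intro power_mono) (auto simp: r_def)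
      then show ?thesis by (simp add: norm_mult norm_power power_mult_distrib divide_right_mono field_simps)
    qed
    then show "\<forall>\<^sub>F k in sequentially. \<forall>t\<in>{a..b}.
        norm ((\<i> * complex_of_real t) ^ k /\<^sub>R fact k) \<le> r ^ k /\<^sub>R fact k"
      by simp
    show "summable (\<lambda>k. r ^ k /\<^sub>R fact k)" by (rule summable_exp_generic)
  qed
  moreover have "poly (\<Sum>k<n. monom (\<i> ^ k / fact k) k) (complex_of_real t)
      = (\<Sum>k<n. (\<i> * complex_of_real t) ^ k /\<^sub>R fact k)" for n t
    by (simp add: poly_sum poly_monom power_mult_distrib scaleR_conv_of_real field_simps)
  ultimately show "uniform_limit {a..b} (\<lambda>n t. poly (\<Sum>k<n. monom (\<i> ^ k / fact k) k) (complex_of_real t))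
      (\<lambda>t. exp (\<i> * complex_of_real t)) sequentially"
    by (simp add: exp_def)
  have monom: "opoly (monom c k) X = sc c * X ^ k" for c k
  proof (induction k)
    case (Suc k)
    have "X * (sc c * X ^ k) = sc c * (X * X ^ k)" by (simp only: sc_commute[of X] flip: mult.assoc)
    then show ?case by (simp add: monom_Suc Suc)
  qed (simp add: monom_0)
  have power: "(sc c * X) ^ k = sc (c ^ k) * X ^ k" for c k
  proof (induction k)
    case (Suc k)
    have "sc c * X * (sc (c ^ k) * X ^ k) = sc c * (X * sc (c ^ k)) * X ^ k" by (simp only: mult.assoc)
    also have "\<dots> = sc c * (sc (c ^ k) * X) * X ^ k" by (simp only: sc_commute[of X])
    finally show ?case by (simp add: Suc sc_mult mult.assoc)
  qed simp
  have sum: "opoly (\<Sum>k<n. monom (\<i> ^ k / fact k) k) X = (\<Sum>k<n. (sc \<i> * X) ^ k /\<^sub>R fact k)" for n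
  proof (induction n)
    case (Suc n)
    have "sc (\<i> ^ n / fact n) = sc (\<i> ^ n) /\<^sub>R fact n"
    proof -
      have eq: "\<i> ^ n / fact n = complex_of_real (inverse (fact n)) * \<i> ^ n"
        by (simp add: divide_inverse)
      show ?thesis unfolding eq sc_mult sc_of_real by simp
    qed
    then show ?case by (simp add: Suc monom power)
  qed simp
  show "(\<lambda>n. opoly (\<Sum>k<n. monom (\<i> ^ k / fact k) k) X) \<longlonglongrightarrow> exp_i X"
    unfolding sum exp_i_def scaleC_op_conv_sc[of \<i> X] using exp_converges[of "sc \<i> * X"]
    by (simp add: sums_def)
qed

section \<open>Geodesics between subspaces in generic position\<close>

text \<open>The operator \<open>2 P - 1\<close> for the projection \<open>P\<close> onto
  \<open>S\<close>. Reflections turn geometry into algebra: co-diagonality of \<open>X\<close>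
  becomes \<open>E X = - X E\<close>, and \<open>U S = T\<close> for unitary \<open>U\<close>
  becomes \<open>U E = F U\<close>.\<close>

definition reflection :: "hardy2 set \<Rightarrow> hardy_op \<Rightarrow> bool" where
  "reflection S E \<longleftrightarrow> adj E E \<and> E * E = 1 \<and> (\<forall>f. f \<in> S \<longleftrightarrow> op_apply E f = f) \<and>
     (\<forall>f. f \<in> ortho S \<longleftrightarrow> op_apply E f = - f)"

lemma reflectionD:
  assumes "reflection S E"
  shows "adj E E" "E * E = 1" "\<And>f. f \<in> S \<longleftrightarrow> op_apply E f = f"
    "\<And>f. f \<in> ortho S \<longleftrightarrow> op_apply E f = - f" "\<And>f. op_apply E (op_apply E f) = f"
proof -
  show *: "adj E E" "E * E = 1" "f \<in> S \<longleftrightarrow> op_apply E f = f"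
    "f \<in> ortho S \<longleftrightarrow> op_apply E f = - f" for f
    using assms by (simp_all add: reflection_def)
  show "op_apply E (op_apply E f) = f" for f using *(2) op_apply_mult[of E E f] by simp
qed

lemma reflection_exists:
  assumes S: "S \<in> Gr"
  obtains E where "reflection S E"
proof -
  obtain P where P: "proj S P" using proj_exists[OF S] .
  have PP: "P * P = P" by (rule proj_idem[OF S P])
  have "adj (P + P - 1) (P + P - 1)" by (intro adj_add adj_diff adj_1 proj_adj[OF P])
  moreover have "(P + P - 1) * (P + P - 1) = 1" by (simp add: algebra_simps PP)
  moreover have "f \<in> S \<longleftrightarrow> op_apply (P + P - 1) f = f" for f
  proof -
    have "op_apply (P + P - 1) f = f \<longleftrightarrow> 2 *\<^sub>R (op_apply P f - f) = 0"
      by (simp add: scaleR_2 algebra_simps)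
    then show ?thesis using proj_in_iff[OF S P] by simp
  qed
  moreover have "f \<in> ortho S \<longleftrightarrow> op_apply (P + P - 1) f = - f" for f
  proof -
    have "op_apply (P + P - 1) f = - f \<longleftrightarrow> 2 *\<^sub>R (op_apply P f) = 0"
      by (simp only: scaleR_2 op_apply_add op_apply_diff op_apply_1) (auto simp: algebra_simps)
    then show ?thesis using proj_ortho_iff[OF S P] by simp
  qed
  ultimately show ?thesis by (intro that[of "P + P - 1"]) (simp add: reflection_def)
qed

lemma reflection_split:
  assumes "reflection S E"
  obtains g h where "f = g + h" "g \<in> S" "h \<in> ortho S"
proof
  show "f = (1/2) *\<^sub>R (f + op_apply E f) + (1/2) *\<^sub>R (f - op_apply E f)"
    by (rule hardy_eqI) (simp add: field_simps)
  have lin: "op_apply E (r *\<^sub>R f) = r *\<^sub>R op_apply E f" for r f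
    by (simp add: scaleR_conv_scaleC op_apply_scaleC_right)
  show "(1/2) *\<^sub>R (f + op_apply E f) \<in> S"
    unfolding reflectionD(3)[OF assms] by (simp add: lin op_apply_add_right reflectionD(5)[OF assms] add.commute)
  show "(1/2) *\<^sub>R (f - op_apply E f) \<in> ortho S"
    unfolding reflectionD(4)[OF assms]
    by (simp add: lin op_apply_diff_right reflectionD(5)[OF assms] flip: scaleR_minus_right)
qed

lemma co_diagonal_iff:
  assumes E: "reflection S E"
  shows "co_diagonal X S \<longleftrightarrow> E * X = - (X * E)"
proof
  assume X: "co_diagonal X S"
  show "E * X = - (X * E)"
  proof (rule op_eqI)
    fix f
    obtain g h where f: "f = g + h" and g: "g \<in> S" and h: "h \<in> ortho S"
      using reflection_split[OF E] .
    have "op_apply X g \<in> ortho S" "op_apply X h \<in> S" using X g h by (auto simp: co_diagonal_def)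
    then have "op_apply E (op_apply X g) = - op_apply X g" "op_apply E (op_apply X h) = op_apply X h"
      using reflectionD[OF E] by auto
    moreover have "op_apply E g = g" "op_apply E h = - h" using g h reflectionD[OF E] by auto
    moreover have "op_apply X (- h) = - op_apply X h" using op_apply_diff_right[of X 0 h] by simp
    ultimately show "op_apply (E * X) f = op_apply (- (X * E)) f"
      by (simp add: f op_apply_add_right)
  qed
next
  assume "E * X = - (X * E)"
  then have *: "op_apply E (op_apply X f) = - op_apply X (op_apply E f)" for f
    by (metis op_apply_minus op_apply_mult)
  have m: "op_apply X (- h) = - op_apply X h" for h using op_apply_diff_right[of X 0 h] by simp
  show "co_diagonal X S"
    unfolding co_diagonal_def using * m by (auto simp: reflectionD(3,4)[OF E])
qed

lemma unitary_image_iff: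
  assumes E: "reflection S E" and F: "reflection T F"
    and U: "adj U U'" "U * U' = 1" "U' * U = 1"
  shows "op_apply U ` S = T \<longleftrightarrow> U * E = F * U"
proof
  have U'U: "op_apply U' (op_apply U f) = f" and UU': "op_apply U (op_apply U' f) = f" for f
    using U(2,3) by (metis op_apply_1 op_apply_mult)+
  assume im: "op_apply U ` S = T"
  show "U * E = F * U"
  proof (rule op_eqI)
    fix f
    obtain g h where f: "f = g + h" and g: "g \<in> S" and h: "h \<in> ortho S"
      using reflection_split[OF E] .
    have "op_apply U g \<in> T" using im g by auto
    then have "op_apply F (op_apply U g) = op_apply U g" using reflectionD(3)[OF F] by simp
    moreover have "op_apply U h \<in> ortho T"
      unfolding ortho_def
    proof safe
      fix k assume "k \<in> T"
      then obtain m where "m \<in> S" "k = op_apply U m" using im by auto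
      then show "cinner k (op_apply U h) = 0"
        using orthoD(1)[OF h] by (simp add: adjD[OF U(1)] U'U)
    qed
    then have "op_apply F (op_apply U h) = - op_apply U h" using reflectionD(4)[OF F] by simp
    moreover have "op_apply E g = g" "op_apply E h = - h" using g h reflectionD[OF E] by auto
    moreover have "op_apply U (- h) = - op_apply U h" using op_apply_diff_right[of U 0 h] by simp
    ultimately show "op_apply (U * E) f = op_apply (F * U) f"
      by (simp add: f op_apply_add_right)
  qed
next
  have U'U: "op_apply U' (op_apply U f) = f" and UU': "op_apply U (op_apply U' f) = f" for f
    using U(2,3) by (metis op_apply_1 op_apply_mult)+
  assume "U * E = F * U"
  then have *: "op_apply U (op_apply E f) = op_apply F (op_apply U f)" for f by (metis op_apply_mult)
  show "op_apply U ` S = T"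
  proof
    show "op_apply U ` S \<subseteq> T"
      using * by (auto simp: reflectionD(3)[OF E] reflectionD(3)[OF F]) metis
    show "T \<subseteq> op_apply U ` S"
    proof
      fix g assume "g \<in> T"
      then have "op_apply F g = g" using reflectionD(3)[OF F] by simp
      then have "op_apply E (op_apply U' g) = op_apply U' g"
        using *[of "op_apply U' g"] U'U[of "op_apply E (op_apply U' g)"] by (simp add: UU')
      then have "op_apply U' g \<in> S" using reflectionD(3)[OF E] by simp
      then show "g \<in> op_apply U ` S" using UU'[of g] by (metis imageI)
    qed
  qed
qed

section \<open>Intertwining relations for exponentials and functions of operators\<close>

lemma exp_intertwine:
  fixes A :: "'a :: {real_normed_algebra_1, banach}"
  assumes "A * Z = W * A"
  shows "A * exp Z = exp W * A"
proof -
  have pow: "A * Z ^ n = W ^ n * A" for n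
  proof (induction n)
    case (Suc n)
    have "A * Z ^ Suc n = (A * Z) * Z ^ n" by (simp add: mult.assoc)
    also have "\<dots> = W * (A * Z ^ n)" by (simp only: assms mult.assoc)
    also have "\<dots> = W ^ Suc n * A" by (simp only: Suc mult.assoc power_Suc)
    finally show ?case .
  qed simp
  have "(\<lambda>n. A * (Z ^ n /\<^sub>R fact n)) sums (A * exp Z)"
    by (intro sums_mult exp_converges)
  moreover have "(\<lambda>n. (W ^ n /\<^sub>R fact n) * A) sums (exp W * A)"
    by (intro sums_mult2 exp_converges)
  ultimately show ?thesis by (simp add: pow sums_unique2)
qed

lemma exp_i_inverse: "exp_i X * exp_i (- X) = 1" "exp_i (- X) * exp_i X = 1"
proof -
  have "scaleC_op \<i> (- X) = - scaleC_op \<i> X"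
    by (simp add: scaleC_op_conv_sc[of _ X] scaleC_op_conv_sc[of _ "- X"])
  then show "exp_i X * exp_i (- X) = 1" "exp_i (- X) * exp_i X = 1"
    using exp_minus_inverse[of "scaleC_op \<i> X"] exp_minus_inverse[of "- scaleC_op \<i> X"]
    by (simp_all add: exp_i_def)
qed

lemma fcalc_exp_minus_i:
  assumes X: "spec_in X (- r) r"
  shows "fcalc (- r) r X (\<lambda>t. exp (- (\<i> * complex_of_real t))) (exp_i (- X))"
proof -
  have m: "fcalc (- r) r X (\<lambda>t. complex_of_real (- t)) (- X)"
    using fcalc_diff[OF fcalc_const[of _ _ _ 0] fcalc_id[of "- r" r X]] by simp
  have "spec_in (- X) (- r) r" by (rule fcalc_spec_in[OF X m]) auto
  from fcalc_compose[OF X m _ fcalc_exp_i[OF this]] show ?thesis by auto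
qed

lemma adj_exp_i:
  assumes "adj X X"
  shows "adj (exp_i X) (exp_i (- X))"
proof -
  have X: "spec_in X (- norm X) (norm X)" by (rule spec_in_norm[OF assms order_refl])
  show ?thesis
    by (rule fcalc_adj[OF X fcalc_exp_i[OF X] fcalc_exp_minus_i[OF X]]) (simp add: exp_cnj)
qed

lemma exp_i_image_iff:
  assumes "reflection S E" "reflection T F" "adj X X"
  shows "op_apply (exp_i X) ` S = T \<longleftrightarrow> exp_i X * E = F * exp_i X"
  by (rule unitary_image_iff[OF assms(1,2) adj_exp_i[OF assms(3)] exp_i_inverse])

lemma exp_i_anticommute:
  assumes "E * X = - (X * E)"
  shows "E * exp_i X = exp_i (- X) * E"
proof -
  have "E * (sc \<i> * X) = (sc \<i> * (- X)) * E"
    using assms by (simp add: sc_commute[of E] flip: mult.assoc) (simp add: mult.assoc assms)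
  then show ?thesis
    unfolding exp_i_def scaleC_op_conv_sc[of _ X] scaleC_op_conv_sc[of _ "- X"] by (rule exp_intertwine)
qed

lemma opoly_intertwine: "B * Y = Y' * B \<Longrightarrow> B * opoly p Y = opoly p Y' * B"
proof (induction p)
  case (pCons c p)
  have "B * (Y * opoly p Y) = (B * Y) * opoly p Y" by (simp only: mult.assoc)
  also have "\<dots> = Y' * (B * opoly p Y)" by (simp only: pCons.prems mult.assoc)
  also have "\<dots> = Y' * opoly p Y' * B" by (simp only: pCons mult.assoc)
  finally show ?case by (simp add: distrib_left distrib_right sc_commute)
qed simp

text \<open>The relation is clear for polynomials, and the same polynomials approximate both sides.
  It is applied with \<open>Y' = Y\<close> to obtain commutation and with \<open>Y' = - Y\<close> to
  obtain anticommutation.\<close>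

lemma fcalc_intertwine:
  assumes Y': "spec_in Y' a b" and BY: "B * Y = Y' * B"
    and T: "fcalc a b Y f T" and T': "fcalc a b Y' f T'"
  shows "B * T = T' * B"
proof -
  obtain p where p: "uniform_limit {a..b} (\<lambda>n t. poly (p n) (complex_of_real t)) f sequentially"
    "(\<lambda>n. opoly (p n) Y) \<longlonglongrightarrow> T"
    using T by (rule fcalcE)
  have "(\<lambda>n. B * opoly (p n) Y) \<longlonglongrightarrow> B * T" by (intro tendsto_intros p)
  moreover have "(\<lambda>n. opoly (p n) Y' * B) \<longlonglongrightarrow> T' * B"
    by (intro tendsto_intros opoly_tendsto[OF Y' T' p(1)])
  ultimately show ?thesis unfolding opoly_intertwine[OF BY] by (rule LIMSEQ_unique)
qed

lemma dense_adj:
  assumes d: "closure (range (op_apply C)) = UNIV"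
    and e: "\<And>f g. cinner (op_apply S (op_apply C f)) (op_apply C g) = cinner (op_apply C f) (op_apply T (op_apply C g))"
  shows "adj S T"
  unfolding adj_def
proof (intro allI)
  fix f g
  obtain x where x: "(\<lambda>n. op_apply C (x n)) \<longlonglongrightarrow> f" using closure_range_iff[of f C] d by auto
  obtain y where y: "(\<lambda>n. op_apply C (y n)) \<longlonglongrightarrow> g" using closure_range_iff[of g C] d by auto
  note lim = bounded_linear.tendsto[OF bounded_linear_op_apply]
  have "(\<lambda>n. cinner (op_apply S (op_apply C (x n))) (op_apply C (y n))) \<longlonglongrightarrow> cinner (op_apply S f) g"
    by (intro tendsto_cinner lim x y)
  moreover have "(\<lambda>n. cinner (op_apply C (x n)) (op_apply T (op_apply C (y n)))) \<longlonglongrightarrow> cinner f (op_apply T g)"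
    by (intro tendsto_cinner lim x y)
  ultimately show "cinner (op_apply S f) g = cinner f (op_apply T g)"
    unfolding e by (rule LIMSEQ_unique)
qed

section \<open>Two subspaces in generic position\<close>

locale generic_pair =
  fixes S T :: "hardy2 set" and E F :: hardy_op
  assumes E: "reflection S E" and F: "reflection T F"
    and ST: "\<And>f. f \<in> S \<Longrightarrow> f \<in> ortho T \<Longrightarrow> f = 0"
    and TS: "\<And>f. f \<in> T \<Longrightarrow> f \<in> ortho S \<Longrightarrow> f = 0"
begin

lemma E_E: "E * E = 1" and F_F: "F * F = 1"
  using reflectionD(2)[OF E] reflectionD(2)[OF F] by auto

lemma E_E_mult: "E * (E * B) = B" and F_F_mult: "F * (F * B) = B"
  by (simp_all add: E_E F_F flip: mult.assoc)

text \<open>For a solution \<open>X\<close> these operators turn out to be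
  \<open>W = e^{2iX}\<close>, \<open>A = 2 e^{iX} cos X\<close> and \<open>K = (2 cos X)^2\<close>.
  Primes denote adjoints.\<close>

definition W where "W = F * E"
definition W' where "W' = E * F"
definition A where "A = 1 + W"
definition A' where "A' = 1 + W'"
definition K where "K = A' * A"

lemma W_W': "W * W' = 1" and W'_W: "W' * W = 1"
  by (simp_all add: W_def W'_def E_E_mult F_F_mult E_E F_F mult.assoc)

lemma adj_W: "adj W W'"
  unfolding W_def W'_def by (intro adj_mult reflectionD(1)[OF E] reflectionD(1)[OF F])

lemma adj_A: "adj A A'"
  unfolding A_def A'_def by (intro adj_add adj_1 adj_W)

lemma K_eq: "K = 1 + 1 + W + W'"
  by (simp add: K_def A_def A'_def W'_W algebra_simps)

lemma A_A': "A * A' = K"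
  by (simp add: K_eq A_def A'_def W_W' algebra_simps)

lemma A_A: "A * A = W * K"
  by (simp add: K_eq A_def W_W' algebra_simps mult_2_right)

text \<open>Generic position enters here. If \<open>F E f = - f\<close>, then twice the component of
  \<open>f\<close> in \<open>S\<close>, namely \<open>f + E f\<close>, lies in
  \<open>ortho T\<close>, and twice the component in \<open>ortho S\<close>, namely
  \<open>f - E f\<close>, lies in \<open>T\<close>. Both vanish.\<close>

lemma A_inj:
  assumes "op_apply A f = 0"
  shows "f = 0"
proof -
  have FE: "op_apply F (op_apply E f) = - f"
    using assms by (simp add: A_def W_def add_eq_0_iff)
  have m: "op_apply F (- h) = - op_apply F h" for h using op_apply_diff_right[of F 0 h] by simp
  have Ff: "op_apply F f = - op_apply E f"
    using arg_cong[OF FE, of "op_apply F"] reflectionD(5)[OF F, of "op_apply E f"] by (simp add: m)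
  have "f + op_apply E f = 0"
  proof (rule ST)
    show "f + op_apply E f \<in> S"
      by (simp add: reflectionD(3)[OF E] op_apply_add_right reflectionD(5)[OF E] add.commute)
    show "f + op_apply E f \<in> ortho T"
      by (simp add: reflectionD(4)[OF F] op_apply_add_right FE Ff)
  qed
  moreover have "f - op_apply E f = 0"
  proof (rule TS)
    show "f - op_apply E f \<in> ortho S"
      by (simp add: reflectionD(4)[OF E] op_apply_diff_right reflectionD(5)[OF E])
    show "f - op_apply E f \<in> T"
      by (simp add: reflectionD(3)[OF F] op_apply_diff_right FE Ff)
  qed
  ultimately have "f + f = 0" by (metis add.right_neutral diff_add_cancel add.assoc add.commute)
  then show ?thesis by (simp flip: scaleR_2)
qed

lemma K_inj: "op_apply K f = 0 \<Longrightarrow> f = 0"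
proof (rule A_inj)
  assume "op_apply K f = 0"
  then have "cinner (op_apply A f) (op_apply A f) = 0"
    using adjD[OF adj_A, of f "op_apply A f"] by (simp add: K_def)
  then show "op_apply A f = 0" by (simp add: cinner_norm)
qed

lemma sqrt_K_dense:
  assumes "adj C C" "C * C = K"
  shows "closure (range (op_apply C)) = UNIV"
  using assms(1)
proof (rule dense_range)
  fix f assume "op_apply C f = 0"
  then have "op_apply (C * C) f = 0" by simp
  then show "f = 0" unfolding assms(2) by (rule K_inj)
qed

text \<open>Write \<open>U = exp_i X\<close>. Anticommutation of \<open>X\<close> with
  \<open>E\<close> gives \<open>E U' = U E\<close>, while \<open>U S = T\<close> gives
  \<open>F = U E U'\<close>. Hence \<open>F = U U E\<close>, that is,
  \<open>U U = F E\<close>.\<close>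

lemma solution_facts:
  assumes X: "adj X X" "co_diagonal X S" "op_apply (exp_i X) ` S = T"
  shows "exp_i X * E = E * exp_i (- X)" "exp_i X * exp_i X = W" "exp_i (- X) * exp_i (- X) = W'"
    "exp_i X * E = F * exp_i X"
proof -
  let ?U = "exp_i X" and ?U' = "exp_i (- X)"
  have "E * ?U = ?U' * E"
    using X(2) by (intro exp_i_anticommute) (simp add: co_diagonal_iff[OF E])
  from arg_cong[OF this, of "\<lambda>B. E * B * E"] show UE: "?U * E = E * ?U'"
    by (simp add: mult.assoc E_E E_E_mult)
  show UF: "?U * E = F * ?U" using X(3) exp_i_image_iff[OF E F X(1)] by simp
  have "?U * ?U * E = ?U * (E * ?U')" by (simp only: mult.assoc UE)
  also have "\<dots> = ?U * E * ?U'" by (simp only: mult.assoc)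
  also have "\<dots> = F" by (simp add: UF mult.assoc exp_i_inverse)
  finally have "?U * ?U * E * E = F * E" by simp
  then show UU: "?U * ?U = W" by (simp add: mult.assoc E_E W_def)
  have "?U' * ?U' * (?U * ?U) = 1"
    by (metis exp_i_inverse(2) mult.assoc mult.right_neutral)
  then have "?U' * ?U' * W * W' = W'" by (simp add: UU)
  then show "?U' * ?U' = W'" by (simp add: mult.assoc W_W')
qed

text \<open>\<open>?C X = 2 cos X\<close> is the square root of \<open>K\<close>, and \<open>?Y X = 2 sin X\<close> determines \<open>X\<close>.\<close>

lemma solution_unique:
  assumes X1: "adj X1 X1" "norm X1 \<le> pi / 2" "co_diagonal X1 S" "op_apply (exp_i X1) ` S = T"
    and X2: "adj X2 X2" "norm X2 \<le> pi / 2" "co_diagonal X2 S" "op_apply (exp_i X2) ` S = T"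
  shows "X1 = X2"
proof -
  let ?C = "\<lambda>X. exp_i X + exp_i (- X)" and ?Y = "\<lambda>X. sc (- \<i>) * (exp_i X - exp_i (- X))"
  have e: "exp (\<i> * complex_of_real t) = complex_of_real (cos t) + \<i> * complex_of_real (sin t)"
    "exp (- (\<i> * complex_of_real t)) = complex_of_real (cos t) - \<i> * complex_of_real (sin t)" for t
    using cis_conv_exp[of t] cis_conv_exp[of "- t"] by (simp_all add: complex_eq_iff)
  \<comment> \<open>The bound \<open>pi / 2\<close> on the norm acts twice: on this interval the
    cosine is nonnegative, so that \<open>?C X\<close> is a positive root, and \<open>arcsin\<close>
    inverts the sine there.\<close>
  have C: "spec_in (?C X) 0 2" and Y: "fcalc (- (pi / 2)) (pi / 2) X (\<lambda>t. complex_of_real (2 * sin t)) (?Y X)"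
    and XS: "spec_in X (- (pi / 2)) (pi / 2)"
    if X: "adj X X" "norm X \<le> pi / 2" for X
  proof -
    show XS: "spec_in X (- (pi / 2)) (pi / 2)" using X by (rule spec_in_norm)
    have "fcalc (- (pi / 2)) (pi / 2) X (\<lambda>t. complex_of_real (2 * cos t)) (?C X)"
      by (rule fcalc_cong[OF fcalc_add[OF fcalc_exp_i[OF XS] fcalc_exp_minus_i[OF XS]]]) (simp add: e)
    then show "spec_in (?C X) 0 2"
      by (rule fcalc_spec_in[OF XS]) (auto intro: cos_ge_zero)
    show "fcalc (- (pi / 2)) (pi / 2) X (\<lambda>t. complex_of_real (2 * sin t)) (?Y X)"
      by (rule fcalc_cong[OF fcalc_mult[OF fcalc_const fcalc_diff[OF fcalc_exp_i[OF XS] fcalc_exp_minus_i[OF XS]]]])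
         (simp add: e algebra_simps)
  qed
  have CC: "?C X * ?C X = K" and UC: "exp_i X * ?C X = A"
    if X: "adj X X" "co_diagonal X S" "op_apply (exp_i X) ` S = T" for X
    using solution_facts[OF X] by (simp_all add: algebra_simps exp_i_inverse K_eq A_def)
  have CC1: "?C X1 * ?C X1 = K" using X1(1,3,4) by (rule CC)
  have CC2: "?C X2 * ?C X2 = K" using X2(1,3,4) by (rule CC)
  have C12: "?C X1 = ?C X2"
    by (rule positive_sqrt_unique[OF C[OF X1(1,2)] C[OF X2(1,2)]]) (simp only: CC1 CC2)
  have "exp_i X1 * ?C X1 = exp_i X2 * ?C X1"
    using UC[OF X1(1,3,4)] UC[OF X2(1,3,4)] by (simp only: C12)
  with sqrt_K_dense[OF spec_in_adj[OF C[OF X1(1,2)]] CC1] have U12: "exp_i X1 = exp_i X2"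
    by (rule op_eq_of_dense)
  with C12 have "exp_i (- X1) = exp_i (- X2)" by simp
  with U12 have Y12: "?Y X1 = ?Y X2" by simp
  have in2: "2 * sin t \<in> {- 2..2}" for t :: real by simp
  have "continuous_on {- 2..2} (\<lambda>t. complex_of_real (arcsin (t / 2)))"
    by (intro continuous_intros) auto
  with fcalc_spec_in[OF XS[OF X1(1,2)] Y[OF X1(1,2)] in2]
  obtain Z where Z: "fcalc (- 2) 2 (?Y X1) (\<lambda>t. complex_of_real (arcsin (t / 2))) Z"
    by (rule fcalc_exists)
  have "X = Z" if X: "adj X X" "norm X \<le> pi / 2"
    and ZX: "fcalc (- 2) 2 (?Y X) (\<lambda>t. complex_of_real (arcsin (t / 2))) Z" for X
    by (rule fcalc_unique[OF XS[OF X] fcalc_id fcalc_compose[OF XS[OF X] Y[OF X] in2 ZX]])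
       (simp add: arcsin_sin)
  from this[OF X1(1,2) Z] this[OF X2(1,2) Z[unfolded Y12]] show ?thesis by simp
qed

text \<open>The upper bound \<open>4\<close> is the square of \<open>norm A \<le> 2\<close>, as
  \<open>W\<close> is a contraction.\<close>

lemma spec_K: "spec_in K 0 4"
proof -
  have "norm W \<le> 1"
  proof -
    have "(norm W)\<^sup>2 \<le> 1\<^sup>2" using norm_adj_mult[OF adj_W] by (simp add: W'_W)
    then show ?thesis by (rule power2_le_imp_le) simp
  qed
  then have A2: "norm A \<le> 2"
    unfolding A_def using norm_triangle_ineq[of 1 W] by simp
  have "0 * (norm f)\<^sup>2 \<le> Re (cinner (op_apply K f) f) \<and> Re (cinner (op_apply K f) f) \<le> 4 * (norm f)\<^sup>2" for f
  proof -
    have "cinner (op_apply K f) f = complex_of_real ((norm (op_apply A f))\<^sup>2)"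
      using adjD[OF adj_sym[OF adj_A], of "op_apply A f" f] by (simp add: K_def cinner_norm)
    moreover have "(norm (op_apply A f))\<^sup>2 \<le> (2 * norm f)\<^sup>2"
      using norm_op_apply[of A f] mult_right_mono[OF A2, of "norm f"] by (intro power_mono) auto
    ultimately show ?thesis by (simp add: power_mult_distrib)
  qed
  moreover have "adj K K" unfolding K_def by (rule adj_mult[OF adj_sym[OF adj_A] adj_A])
  ultimately show ?thesis unfolding spec_in_def by blast
qed

text \<open>
  \<open>V C = A\<close> is the polar decomposition. For the operator \<open>X\<close> to be constructed, \<open>C = 2 cos X\<close>,
  \<open>V = e\<^sup>i\<^sup>X\<close> and \<open>Y = 2 sin X\<close>.
\<close>

lemma solution_exists:
  obtains X where "adj X X" "norm X \<le> pi / 2" "co_diagonal X S" "op_apply (exp_i X) ` S = T"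
proof -
  have "continuous_on {0..4} (\<lambda>t. complex_of_real (sqrt t))" by (intro continuous_intros)
  then obtain C where C: "fcalc 0 4 K (\<lambda>t. complex_of_real (sqrt t)) C"
    using fcalc_exists[OF spec_K] by blast
  have specC: "spec_in C 0 2"
  proof (rule fcalc_spec_in[OF spec_K C])
    fix t :: real assume "t \<in> {0..4}"
    then show "sqrt t \<in> {0..2}" using real_sqrt_le_mono[of t 4] by simp
  qed
  have CC: "C * C = K"
    by (rule fcalc_unique[OF spec_K fcalc_mult[OF C C] fcalc_id]) (simp flip: of_real_mult)
  have commC: "B * C = C * B" if "B * K = K * B" for B
    by (rule fcalc_intertwine[OF spec_K that C C])
  have EW: "E * W = W' * E" and EW': "E * W' = W * E"
    by (simp_all add: W_def W'_def mult.assoc E_E E_E_mult)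
  have EA: "E * A = A' * E" by (simp add: A_def A'_def algebra_simps EW)
  have WK: "W * K = K * W" by (simp add: K_eq algebra_simps mult_2 mult_2_right W_W' W'_W)
  have W'K: "W' * K = K * W'" by (simp add: K_eq algebra_simps mult_2 mult_2_right W_W' W'_W)
  have EC: "E * C = C * E" by (rule commC) (simp add: K_eq algebra_simps mult_2 mult_2_right EW EW')
  have WC: "W * C = C * W" by (rule commC[OF WK])
  have AC: "A * C = C * A" by (simp add: A_def algebra_simps WC)
  have A'C: "A' * C = C * A'" using commC[OF W'K] by (simp add: A'_def algebra_simps)
  note adjC = spec_in_adj[OF specC]
  note dense = sqrt_K_dense[OF adjC CC]
  note cancel = op_eq_of_dense[OF dense]
  \<comment> \<open>As \<open>K\<close> equals both \<open>A' * A\<close> and \<open>A * A'\<close>,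
    this serves \<open>A\<close> and \<open>A'\<close> alike. The factor \<open>V'\<close> obtained
    from \<open>A'\<close> is then shown to be the inverse and the adjoint of
    \<open>V\<close>.\<close>
  have norm_eq: "norm (op_apply B f) = norm (op_apply C f)" if B: "adj B B'" "B' * B = K" for B B' f
  proof -
    have "cinner (op_apply B f) (op_apply B f) = cinner f (op_apply K f)"
      by (simp add: adjD[OF B(1)] flip: B(2))
    also have "\<dots> = cinner (op_apply C f) (op_apply C f)"
      by (simp add: adjD[OF adjC] flip: CC)
    finally show ?thesis by (simp add: cinner_norm power2_eq_iff_nonneg flip: of_real_power)
  qed
  obtain V where V: "V * C = A"
    using isometric_factor[OF dense norm_eq[OF adj_A K_def[symmetric]]] .
  obtain V' where V': "V' * C = A'"
    using isometric_factor[OF dense norm_eq[OF adj_sym[OF adj_A] A_A']] .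
  have VA': "V * A' = C"
  proof (rule cancel)
    have "V * A' * C = (V * C) * A'" by (simp only: mult.assoc A'C)
    then show "V * A' * C = C * C" by (simp only: V A_A' CC)
  qed
  have V'A: "V' * A = C"
  proof (rule cancel)
    have "V' * A * C = (V' * C) * A" by (simp only: mult.assoc AC)
    then show "V' * A * C = C * C" by (simp only: V' CC K_def)
  qed
  have VV': "V * V' = 1" by (rule cancel) (simp add: mult.assoc V' VA')
  have V'V: "V' * V = 1" by (rule cancel) (simp add: mult.assoc V V'A)
  \<comment> \<open>Two factors \<open>C\<close> are cancelled, because \<open>A * A = W * K\<close>
    and \<open>K = C * C\<close>.\<close>
  have VV: "V * V = W"
  proof (rule cancel, rule cancel)
    have "V * V * C * C = V * (A * C)" by (simp only: mult.assoc V)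
    also have "\<dots> = (V * C) * A" by (simp only: AC mult.assoc)
    also have "\<dots> = W * C * C" by (simp only: V A_A mult.assoc CC)
    finally show "V * V * C * C = W * C * C" .
  qed
  have V'V': "V' * V' = W'"
  proof -
    have "V' * V' * (V * V) = V' * (V' * V) * V" by (simp only: mult.assoc)
    then have "V' * V' * W * W' = W'" by (simp add: VV V'V)
    then show ?thesis by (simp add: mult.assoc W_W')
  qed
  have VpV': "V + V' = C"
  proof (rule cancel)
    show "(V + V') * C = C * C" by (simp add: distrib_right V V' CC K_eq A_def A'_def)
  qed
  have EV: "E * V = V' * E"
  proof (rule cancel)
    have "E * V * C = E * A" by (simp only: mult.assoc V)
    also have "\<dots> = V' * (C * E)" unfolding EA by (simp only: V' flip: mult.assoc)
    also have "\<dots> = V' * E * C" by (simp only: mult.assoc EC)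
    finally show "E * V * C = V' * E * C" .
  qed
  from arg_cong[OF this, of "\<lambda>B. E * B * E"] have EV': "E * V' = V * E"
    by (simp add: mult.assoc E_E E_E_mult)
  have adjV: "adj V V'"
  proof (rule dense_adj[OF dense])
    fix f g
    have "cinner (op_apply V (op_apply C f)) (op_apply C g) = cinner f (op_apply (A' * C) g)"
      using adjD[OF adj_A, of f "op_apply C g"] by (simp flip: V)
    also have "\<dots> = cinner (op_apply C f) (op_apply A' g)"
      unfolding A'C by (simp add: adjD[OF adjC])
    finally show "cinner (op_apply V (op_apply C f)) (op_apply C g)
        = cinner (op_apply C f) (op_apply V' (op_apply C g))"
      by (simp flip: V')
  qed
  define Y where "Y = sc (- \<i>) * (V - V')"
  have adjY: "adj Y Y"
  proof -
    have "adj Y ((V' - V) * sc (cnj (- \<i>)))"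
      unfolding Y_def by (intro adj_mult adj_sc adj_diff adjV adj_sym[OF adjV])
    moreover have "(V' - V) * sc (cnj (- \<i>)) = Y"
      unfolding sc_commute by (simp add: Y_def sc_minus algebra_simps)
    ultimately show ?thesis by simp
  qed
  have norm1: "norm B \<le> 1" if "adj B B'" "B' * B = 1" for B B'
  proof -
    have "(norm B)\<^sup>2 \<le> 1\<^sup>2" using norm_adj_mult[OF that(1)] that(2) by simp
    then show ?thesis by (rule power2_le_imp_le) simp
  qed
  have "norm Y \<le> norm (sc (- \<i>)) * norm (V - V')" unfolding Y_def by (rule norm_mult_ineq)
  also have "\<dots> \<le> 2"
    using norm_triangle_ineq4[of V V'] norm1[OF adjV V'V] norm1[OF adj_sym[OF adjV] VV']
    by (simp add: norm_sc)
  finally have specY: "spec_in Y (- 2) 2" by (rule spec_in_norm[OF adjY])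
  have YY: "Y * Y = 1 + 1 + 1 + 1 - C * C"
  proof -
    have "Y * Y = sc (- \<i>) * ((V - V') * sc (- \<i>)) * (V - V')" by (simp only: Y_def mult.assoc)
    also have "\<dots> = sc (- \<i>) * sc (- \<i>) * ((V - V') * (V - V'))" by (simp only: sc_commute[of "V - V'"] mult.assoc)
    also have "sc (- \<i>) * sc (- \<i>) = - 1" by (simp add: sc_minus sc_II)
    finally have "Y * Y = 1 + 1 - W - W'" by (simp add: algebra_simps VV V'V' VV' V'V)
    moreover have "x + x + x + x - (x + x + a + b) = x + x - a - b" for x a b :: hardy_op
      by (simp add: algebra_simps)
    ultimately show ?thesis unfolding CC K_eq by metis
  qed
  have "continuous_on {- 2..2} (\<lambda>t. complex_of_real (arcsin (t / 2)))"
    by (intro continuous_intros) auto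
  then obtain X where X: "fcalc (- 2) 2 Y (\<lambda>t. complex_of_real (arcsin (t / 2))) X"
    using fcalc_exists[OF specY] by blast
  have arcsin_in: "arcsin (t / 2) \<in> {- (pi / 2)..pi / 2}" if "t \<in> {- 2..2}" for t :: real
    using that arcsin_bounded[of "t / 2"] by auto
  have specX: "spec_in X (- (pi / 2)) (pi / 2)"
    by (rule fcalc_spec_in[OF specY X arcsin_in])
  \<comment> \<open>\<open>R\<close> is \<open>2 cos X\<close> computed from \<open>Y\<close>, the
    root being positive because \<open>arcsin\<close> takes values where the cosine is nonnegative.
    By \<open>YY\<close> it has the same square as the positive \<open>C\<close>, so the two agree;
    this is what selects the right branch.\<close>
  have "continuous_on {- 2..2} (\<lambda>t. complex_of_real (sqrt (4 - t\<^sup>2)))" by (intro continuous_intros)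
  then obtain R where R: "fcalc (- 2) 2 Y (\<lambda>t. complex_of_real (sqrt (4 - t\<^sup>2))) R"
    using fcalc_exists[OF specY] by blast
  have sq4: "t\<^sup>2 \<le> 4" if "t \<in> {- 2..2}" for t :: real
    using that abs_le_square_iff[of t 2] by auto
  have specR: "spec_in R 0 2"
  proof (rule fcalc_spec_in[OF specY R])
    fix t :: real assume "t \<in> {- 2..2}"
    then show "sqrt (4 - t\<^sup>2) \<in> {0..2}"
      using sq4[of t] real_sqrt_le_mono[of "4 - t\<^sup>2" 4] by simp
  qed
  have "R * R = sc 4 - Y * Y"
    by (rule fcalc_unique[OF specY fcalc_mult[OF R R] fcalc_diff[OF fcalc_const fcalc_mult[OF fcalc_id fcalc_id]]])
       (use sq4 in \<open>simp add: power2_eq_square flip: of_real_mult\<close>)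
  moreover have "sc 4 = 1 + 1 + 1 + 1" using sc_of_real[of 4] by (simp add: scaleR_conv_of_real)
  ultimately have "R * R = 1 + 1 + 1 + 1 - (1 + 1 + 1 + 1 - C * C)" by (simp only: YY)
  then have "R * R = C * C" by simp
  then have RC: "R = C" by (rule positive_sqrt_unique[OF specR specC])
  have expX: "exp_i X = V"
  proof -
    have e: "fcalc (- 2) 2 Y (\<lambda>t. exp (\<i> * complex_of_real (arcsin (t / 2)))) (exp_i X)"
      by (rule fcalc_compose[OF specY X arcsin_in fcalc_exp_i[OF specX]])
    \<comment> \<open>Euler's formula: \<open>2 e^{iX}\<close> is \<open>R + i Y\<close>, and with
      \<open>R = C = V + V'\<close> and \<open>i Y = V - V'\<close> this becomes
      \<open>2 V\<close>.\<close>
    have "exp_i X + exp_i X = R + sc \<i> * Y"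
    proof (rule fcalc_unique[OF specY fcalc_add[OF e e] fcalc_add[OF R fcalc_mult[OF fcalc_const fcalc_id]]])
      fix t :: real assume t: "t \<in> {- 2..2}"
      have "2 * cos (arcsin (t / 2)) = sqrt 4 * sqrt (1 - (t / 2)\<^sup>2)"
        using t by (simp add: cos_arcsin)
      also have "\<dots> = sqrt (4 - t\<^sup>2)"
        by (simp only: real_sqrt_mult[symmetric]) (simp add: field_simps)
      finally have c: "2 * cos (arcsin (t / 2)) = sqrt (4 - t\<^sup>2)" .
      have s: "2 * sin (arcsin (t / 2)) = t" using t by simp
      have "exp (\<i> * complex_of_real u) = complex_of_real (cos u) + \<i> * complex_of_real (sin u)" for u
        using cis_conv_exp[of u] by (simp add: complex_eq_iff)
      then show "exp (\<i> * complex_of_real (arcsin (t / 2))) + exp (\<i> * complex_of_real (arcsin (t / 2)))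
          = complex_of_real (sqrt (4 - t\<^sup>2)) + \<i> * complex_of_real t"
        using c s by (simp add: complex_eq_iff)
    qed
    also have "sc \<i> * Y = V - V'"
      unfolding Y_def mult.assoc[symmetric] sc_mult[symmetric] by simp
    finally have "2 *\<^sub>R exp_i X = 2 *\<^sub>R V" by (simp add: scaleR_2 RC flip: VpV')
    then show ?thesis by simp
  qed
  have EY: "E * Y = (- Y) * E"
  proof -
    have "E * Y = sc (- \<i>) * (E * (V - V'))"
      by (simp only: Y_def mult.assoc[symmetric] sc_commute[of E])
    also have "E * (V - V') = - (V - V') * E" by (simp add: algebra_simps EV EV')
    also have "sc (- \<i>) * (- (V - V') * E) = (- Y) * E"
      by (simp only: Y_def mult_minus_left mult_minus_right mult.assoc)
    finally show ?thesis .
  qed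
  \<comment> \<open>\<open>E\<close> intertwines \<open>Y\<close> with \<open>- Y\<close>; since
    \<open>arcsin\<close> is odd, it intertwines \<open>X\<close> with \<open>- X\<close>.\<close>
  have mY: "fcalc (- 2) 2 Y (\<lambda>t. complex_of_real (- t)) (- Y)"
    using fcalc_diff[OF fcalc_const[of _ _ _ 0] fcalc_id[of "- 2" 2 Y]] by simp
  have neg_in: "- t \<in> {- 2..2}" if "t \<in> {- 2..2}" for t :: real using that by auto
  have specmY: "spec_in (- Y) (- 2) 2" by (rule fcalc_spec_in[OF specY mY neg_in])
  have "continuous_on {- 2..2} (\<lambda>t. complex_of_real (arcsin (t / 2)))"
    by (intro continuous_intros) auto
  then obtain Z where Z: "fcalc (- 2) 2 (- Y) (\<lambda>t. complex_of_real (arcsin (t / 2))) Z"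
    using fcalc_exists[OF specmY] by blast
  have mX: "fcalc (- 2) 2 Y (\<lambda>t. - complex_of_real (arcsin (t / 2))) (- X)"
    using fcalc_diff[OF fcalc_const[of _ _ _ 0] X] by simp
  have "Z = - X"
    by (rule fcalc_unique[OF specY fcalc_compose[OF specY mY neg_in Z] mX]) (auto simp: arcsin_minus)
  with fcalc_intertwine[OF specmY EY X Z] have EX: "E * X = - (X * E)" by simp
  show ?thesis
  proof
    show adjX: "adj X X" by (rule spec_in_adj[OF specX])
    show "norm X \<le> pi / 2" by (rule norm_spec_in[OF specX])
    show "co_diagonal X S" unfolding co_diagonal_iff[OF E] by (rule EX)
    have "F * V = W * E * V" by (simp add: W_def mult.assoc E_E_mult E_E)
    also have "\<dots> = V * (V * V') * E" by (simp add: mult.assoc EV flip: VV)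
    finally show "op_apply (exp_i X) ` S = T"
      unfolding exp_i_image_iff[OF E F adjX] unfolding expX by (simp add: VV')
  qed
qed

end

section \<open>From operators to curves of subspaces\<close>

lemma invertible_image_Gr:
  assumes S: "S \<in> Gr" and U: "U * U' = 1" "U' * U = 1"
  shows "op_apply U ` S \<in> Gr"
proof -
  have inv: "op_apply U (op_apply U' f) = f" "op_apply U' (op_apply U f) = f" for f
    using U by (metis op_apply_1 op_apply_mult)+
  \<comment> \<open>As a preimage under the continuous inverse, the image is closed.\<close>
  have im: "op_apply U ` S = op_apply U' -` S"
  proof (intro equalityI subsetI)
    show "f \<in> op_apply U' -` S" if "f \<in> op_apply U ` S" for f using that by (auto simp: inv)
    show "f \<in> op_apply U ` S" if "f \<in> op_apply U' -` S" for f
      using imageI[of "op_apply U' f" S "op_apply U"] that by (simp add: inv)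
  qed
  have "closed (op_apply U' -` S)"
    by (intro closed_vimage GrD(1)[OF S] linear_continuous_on bounded_linear_op_apply)
  then show ?thesis
    unfolding im using GrD(2-4)[OF S] by (simp add: Gr_def op_apply_add_right op_apply_scaleC_right)
qed

text \<open>A minimal geodesic supplies an \<open>X\<close> that is co-diagonal for
  \<open>S\<close>, and this already determines \<open>X\<close>, hence the curve. Co-diagonality
  for \<open>T\<close> is then automatic: \<open>F\<close> is the conjugate of \<open>E\<close> by
  \<open>exp_i X\<close>, which commutes with \<open>X\<close>.\<close>

theorem unique_minimal_geodesic:
  assumes S: "S \<in> Gr" and T: "T \<in> Gr"
    and ST: "\<And>f. f \<in> S \<Longrightarrow> f \<in> ortho T \<Longrightarrow> f = 0"
    and TS: "\<And>f. f \<in> T \<Longrightarrow> f \<in> ortho S \<Longrightarrow> f = 0"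
  shows "(\<exists>!\<delta>. minimal_geodesic \<delta> S T) \<and>
    (\<exists>!X. self_adjoint X \<and> norm X \<le> pi / 2 \<and> co_diagonal X S \<and> co_diagonal X T \<and>
       op_apply (exp_i X) ` S = T)"
proof -
  obtain E where E: "reflection S E" using reflection_exists[OF S] .
  obtain F where F: "reflection T F" using reflection_exists[OF T] .
  interpret generic_pair S T E F using E F ST TS by unfold_locales
  obtain X where X: "adj X X" "norm X \<le> pi / 2" "co_diagonal X S" "op_apply (exp_i X) ` S = T"
    by (rule solution_exists)
  have unique: "Y = X" if "self_adjoint Y" "norm Y \<le> pi / 2" "co_diagonal Y S" "op_apply (exp_i Y) ` S = T" for Y
    by (rule solution_unique[OF _ that(2-4) X]) (use that(1) in \<open>simp add: self_adjoint_adj\<close>)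
  have XT: "co_diagonal X T"
  proof -
    let ?U = "exp_i X" and ?U' = "exp_i (- X)"
    note sf = solution_facts[OF X(1,3,4)]
    have XU: "X * ?U = ?U * X"
      unfolding exp_i_def by (rule exp_intertwine) (simp add: scaleC_op_conv_sc[of _ X] sc_commute[of X] flip: mult.assoc)
    have XU': "?U' * X = X * ?U'"
    proof -
      have "?U' * X = ?U' * (X * ?U) * ?U'" by (simp add: mult.assoc exp_i_inverse)
      also have "\<dots> = (?U' * ?U) * X * ?U'" by (simp only: XU mult.assoc)
      finally show ?thesis by (simp add: exp_i_inverse)
    qed
    have F_eq: "F = ?U * E * ?U'" using sf(4) by (simp add: mult.assoc exp_i_inverse)
    have EX: "E * X = - (X * E)" using X(3) co_diagonal_iff[OF E] by simp
    have "F * X = ?U * (E * X) * ?U'" by (simp only: F_eq mult.assoc XU')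
    also have "\<dots> = - ((?U * X) * E * ?U')" by (simp add: EX mult.assoc)
    also have "\<dots> = - (X * F)" by (simp only: F_eq mult.assoc flip: XU)
    finally have "F * X = - (X * F)" .
    then show ?thesis unfolding co_diagonal_iff[OF F] by simp
  qed
  define \<delta> where "\<delta> = restrict (\<lambda>t. op_apply (exp_i (t *\<^sub>R X)) ` S) {0..1}"
  have "\<delta> \<in> {0..1} \<rightarrow>\<^sub>E Gr"
    unfolding \<delta>_def using invertible_image_Gr[OF S exp_i_inverse] by auto
  then have "geodesic_with X \<delta> S T"
    using X by (simp add: geodesic_with_def self_adjoint_adj \<delta>_def)
  then have 1: "minimal_geodesic \<delta> S T"
    using X(2) unfolding minimal_geodesic_def by blast
  have 2: "\<gamma> = \<delta>" if \<gamma>: "minimal_geodesic \<gamma> S T" for \<gamma>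
  proof -
    obtain Y where Y: "geodesic_with Y \<gamma> S T" "norm Y \<le> pi / 2"
      using \<gamma> unfolding minimal_geodesic_def by blast
    have "Y = X" using Y unfolding geodesic_with_def by (intro unique) auto
    with Y(1) have g: "\<gamma> \<in> {0..1} \<rightarrow>\<^sub>E Gr" "\<And>t. t \<in> {0..1} \<Longrightarrow> \<gamma> t = \<delta> t"
      by (auto simp: geodesic_with_def \<delta>_def)
    show ?thesis
      using g(1) \<open>\<delta> \<in> {0..1} \<rightarrow>\<^sub>E Gr\<close> g(2) by (rule PiE_ext)
  qed
  show ?thesis
  proof (intro conjI)
    show "\<exists>!\<delta>. minimal_geodesic \<delta> S T" using 1 2 by blast
    show "\<exists>!X. self_adjoint X \<and> norm X \<le> pi / 2 \<and> co_diagonal X S \<and> co_diagonal X T \<and>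
       op_apply (exp_i X) ` S = T"
    proof (rule ex1I)
      show "self_adjoint X \<and> norm X \<le> pi / 2 \<and> co_diagonal X S \<and> co_diagonal X T \<and>
          op_apply (exp_i X) ` S = T"
        using X XT by (simp add: self_adjoint_adj)
      show "Y = X" if "self_adjoint Y \<and> norm Y \<le> pi / 2 \<and> co_diagonal Y S \<and> co_diagonal Y T \<and>
          op_apply (exp_i Y) ` S = T" for Y
        using that by (intro unique) blast+
    qed
  qed
qed

section \<open>Blaschke products and boundary continuation\<close>

lemma hardy_eval_eqI:
  assumes "\<And>z. cmod z < 1 \<Longrightarrow> hardy_eval f z = hardy_eval g z"
  shows "f = g"
proof -
  have "hardy_eval f z = hardy_eval g z" for z
    using assms[of z] hardy_outside[of z] by (cases "cmod z < 1") auto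
  then show ?thesis by (metis hardy_eval_inject ext)
qed

text \<open>The Szego kernel, with Taylor coefficients \<open>cnj b ^ n\<close>.\<close>

lemma kernel_exists:
  assumes b: "cmod b < 1"
  obtains k where "\<And>f. cinner f k = hardy_eval f b"
    "\<And>z. cmod z < 1 \<Longrightarrow> hardy_eval k z = 1 / (1 - cnj b * z)"
proof -
  have "norm ((cmod b)\<^sup>2) < 1" using power_strict_mono[of "cmod b" 1 2] b by simp
  then have "summable (\<lambda>n. ((cmod b)\<^sup>2) ^ n)" by (intro summable_geometric)
  then have "summable (\<lambda>n. (cmod (cnj b ^ n))\<^sup>2)"
    by (simp add: norm_power mult.commute flip: power_mult)
  from coeff_hardy_exists[OF this] obtain k where k: "coeff_hardy k = (\<lambda>n. cnj b ^ n)" by blast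
  show ?thesis
  proof
    fix f
    have "(\<lambda>n. coeff_hardy f n * b ^ n) sums hardy_eval f b" using b by (intro hardy_sums) simp
    then show "cinner f k = hardy_eval f b" by (simp add: cinner_def k sums_unique[symmetric])
  next
    fix z assume z: "cmod z < 1"
    have "cmod b * cmod z \<le> cmod b" using z by (simp add: mult_left_le)
    then have "cmod (cnj b * z) < 1" using b by (simp add: norm_mult)
    from geometric_sums[OF this] have "(\<lambda>n. cnj b ^ n * z ^ n) sums (1 / (1 - cnj b * z))"
      by (simp add: power_mult_distrib)
    moreover have "(\<lambda>n. cnj b ^ n * z ^ n) sums hardy_eval k z"
      using hardy_sums[of z k] z by (simp add: k)
    ultimately show "hardy_eval k z = 1 / (1 - cnj b * z)" by (rule sums_unique2[symmetric])
  qed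
qed

lemma one_minus_cnj_nonzero: "cmod b < 1 \<Longrightarrow> cmod z \<le> 1 \<Longrightarrow> 1 - cnj b * z \<noteq> 0"
proof
  assume "cmod b < 1" "cmod z \<le> 1" "1 - cnj b * z = 0"
  then have "cmod b * cmod z = 1" by (metis norm_mult complex_mod_cnj eq_iff_diff_eq_0 norm_one)
  moreover have "cmod b * cmod z \<le> cmod b" using \<open>cmod z \<le> 1\<close> by (simp add: mult_left_le)
  ultimately show False using \<open>cmod b < 1\<close> by simp
qed

lemma eval_tendsto:
  assumes "x \<longlonglongrightarrow> f"
  shows "(\<lambda>n. hardy_eval (x n) b) \<longlonglongrightarrow> hardy_eval f b"
proof (cases "cmod b < 1")
  case True
  obtain k where k: "\<And>f. cinner f k = hardy_eval f b" using kernel_exists[OF True] by metis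
  show ?thesis unfolding k[symmetric] by (intro tendsto_cinner assms tendsto_const)
next
  case False
  then show ?thesis by (simp add: hardy_outside)
qed

lemma zero_space_Gr: "zero_space A \<in> Gr"
proof -
  have "closed (zero_space A)"
    unfolding closed_sequential_limits
  proof (intro allI impI, elim conjE)
    fix x l assume x: "\<forall>n. x n \<in> zero_space A" "x \<longlonglongrightarrow> l"
    have "hardy_eval l a = 0" if "a \<in> A" for a
    proof -
      have "(\<lambda>n. hardy_eval (x n) a) = (\<lambda>n. 0)" using x(1) that by (simp add: zero_space_def)
      then show ?thesis using eval_tendsto[OF x(2), of a] by (simp add: LIMSEQ_const_iff)
    qed
    then show "l \<in> zero_space A" by (simp add: zero_space_def)
  qed
  then show ?thesis by (simp add: Gr_def zero_space_def)
qed

section \<open>Forward and backward shift\<close>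

lemma shift_exists: "\<exists>g. norm g = norm f \<and> (\<forall>z. hardy_eval g z = z * hardy_eval f z)"
proof -
  let ?c = "\<lambda>n. case n of 0 \<Rightarrow> 0 | Suc m \<Rightarrow> coeff_hardy f m"
  have "summable (\<lambda>n. (cmod (?c n))\<^sup>2)"
    by (subst summable_Suc_iff[symmetric]) (simp add: hardy_summable)
  from coeff_hardy_exists[OF this] obtain g where g: "coeff_hardy g = ?c" by blast
  have "(norm g)\<^sup>2 = (norm f)\<^sup>2"
    unfolding norm_hardy2_square
    using suminf_split_head[OF hardy_summable[of g]] by (simp add: g)
  moreover have "hardy_eval g z = z * hardy_eval f z" for z
  proof (cases "z \<in> ball 0 1")
    case True
    have "(\<lambda>n. coeff_hardy g (Suc n) * z ^ Suc n) sums (z * hardy_eval f z)"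
      using sums_mult[OF hardy_sums[OF True, of f], of z] by (simp add: g mult_ac)
    then have "(\<lambda>n. coeff_hardy g n * z ^ n) sums (z * hardy_eval f z)"
      by (subst (asm) sums_Suc_iff) (simp add: g)
    with hardy_sums[OF True, of g] show ?thesis by (rule sums_unique2)
  qed (simp add: hardy_outside)
  ultimately show ?thesis by (intro exI[of _ g]) (simp add: power2_eq_iff_nonneg)
qed

lemma backward_shift_exists:
  "\<exists>g. norm g \<le> norm f \<and> (\<forall>n. coeff_hardy g n = coeff_hardy f (Suc n)) \<and>
    (\<forall>z. cmod z < 1 \<longrightarrow> z * hardy_eval g z = hardy_eval f z - coeff_hardy f 0)"
proof -
  have "summable (\<lambda>n. (cmod (coeff_hardy f (Suc n)))\<^sup>2)"
    using summable_Suc_iff[of "\<lambda>n. (cmod (coeff_hardy f n))\<^sup>2"] hardy_summable[of f] by simp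
  from coeff_hardy_exists[OF this] obtain g where g: "coeff_hardy g = (\<lambda>n. coeff_hardy f (Suc n))" by blast
  have "(norm g)\<^sup>2 \<le> (norm f)\<^sup>2"
    unfolding norm_hardy2_square
    using suminf_split_head[OF hardy_summable[of f]] by (simp add: g)
  moreover have "z * hardy_eval g z = hardy_eval f z - coeff_hardy f 0" if "cmod z < 1" for z
  proof -
    have z: "z \<in> ball 0 1" using that by simp
    have "(\<lambda>n. coeff_hardy f (Suc n) * z ^ Suc n) sums (z * hardy_eval g z)"
      using sums_mult[OF hardy_sums[OF z, of g], of z] by (simp add: g mult_ac)
    moreover have "(\<lambda>n. coeff_hardy f (Suc n) * z ^ Suc n) sums (hardy_eval f z - coeff_hardy f 0 * z ^ 0)"
      using hardy_sums[OF z, of f] by (subst sums_Suc_iff) simp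
    ultimately show ?thesis using sums_unique2 by fastforce
  qed
  ultimately show ?thesis by (intro exI[of _ g]) (auto simp: g intro: power2_le_imp_le)
qed

text \<open>Inverts \<open>1 - c L\<close> by Banach's fixed point theorem. For the forward shift
  this amounts to division by \<open>1 - cnj b * z\<close>, for the backward shift to division by
  \<open>z - b\<close>.\<close>

lemma affine_fixpoint:
  fixes L :: hardy_op
  assumes "norm L \<le> 1" "cmod c < 1"
  shows "\<exists>q. q = f + c *\<^sub>C op_apply L q"
proof -
  have "dist (f + c *\<^sub>C op_apply L x) (f + c *\<^sub>C op_apply L y) \<le> cmod c * dist x y" for x y
  proof -
    have "dist (f + c *\<^sub>C op_apply L x) (f + c *\<^sub>C op_apply L y) = cmod c * norm (op_apply L (x - y))"
      by (simp add: dist_norm op_apply_diff_right flip: norm_scaleC scaleC_diff_right)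
    also have "norm (op_apply L (x - y)) \<le> 1 * norm (x - y)"
      by (intro order_trans[OF norm_op_apply] mult_right_mono assms) simp
    finally show ?thesis by (simp add: dist_norm mult_left_mono)
  qed
  then have "\<exists>!q. f + c *\<^sub>C op_apply L q = q"
    by (intro banach_fix_type[of "cmod c"]) (use assms in auto)
  then show ?thesis by metis
qed

lemma shift_op_exists:
  obtains Z where "\<And>f. norm (op_apply Z f) = norm f" "\<And>f z. hardy_eval (op_apply Z f) z = z * hardy_eval f z"
    "norm Z \<le> 1"
proof -
  from shift_exists have "\<forall>f. \<exists>g. norm g = norm f \<and> (\<forall>z. hardy_eval g z = z * hardy_eval f z)" by blast
  from choice[OF this] obtain F where F: "\<And>f. norm (F f) = norm f" "\<And>f z. hardy_eval (F f) z = z * hardy_eval f z"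
    by blast
  obtain Z where Z: "\<And>f. op_apply Z f = F f"
  proof (rule op_exists)
    show "F (f + g) = F f + F g" for f g by (rule hardy_eval_eqI) (simp add: F algebra_simps)
    show "F (c *\<^sub>C f) = c *\<^sub>C F f" for c f by (rule hardy_eval_eqI) (simp add: F)
    show "norm (F f) \<le> 1 * norm f" for f by (simp add: F)
  qed blast
  show ?thesis
  proof
    show "norm Z \<le> 1" by (rule norm_op_bound) (simp_all add: Z F)
  qed (simp_all add: Z F)
qed

lemma backward_shift_op_exists:
  obtains L where "norm L \<le> 1"
    "\<And>f z. cmod z < 1 \<Longrightarrow> z * hardy_eval (op_apply L f) z = hardy_eval f z - coeff_hardy f 0"
proof -
  from backward_shift_exists have "\<forall>f. \<exists>g. norm g \<le> norm f \<and> (\<forall>n. coeff_hardy g n = coeff_hardy f (Suc n)) \<and>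
    (\<forall>z. cmod z < 1 \<longrightarrow> z * hardy_eval g z = hardy_eval f z - coeff_hardy f 0)" by blast
  from choice[OF this] obtain F where F: "\<And>f. norm (F f) \<le> norm f"
    and coeff: "\<And>f n. coeff_hardy (F f) n = coeff_hardy f (Suc n)" and eval:
    "\<And>f z. cmod z < 1 \<Longrightarrow> z * hardy_eval (F f) z = hardy_eval f z - coeff_hardy f 0" by blast
  obtain L where L: "\<And>f. op_apply L f = F f"
  proof (rule op_exists)
    show "F (f + g) = F f + F g" for f g by (rule hardy_eqI) (simp add: coeff)
    show "F (c *\<^sub>C f) = c *\<^sub>C F f" for c f by (rule hardy_eqI) (simp add: coeff)
    show "norm (F f) \<le> 1 * norm f" for f by (simp add: F)
  qed blast
  show ?thesis
  proof
    show "norm L \<le> 1" by (rule norm_op_bound) (simp_all add: L F)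
  qed (simp_all add: L eval)
qed

section \<open>Blaschke factors and the Takenaka-Malmquist expansion\<close>

definition blaschke_factor :: "complex \<Rightarrow> complex \<Rightarrow> complex" where
  "blaschke_factor b z = (z - b) / (1 - cnj b * z)"

text \<open>Writing \<open>f = q - cnj b Z q\<close> with the shift \<open>Z\<close>, the product
  with the factor is \<open>Z q - b q\<close>. Expanding squares shows that both have the same norm,
  because \<open>Z\<close> is isometric; no boundary values are involved.\<close>

lemma blaschke_mult_exists:
  assumes b: "cmod b < 1"
  obtains M where "\<And>f. norm (op_apply M f) = norm f"
    "\<And>f z. cmod z < 1 \<Longrightarrow> hardy_eval (op_apply M f) z = blaschke_factor b z * hardy_eval f z"
proof -
  obtain Z where Z: "\<And>f. norm (op_apply Z f) = norm f" "norm Z \<le> 1"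
    "\<And>f z. hardy_eval (op_apply Z f) z = z * hardy_eval f z"
    using shift_op_exists by metis
  have "\<exists>h. norm h = norm f \<and> (\<forall>z. cmod z < 1 \<longrightarrow> hardy_eval h z = blaschke_factor b z * hardy_eval f z)" for f
  proof -
    obtain q where q: "q = f + cnj b *\<^sub>C op_apply Z q"
      using affine_fixpoint[OF Z(2), of "cnj b"] b by auto
    then have f: "f = q - cnj b *\<^sub>C op_apply Z q" by (simp add: algebra_simps)
    define h where "h = op_apply Z q - b *\<^sub>C q"
    have "cinner q (cnj b *\<^sub>C op_apply Z q) = cnj (cinner (op_apply Z q) (b *\<^sub>C q))"
      using cinner_commute[of q "op_apply Z q"] by (simp add: cinner_scaleC_right)
    then have "(norm h)\<^sup>2 = (norm f)\<^sup>2"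
      unfolding f h_def norm_diff_square by (simp add: norm_scaleC Z(1))
    moreover have "hardy_eval h z = blaschke_factor b z * hardy_eval f z" if z: "cmod z < 1" for z
      using one_minus_cnj_nonzero[OF b, of z] z unfolding f h_def
      by (simp add: Z(3) blaschke_factor_def field_simps)
    ultimately show ?thesis by (intro exI[of _ h]) (simp add: power2_eq_iff_nonneg)
  qed
  then have "\<forall>f. \<exists>h. norm h = norm f \<and>
    (\<forall>z. cmod z < 1 \<longrightarrow> hardy_eval h z = blaschke_factor b z * hardy_eval f z)" by blast
  from choice[OF this] obtain F where F: "\<And>f. norm (F f) = norm f"
    "\<And>f z. cmod z < 1 \<Longrightarrow> hardy_eval (F f) z = blaschke_factor b z * hardy_eval f z" by blast
  obtain M where M: "\<And>f. op_apply M f = F f"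
  proof (rule op_exists)
    show "F (f + g) = F f + F g" for f g by (rule hardy_eval_eqI) (simp add: F algebra_simps)
    show "F (c *\<^sub>C f) = c *\<^sub>C F f" for c f by (rule hardy_eval_eqI) (simp add: F)
    show "norm (F f) \<le> 1 * norm f" for f by (simp add: F)
  qed blast
  show ?thesis by (rule that[of M]) (simp_all add: M F)
qed

lemma blaschke_divide:
  assumes b: "cmod b < 1" and g: "hardy_eval g b = 0"
  obtains h where "\<And>z. cmod z < 1 \<Longrightarrow> hardy_eval g z = blaschke_factor b z * hardy_eval h z"
proof -
  obtain Z where Z: "\<And>f z. hardy_eval (op_apply Z f) z = z * hardy_eval f z"
    using shift_op_exists by metis
  obtain L where L: "norm L \<le> 1"
    "\<And>f z. cmod z < 1 \<Longrightarrow> z * hardy_eval (op_apply L f) z = hardy_eval f z - coeff_hardy f 0"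
    using backward_shift_op_exists by metis
  \<comment> \<open>\<open>q\<close> is to be \<open>g / (z - b)\<close>. The equation makes
    \<open>(z - b) q\<close> equal to \<open>g\<close> minus a constant, and evaluation at
    \<open>b\<close> shows that the constant is \<open>g b = 0\<close>.\<close>
  obtain q where q: "q = op_apply L g + b *\<^sub>C op_apply L q"
    using affine_fixpoint[OF L(1) b] by blast
  have 1: "(z - b) * hardy_eval q z = hardy_eval g z - coeff_hardy g 0 - b * coeff_hardy q 0" if z: "cmod z < 1" for z
  proof -
    have "z * hardy_eval q z = z * hardy_eval (op_apply L g) z + b * (z * hardy_eval (op_apply L q) z)"
      using arg_cong[OF q, of "\<lambda>f. z * hardy_eval f z"] by (simp add: algebra_simps)
    then show ?thesis unfolding L(2)[OF z] by (simp add: algebra_simps)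
  qed
  have "(z - b) * hardy_eval q z = hardy_eval g z" if "cmod z < 1" for z
    using 1[OF that] 1[OF b] g by simp
  then have "hardy_eval g z = blaschke_factor b z * hardy_eval (q - cnj b *\<^sub>C op_apply Z q) z" if "cmod z < 1" for z
    using that one_minus_cnj_nonzero[OF b, of z] by (simp add: Z blaschke_factor_def field_simps)
  then show ?thesis by (rule that)
qed

lemma isometry_cinner:
  assumes M: "\<And>f. norm (op_apply M f) = norm f"
  shows "cinner (op_apply M f) (op_apply M g) = cinner f g"
proof -
  have re: "Re (cinner (op_apply M f) (op_apply M g)) = Re (cinner f g)" for f g
    using norm_diff_square[of "op_apply M f" "op_apply M g"] norm_diff_square[of f g]
    by (simp add: M flip: op_apply_diff_right)
  have "Im (cinner (op_apply M f) (op_apply M g)) = Im (cinner f g)"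
    using re[of "\<i> *\<^sub>C f" g] by (simp add: op_apply_scaleC_right cinner_scaleC_left)
  with re show ?thesis by (simp add: complex_eq_iff)
qed

text \<open>The kernel \<open>k\<close> spans the complement of the functions vanishing at
  \<open>b\<close>, and by \<open>blaschke_divide\<close> these functions form the range of
  \<open>M\<close>. The square root normalises \<open>k\<close>, whose squared norm is
  \<open>1 / (1 - cmod b ^ 2)\<close>.\<close>

lemma blaschke_step:
  assumes b: "cmod b < 1"
    and k: "\<And>f. cinner f k = hardy_eval f b" "\<And>z. cmod z < 1 \<Longrightarrow> hardy_eval k z = 1 / (1 - cnj b * z)"
    and M: "\<And>f. norm (op_apply M f) = norm f"
      "\<And>f z. cmod z < 1 \<Longrightarrow> hardy_eval (op_apply M f) z = blaschke_factor b z * hardy_eval f z"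
  shows "\<exists>h c. g = ((c::complex) * sqrt (1 - (cmod b)\<^sup>2)) *\<^sub>C k + op_apply M h \<and> (norm g)\<^sup>2 = (cmod c)\<^sup>2 + (norm h)\<^sup>2"
proof -
  define s where "s = sqrt (1 - (cmod b)\<^sup>2)"
  have "(cmod b)\<^sup>2 < 1" using power_strict_mono[of "cmod b" 1 2] b by simp
  then have s: "s > 0" "s * s = 1 - (cmod b)\<^sup>2" by (simp_all add: s_def)
  have kb: "hardy_eval k b = 1 / complex_of_real (s * s)"
    using k(2)[OF b] by (simp add: s(2) mult.commute[of "cnj b"] flip: complex_norm_square)
  \<comment> \<open>The inner product of \<open>g\<close> with the unit vector
    \<open>s k\<close>.\<close>
  define c where "c = s * hardy_eval g b"
  define r where "r = g - (c * s) *\<^sub>C k"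
  have "hardy_eval r b = 0" using s(1) by (simp add: r_def kb c_def)
  then obtain h where h: "\<And>z. cmod z < 1 \<Longrightarrow> hardy_eval r z = blaschke_factor b z * hardy_eval h z"
    using blaschke_divide[OF b] by metis
  then have rM: "r = op_apply M h" by (intro hardy_eval_eqI) (simp add: M(2))
  have g: "g = op_apply M h - (- (c * s)) *\<^sub>C k"
    using rM unfolding r_def by (intro hardy_eqI) (auto simp: algebra_simps dest: arg_cong[of _ _ "\<lambda>f. coeff_hardy f _"])
  have "s\<^sup>2 * (norm k)\<^sup>2 = 1"
  proof -
    have "complex_of_real ((norm k)\<^sup>2) = complex_of_real (1 / (s * s))"
      unfolding cinner_norm[symmetric] k(1) kb by simp
    then show ?thesis using s(1) by (simp only: of_real_eq_iff) (simp add: power2_eq_square)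
  qed
  moreover have "cinner (op_apply M h) k = 0" using b by (simp add: k(1) M(2) blaschke_factor_def)
  ultimately have "(norm g)\<^sup>2 = (cmod c)\<^sup>2 + (norm h)\<^sup>2"
    unfolding g norm_diff_square
    by (simp add: cinner_scaleC_right M(1) norm_scaleC norm_mult power_mult_distrib mult.assoc)
  moreover have "g = (c * s) *\<^sub>C k + op_apply M h"
    unfolding rM[symmetric] r_def by simp
  ultimately show ?thesis unfolding s_def by blast
qed

text \<open>
  Splitting off one kernel component and one Blaschke factor at a time gives \<open>f\<close> as a partial sum of
  its Takenaka-Malmquist expansion plus a remainder \<open>h n\<close> vanishing at \<open>b 0, \<dots>, b (n - 1)\<close>. The
  remainders converge to the projection of \<open>f\<close> to the zero space, hence to \<open>0\<close>.
\<close>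

lemma ortho_zero_space_series:
  fixes b :: "nat \<Rightarrow> complex"
  assumes b: "\<And>n. cmod (b n) < 1" and f: "f \<in> ortho (zero_space (range b))"
  obtains c :: "nat \<Rightarrow> complex" where "summable (\<lambda>n. (cmod (c n))\<^sup>2)"
    "\<And>z. cmod z < 1 \<Longrightarrow>
      (\<lambda>n. c n * (sqrt (1 - (cmod (b n))\<^sup>2) / (1 - cnj (b n) * z) * (\<Prod>i<n. blaschke_factor (b i) z)))
        sums hardy_eval f z"
proof -
  define s where "s n = sqrt (1 - (cmod (b n))\<^sup>2)" for n
  have "\<forall>n. \<exists>k. (\<forall>f. cinner f k = hardy_eval f (b n)) \<and>
      (\<forall>z. cmod z < 1 \<longrightarrow> hardy_eval k z = 1 / (1 - cnj (b n) * z))"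
    using kernel_exists[OF b] by metis
  from choice[OF this] obtain k where k: "\<And>n f. cinner f (k n) = hardy_eval f (b n)"
    "\<And>n z. cmod z < 1 \<Longrightarrow> hardy_eval (k n) z = 1 / (1 - cnj (b n) * z)" by blast
  have "\<forall>n. \<exists>M. (\<forall>f. norm (op_apply M f) = norm f) \<and>
      (\<forall>f z. cmod z < 1 \<longrightarrow> hardy_eval (op_apply M f) z = blaschke_factor (b n) z * hardy_eval f z)"
    using blaschke_mult_exists[OF b] by metis
  from choice[OF this] obtain M where M: "\<And>n f. norm (op_apply (M n) f) = norm f"
    "\<And>n f z. cmod z < 1 \<Longrightarrow> hardy_eval (op_apply (M n) f) z = blaschke_factor (b n) z * hardy_eval f z" by blast
  have "\<forall>n g. \<exists>h. \<exists>c::complex. g = (c * s n) *\<^sub>C k n + op_apply (M n) h \<and> (norm g)\<^sup>2 = (cmod c)\<^sup>2 + (norm h)\<^sup>2"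
    unfolding s_def using blaschke_step[OF b k M] by blast
  then obtain H where "\<forall>n g. \<exists>c::complex. g = (c * s n) *\<^sub>C k n + op_apply (M n) (H n g) \<and>
      (norm g)\<^sup>2 = (cmod c)\<^sup>2 + (norm (H n g))\<^sup>2" by metis
  then obtain C :: "nat \<Rightarrow> hardy2 \<Rightarrow> complex" where step: "\<And>n g. g = (C n g * s n) *\<^sub>C k n + op_apply (M n) (H n g)"
      "\<And>n g. (norm g)\<^sup>2 = (cmod (C n g))\<^sup>2 + (norm (H n g))\<^sup>2" by metis
  \<comment> \<open>\<open>g n\<close> is what is left of \<open>f\<close> after \<open>n\<close>
    kernel components have been removed and \<open>n\<close> factors divided out. \<open>V n\<close>
    multiplies by these factors again, so that \<open>h n\<close> is the remainder of the
    expansion.\<close>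
  define g where "g = rec_nat f H"
  define V where "V = rec_nat 1 (\<lambda>n V. V * M n)"
  define c where "c n = C n (g n)" for n
  define h where "h n = op_apply (V n) (g n)" for n
  have g: "g 0 = f" "g (Suc n) = H n (g n)" for n by (simp_all add: g_def)
  have V: "V 0 = 1" "V (Suc n) = V n * M n" for n by (simp_all add: V_def)
  have V_norm: "norm (op_apply (V n) u) = norm u" for n u
    by (induction n arbitrary: u) (simp_all add: V M)
  have V_eval: "hardy_eval (op_apply (V n) u) z = (\<Prod>i<n. blaschke_factor (b i) z) * hardy_eval u z"
    if "cmod z < 1" for n u z
    using that by (induction n arbitrary: u) (simp_all add: V M mult_ac)
  have V_range: "\<exists>u. op_apply (V (m + d)) v = op_apply (V m) u" for m d v
  proof (induction d arbitrary: v)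
    case (Suc d)
    show ?case using Suc[of "op_apply (M (m + d)) v"] by (simp add: V)
  qed auto
  have h_step: "h n = op_apply (V n) ((c n * s n) *\<^sub>C k n) + h (Suc n)" for n
    unfolding h_def c_def using arg_cong[OF step(1)[of "g n" n], of "op_apply (V n)"]
    by (simp add: V g op_apply_add_right)
  have partial: "hardy_eval f z = (\<Sum>j<n. c j * (s j / (1 - cnj (b j) * z) * (\<Prod>i<j. blaschke_factor (b i) z)))
      + hardy_eval (h n) z" if z: "cmod z < 1" for n z
  proof (induction n)
    case 0
    then show ?case by (simp add: h_def V g)
  next
    case (Suc n)
    then show ?case using arg_cong[OF h_step[of n], of "\<lambda>u. hardy_eval u z"]
      by (simp add: V_eval[OF z] k(2)[OF z])
  qed
  \<comment> \<open>The term removed at stage \<open>n\<close> is a multiple of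
    \<open>V n (k n)\<close>. It is orthogonal to \<open>V n (M n u)\<close> because
    \<open>V n\<close> is isometric and \<open>M n u\<close> vanishes at \<open>b n\<close>.\<close>
  have orth: "cinner (f - h n) (op_apply (V n) u) = 0" for n u
  proof (induction n arbitrary: u)
    case 0
    then show ?case by (simp add: h_def V g)
  next
    case (Suc n)
    have eq: "f - h (Suc n) = (f - h n) + op_apply (V n) ((c n * s n) *\<^sub>C k n)"
      unfolding h_step[of n] by simp
    have "cinner (op_apply (V n) ((c n * s n) *\<^sub>C k n)) (op_apply (V n) (op_apply (M n) u)) = 0"
      unfolding isometry_cinner[OF V_norm] using k(1)[of "op_apply (M n) u" n] M(2)[OF b[of n], of n u]
        cinner_commute[of "k n" "op_apply (M n) u"]
      by (simp add: cinner_scaleC_left blaschke_factor_def)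
    then show ?case
      using Suc[of "op_apply (M n) u"] unfolding eq V op_apply_mult cinner_add_left by simp
  qed
  have h_norm: "norm (h n) = norm (g n)" for n by (simp add: h_def V_norm)
  have bessel: "(norm f)\<^sup>2 = (\<Sum>j<n. (cmod (c j))\<^sup>2) + (norm (h n))\<^sup>2" for n
    unfolding h_norm
  proof (induction n)
    case (Suc n)
    then show ?case using step(2)[of "g n" n] by (simp add: g c_def)
  qed (simp add: g)
  have cs: "summable (\<lambda>n. (cmod (c n))\<^sup>2)"
  proof (rule summableI_nonneg_bounded)
    show "(\<Sum>j<n. (cmod (c j))\<^sup>2) \<le> (norm f)\<^sup>2" for n using bessel[of n] by simp
  qed simp
  \<comment> \<open>For \<open>m \<le> n\<close> the remainder \<open>h n\<close> lies in the ranges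
    of both \<open>V m\<close> and \<open>V n\<close>, so \<open>f - h m\<close> and
    \<open>f - h n\<close> are orthogonal to it.\<close>
  have pyth: "(norm (h m - h n))\<^sup>2 = (norm (h m))\<^sup>2 - (norm (h n))\<^sup>2" if mn: "m \<le> n" for m n
  proof -
    obtain u where u: "h n = op_apply (V m) u"
      using V_range[of m "n - m" "g n"] mn by (auto simp: h_def)
    have "cinner (f - h m) (h n) = 0" unfolding u by (rule orth)
    moreover have "cinner (f - h n) (h n) = 0" unfolding h_def[of n] by (rule orth[unfolded h_def])
    ultimately have "cinner (h m) (h n) = cinner (h n) (h n)" by (simp add: cinner_diff_left)
    then show ?thesis unfolding norm_diff_square by (simp add: cinner_norm flip: of_real_power)
  qed
  have "convergent (\<lambda>n. (norm (h n))\<^sup>2)"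
  proof -
    have "(norm (h n))\<^sup>2 = (norm f)\<^sup>2 - (\<Sum>j<n. (cmod (c j))\<^sup>2)" for n using bessel[of n] by simp
    moreover have "(\<lambda>n. (norm f)\<^sup>2 - (\<Sum>j<n. (cmod (c j))\<^sup>2)) \<longlonglongrightarrow> (norm f)\<^sup>2 - (\<Sum>j. (cmod (c j))\<^sup>2)"
      by (intro tendsto_intros summable_LIMSEQ cs)
    ultimately show ?thesis unfolding convergent_def by auto
  qed
  then have Cau: "Cauchy (\<lambda>n. (norm (h n))\<^sup>2)" by (rule convergent_Cauchy)
  have "Cauchy h"
  proof (rule CauchyI)
    fix e :: real assume e: "0 < e"
    then have "0 < e\<^sup>2" by simp
    from CauchyD[OF Cau this] obtain N
      where N: "\<And>m n. m \<ge> N \<Longrightarrow> n \<ge> N \<Longrightarrow> norm ((norm (h m))\<^sup>2 - (norm (h n))\<^sup>2) < e\<^sup>2" by blast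
    have le: "norm (h m - h n) < e" if "m \<ge> N" "n \<ge> N" "m \<le> n" for m n
    proof -
      have "(norm (h m - h n))\<^sup>2 < e\<^sup>2" using N[OF that(1,2)] pyth[OF that(3)] by simp
      then show ?thesis using e by (auto intro: power2_less_imp_less)
    qed
    have "norm (h m - h n) < e" if "m \<ge> N" "n \<ge> N" for m n
      using le[of m n] le[of n m] that by (cases "m \<le> n") (simp_all add: norm_minus_commute)
    then show "\<exists>N. \<forall>m\<ge>N. \<forall>n\<ge>N. norm (h m - h n) < e" by blast
  qed
  then obtain l where l: "h \<longlonglongrightarrow> l" by (auto simp: Cauchy_convergent_iff convergent_def)
  have "hardy_eval l (b i) = 0" for i
  proof -
    have "hardy_eval (h n) (b i) = 0" if "n > i" for n
      using that by (auto simp: h_def V_eval[OF b] blaschke_factor_def)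
    then have "(\<lambda>n. hardy_eval (h n) (b i)) \<longlonglongrightarrow> 0"
      by (intro tendsto_eventually eventually_sequentiallyI[of "Suc i"]) simp
    with eval_tendsto[OF l] show ?thesis by (rule LIMSEQ_unique)
  qed
  then have "l \<in> zero_space (range b)" by (auto simp: zero_space_def)
  with f have fl: "cinner f l = 0" by (auto dest: orthoD)
  \<comment> \<open>In the limit this identity reads \<open>cinner f l = cinner l l\<close>, and the
    left side is zero because \<open>l\<close> lies in the zero space.\<close>
  have "cinner f (h n) = cinner (h n) (h n)" for n
    using orth[of n "g n"] by (simp add: cinner_diff_left flip: h_def)
  moreover have "(\<lambda>n. cinner f (h n)) \<longlonglongrightarrow> 0"
    using tendsto_cinner[OF tendsto_const l, of f] by (simp add: fl)
  moreover have "(\<lambda>n. cinner (h n) (h n)) \<longlonglongrightarrow> cinner l l" by (intro tendsto_cinner l)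
  ultimately have "cinner l l = 0" using LIMSEQ_unique by fastforce
  then have l0: "l = 0" by (simp add: cinner_norm)
  show ?thesis
  proof (rule that[OF cs])
    fix z assume z: "cmod z < 1"
    have "(\<lambda>n. hardy_eval f z - hardy_eval (h n) z) \<longlonglongrightarrow> hardy_eval f z - hardy_eval l z"
      by (intro tendsto_intros eval_tendsto l)
    moreover have "hardy_eval f z - hardy_eval (h n) z =
        (\<Sum>j<n. c j * (s j / (1 - cnj (b j) * z) * (\<Prod>i<j. blaschke_factor (b i) z)))" for n
      using partial[OF z, of n] by (simp only: add_diff_cancel_right')
    ultimately show "(\<lambda>n. c n * (sqrt (1 - (cmod (b n))\<^sup>2) / (1 - cnj (b n) * z) * (\<Prod>i<n. blaschke_factor (b i) z)))
        sums hardy_eval f z"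
      unfolding sums_def s_def[symmetric] by (simp only: l0 hardy_eval_0 diff_zero)
  qed
qed

section \<open>Continuation across the boundary\<close>

lemma blaschke_factor_bound:
  assumes b: "cmod b < 1" and r: "0 < r" "r \<le> cmod (1 - cnj b * w)" and w: "cmod w \<le> 2"
  shows "(cmod (blaschke_factor b w))\<^sup>2 \<le> exp (6 / r\<^sup>2 * (1 - cmod b))"
proof -
  \<comment> \<open>Outside the disk the factor may exceed \<open>1\<close> in modulus, but by this
    identity only by an amount controlled by \<open>1 - cmod b\<close>. The constant
    \<open>6\<close> is \<open>2 * 3\<close>: \<open>1 - cmod b ^ 2 \<le> 2 * (1 - cmod b)\<close>
    and \<open>cmod w ^ 2 - 1 \<le> 3\<close>. The exponential form lets the Blaschke sum bound all
    finite products at once.\<close>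
  have "(cmod (w - b))\<^sup>2 = (cmod (1 - cnj b * w))\<^sup>2 + (1 - (cmod b)\<^sup>2) * ((cmod w)\<^sup>2 - 1)"
    unfolding cmod_power2 by (simp add: power2_eq_square algebra_simps)
  moreover have "(1 - (cmod b)\<^sup>2) * ((cmod w)\<^sup>2 - 1) \<le> (2 * (1 - cmod b)) * 3"
  proof -
    have "(1 - (cmod b)\<^sup>2) = (1 + cmod b) * (1 - cmod b)" by (simp add: power2_eq_square algebra_simps)
    also have "\<dots> \<le> 2 * (1 - cmod b)" using b by (intro mult_right_mono) auto
    finally have "1 - (cmod b)\<^sup>2 \<le> 2 * (1 - cmod b)" .
    moreover have "(cmod w)\<^sup>2 - 1 \<le> 3" using power_mono[OF w, of 2] by simp
    moreover have "0 \<le> 1 - (cmod b)\<^sup>2" using power_mono[of "cmod b" 1 2] b by simp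
    ultimately have "(1 - (cmod b)\<^sup>2) * ((cmod w)\<^sup>2 - 1) \<le> (1 - (cmod b)\<^sup>2) * 3"
      and "(1 - (cmod b)\<^sup>2) * 3 \<le> (2 * (1 - cmod b)) * 3"
      by (intro mult_left_mono, simp_all)
    then show ?thesis by (rule order_trans)
  qed
  ultimately have "(cmod (w - b))\<^sup>2 \<le> (cmod (1 - cnj b * w))\<^sup>2 + 6 * (1 - cmod b)" by simp
  moreover have pos: "0 < (cmod (1 - cnj b * w))\<^sup>2" using r by (intro zero_less_power) linarith
  ultimately have "(cmod (blaschke_factor b w))\<^sup>2 \<le> 1 + 6 * (1 - cmod b) / (cmod (1 - cnj b * w))\<^sup>2"
    by (simp add: blaschke_factor_def norm_divide power_divide field_simps)
  also have "\<dots> \<le> 1 + 6 * (1 - cmod b) / r\<^sup>2"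
    using r b pos by (intro add_left_mono divide_left_mono power_mono) auto
  also have "\<dots> \<le> exp (6 / r\<^sup>2 * (1 - cmod b))"
    using exp_ge_add_one_self[of "6 / r\<^sup>2 * (1 - cmod b)"] by simp
  finally show ?thesis .
qed

lemma ortho_zero_space_extension:
  fixes b :: "nat \<Rightarrow> complex"
  assumes b: "\<And>n. cmod (b n) < 1" and sum: "summable (\<lambda>n. 1 - cmod (b n))"
    and f: "f \<in> ortho (zero_space (range b))"
    and \<zeta>: "cmod \<zeta> = 1" and r: "0 < r" "r \<le> 1" "\<And>n. 2 * r \<le> dist \<zeta> (b n)"
  shows "\<exists>F. F holomorphic_on ball \<zeta> r \<and>
    (\<forall>w\<in>ball \<zeta> r. cmod w < 1 \<longrightarrow> F w = hardy_eval f w)"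
proof -
  obtain c :: "nat \<Rightarrow> complex" where c: "summable (\<lambda>n. (cmod (c n))\<^sup>2)"
    and sums: "\<And>z. cmod z < 1 \<Longrightarrow>
      (\<lambda>n. c n * (sqrt (1 - (cmod (b n))\<^sup>2) / (1 - cnj (b n) * z) * (\<Prod>i<n. blaschke_factor (b i) z)))
        sums hardy_eval f z"
    using ortho_zero_space_series[OF b f] by blast
  define u where "u n z = c n * (sqrt (1 - (cmod (b n))\<^sup>2) / (1 - cnj (b n) * z) * (\<Prod>i<n. blaschke_factor (b i) z))" for n z
  define K where "K = 6 / r\<^sup>2"
  define Q where "Q = exp (K * (\<Sum>n. 1 - cmod (b n)))"
  have K: "0 \<le> K" by (simp add: K_def)
  \<comment> \<open>On the circle \<open>cmod (1 - cnj (b n) * \<zeta>)\<close> is the distance from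
    \<open>\<zeta>\<close> to \<open>b n\<close>, at least \<open>2 * r\<close>. Moving from
    \<open>\<zeta>\<close> to \<open>w\<close> costs at most \<open>r\<close>.\<close>
  have below: "r \<le> cmod (1 - cnj (b n) * w)" if w: "w \<in> ball \<zeta> r" for n w
  proof -
    have "cmod (1 - cnj (b n) * \<zeta>) = cmod (cnj \<zeta> - cnj (b n)) * cmod \<zeta>"
      unfolding norm_mult[symmetric] using complex_norm_square[of \<zeta>] \<zeta> by (simp add: algebra_simps)
    also have "\<dots> = dist \<zeta> (b n)" using \<zeta> by (simp add: dist_norm flip: complex_cnj_diff)
    finally have "2 * r \<le> cmod (1 - cnj (b n) * \<zeta>)" using r(3)[of n] by simp
    moreover have "cmod (cnj (b n) * (w - \<zeta>)) \<le> r"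
      using w b[of n] mult_mono[of "cmod (b n)" 1 "cmod (w - \<zeta>)" r]
      by (simp add: norm_mult dist_norm norm_minus_commute)
    moreover have "cmod (1 - cnj (b n) * \<zeta>) = cmod ((1 - cnj (b n) * w) + cnj (b n) * (w - \<zeta>))"
      by (rule arg_cong) (simp add: algebra_simps)
    ultimately show ?thesis
      using norm_triangle_ineq[of "1 - cnj (b n) * w" "cnj (b n) * (w - \<zeta>)"] by linarith
  qed
  have nonzero: "1 - cnj (b n) * w \<noteq> 0" if w: "w \<in> ball \<zeta> r" for n w
    using below[OF w, of n] r(1) by auto
  have w2: "cmod w \<le> 2" if w: "w \<in> ball \<zeta> r" for w
    using w r(2) \<zeta> norm_triangle_ineq2[of w \<zeta>] by (simp add: dist_norm norm_minus_commute)
  have prod: "(cmod (\<Prod>i<n. blaschke_factor (b i) w))\<^sup>2 \<le> Q" if w: "w \<in> ball \<zeta> r" for n w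
  proof -
    have "(cmod (\<Prod>i<n. blaschke_factor (b i) w))\<^sup>2 = (\<Prod>i<n. (cmod (blaschke_factor (b i) w))\<^sup>2)"
      by (simp add: prod_norm[symmetric] prod_power_distrib)
    also have "\<dots> \<le> (\<Prod>i<n. exp (K * (1 - cmod (b i))))"
      unfolding K_def using blaschke_factor_bound[OF b r(1) below[OF w] w2[OF w]]
      by (intro prod_mono) auto
    also have "\<dots> = exp (K * (\<Sum>i<n. 1 - cmod (b i)))"
      by (simp add: exp_sum sum_distrib_left)
    also have "\<dots> \<le> Q"
      unfolding Q_def exp_le_cancel_iff using b
      by (intro mult_left_mono[OF _ K] sum_le_suminf[OF sum]) (auto simp: less_imp_le)
    finally show ?thesis .
  qed
  \<comment> \<open>The term is \<open>c n\<close> times a factor whose square is of order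
    \<open>1 - cmod (b n)\<close>. Bounding this product by a sum of squares separates the two
    summable sequences.\<close>
  have maj: "norm (u n w) \<le> (cmod (c n))\<^sup>2 + 2 * Q / r\<^sup>2 * (1 - cmod (b n))" if w: "w \<in> ball \<zeta> r" for n w
  proof -
    define y where "y = cmod (sqrt (1 - (cmod (b n))\<^sup>2) / (1 - cnj (b n) * w) * (\<Prod>i<n. blaschke_factor (b i) w))"
    have s0: "0 \<le> 1 - (cmod (b n))\<^sup>2" using power_mono[of "cmod (b n)" 1 2] b[of n] by simp
    have s1: "1 - (cmod (b n))\<^sup>2 \<le> 2 * (1 - cmod (b n))"
      using zero_le_power2[of "1 - cmod (b n)"] by (simp add: power2_diff)
    have "y\<^sup>2 = (1 - (cmod (b n))\<^sup>2) / (cmod (1 - cnj (b n) * w))\<^sup>2 * (cmod (\<Prod>i<n. blaschke_factor (b i) w))\<^sup>2"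
      unfolding y_def norm_mult norm_divide power_mult_distrib power_divide using s0 by simp
    also have "\<dots> \<le> (2 * (1 - cmod (b n))) / r\<^sup>2 * Q"
      using s0 s1 prod[OF w] below[OF w, of n] r(1) b[of n]
      by (intro mult_mono frac_le power_mono) auto
    finally have y2: "y\<^sup>2 \<le> 2 * Q / r\<^sup>2 * (1 - cmod (b n))" by (simp add: mult_ac)
    have "norm (u n w) = cmod (c n) * y" unfolding u_def y_def by (rule norm_mult)
    also have "\<dots> \<le> (cmod (c n))\<^sup>2 + y\<^sup>2"
    proof -
      have "0 \<le> cmod (c n) * y" by (simp add: y_def)
      then show ?thesis using sum_squares_bound[of "cmod (c n)" y] by linarith
    qed
    finally show ?thesis using y2 by simp
  qed
  have uni: "uniform_limit (ball \<zeta> r) (\<lambda>n w. \<Sum>i<n. u i w) (\<lambda>w. \<Sum>i. u i w) sequentially"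
  proof (rule Weierstrass_m_test_ev)
    show "\<forall>\<^sub>F n in sequentially. \<forall>w\<in>ball \<zeta> r. norm (u n w) \<le> (cmod (c n))\<^sup>2 + 2 * Q / r\<^sup>2 * (1 - cmod (b n))"
      using maj by auto
    show "summable (\<lambda>n. (cmod (c n))\<^sup>2 + 2 * Q / r\<^sup>2 * (1 - cmod (b n)))"
      by (intro summable_add c summable_mult sum)
  qed
  have "(\<lambda>w. \<Sum>i. u i w) holomorphic_on ball \<zeta> r"
  proof (rule holomorphic_uniform_sequence)
    show "(\<lambda>w. \<Sum>i<n. u i w) holomorphic_on ball \<zeta> r" for n
      unfolding u_def blaschke_factor_def
      by (intro holomorphic_intros nonzero)
    fix w assume "w \<in> ball \<zeta> r"
    then obtain d where "0 < d" "cball w d \<subseteq> ball \<zeta> r"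
      using open_contains_cball[THEN iffD1, OF open_ball, THEN bspec, of w \<zeta> r] by auto
    then show "\<exists>d>0. cball w d \<subseteq> ball \<zeta> r \<and>
        uniform_limit (cball w d) (\<lambda>n w. \<Sum>i<n. u i w) (\<lambda>w. \<Sum>i. u i w) sequentially"
      using uniform_limit_on_subset[OF uni] by blast
  qed simp
  moreover have "(\<Sum>i. u i w) = hardy_eval f w" if "cmod w < 1" for w
    using sums[OF that] unfolding u_def by (rule sums_unique[symmetric])
  ultimately show ?thesis by (intro exI[of _ "\<lambda>w. \<Sum>i. u i w"]) simp
qed

section \<open>Limit points of Blaschke sets and the generic position of zero spaces\<close>

lemma blaschke_enumeration:
  assumes B: "B \<subseteq> ball 0 1" "infinite B" "blaschke B"
  obtains b :: "nat \<Rightarrow> complex" where "range b = B" "summable (\<lambda>n. 1 - cmod (b n))"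
proof -
  \<comment> \<open>A summable family has only countably many nonzero terms, and here no term is
    zero.\<close>
  have eq: "{a\<in>B. 1 - cmod a \<noteq> 0} = B" using B(1) by auto
  have "countable B"
    using summable_countable_real[OF B(3)[unfolded blaschke_def]] unfolding eq .
  then have bij: "bij_betw (from_nat_into B) UNIV B" using B(2) by (rule bij_betw_from_nat_into)
  have range: "range (from_nat_into B) = B" using bij by (rule bij_betw_imp_surj_on)
  have "0 \<le> 1 - cmod (from_nat_into B n)" for n
  proof -
    have "from_nat_into B n \<in> ball 0 1" using B(1) range by blast
    then show ?thesis by simp
  qed
  moreover have "(\<lambda>n. 1 - cmod (from_nat_into B n)) summable_on UNIV"
    by (rule iffD2[OF summable_on_reindex_bij_betw[OF bij, of "\<lambda>a. 1 - cmod a"] B(3)[unfolded blaschke_def]])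
  ultimately have "summable (\<lambda>n. 1 - cmod (from_nat_into B n))"
    by (simp only: summable_on_UNIV_nonneg_real_iff)
  with range show ?thesis by (rule that)
qed

text \<open>Near an interior limit point there would be infinitely many \<open>a\<close> with
  \<open>1 - cmod a\<close> bounded away from zero.\<close>

lemma blaschke_limit_point:
  assumes A: "A \<subseteq> ball 0 1" "infinite A" "blaschke A" and \<zeta>: "\<zeta> islimpt A"
  shows "cmod \<zeta> = 1"
proof -
  obtain b :: "nat \<Rightarrow> complex" where b: "range b = A" "summable (\<lambda>n. 1 - cmod (b n))"
    using blaschke_enumeration[OF A] .
  have "\<zeta> \<in> cball 0 1"
    using \<zeta> A(1) closed_limpt[of "cball (0::complex) 1"] islimpt_subset[of \<zeta> A "cball 0 1"] by force
  then have le: "cmod \<zeta> \<le> 1" by simp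
  moreover have "\<not> cmod \<zeta> < 1"
  proof
    assume lt: "cmod \<zeta> < 1"
    define d where "d = (1 - cmod \<zeta>) / 2"
    have d: "0 < d" using lt by (simp add: d_def)
    obtain N where N: "\<And>n. n \<ge> N \<Longrightarrow> 1 - cmod (b n) < d"
      using order_tendstoD(2)[OF summable_LIMSEQ_zero[OF b(2)] d] by (auto simp: eventually_sequentially)
    have "A \<inter> ball \<zeta> d \<subseteq> b ` {..<N}"
    proof
      fix a assume a: "a \<in> A \<inter> ball \<zeta> d"
      then obtain n where n: "a = b n" using b(1) by auto
      have "cmod a < cmod \<zeta> + d"
        using a norm_triangle_ineq2[of a \<zeta>] by (simp add: dist_norm norm_minus_commute)
      then have "d < 1 - cmod a" by (simp add: d_def field_simps)
      then have "n < N" using N[of n] n by (meson not_less less_asym)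
      then show "a \<in> b ` {..<N}" using n by auto
    qed
    then have "finite (A \<inter> ball \<zeta> d)" using finite_subset by blast
    then show False using \<zeta> d islimpt_eq_infinite_ball by blast
  qed
  ultimately show ?thesis by simp
qed

lemma zero_space_ortho_trivial:
  assumes A: "A \<subseteq> ball 0 1" "infinite A" "blaschke A"
    and B: "B \<subseteq> ball 0 1" "infinite B" "blaschke B"
    and lim: "\<not> lim_set A \<subseteq> lim_set B"
    and fA: "f \<in> zero_space A" and fB: "f \<in> ortho (zero_space B)"
  shows "f = 0"
proof -
  obtain \<zeta> where \<zeta>: "\<zeta> \<in> closure A" "\<zeta> \<notin> A" "\<zeta> \<notin> closure B - B"
    using lim by (auto simp: lim_set_def)
  have limA: "\<zeta> islimpt A" using \<zeta>(1,2) by (simp add: closure_def)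
  have one: "cmod \<zeta> = 1" by (rule blaschke_limit_point[OF A limA])
  then have "\<zeta> \<notin> B" using B(1) by auto
  then have "\<zeta> \<notin> closure B" using \<zeta>(3) by simp
  then obtain e where e: "e > 0" "\<And>y. y \<in> B \<Longrightarrow> e \<le> dist y \<zeta>"
    unfolding closure_approachable by (meson not_less)
  obtain b :: "nat \<Rightarrow> complex" where b: "range b = B" "summable (\<lambda>n. 1 - cmod (b n))"
    using blaschke_enumeration[OF B] .
  have b1: "cmod (b n) < 1" for n
  proof -
    have "b n \<in> ball 0 1" using b(1) B(1) by blast
    then show ?thesis by simp
  qed
  \<comment> \<open>Half of \<open>e\<close> gives the distance \<open>2 * r\<close> to all
    \<open>b n\<close>; the cap \<open>1\<close> keeps the ball inside
    \<open>cmod w \<le> 2\<close>.\<close>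
  define r where "r = min 1 (e / 2)"
  have r: "0 < r" "r \<le> 1" "\<And>n. 2 * r \<le> dist \<zeta> (b n)"
  proof -
    show "0 < r" "r \<le> 1" using e(1) by (auto simp: r_def)
    fix n
    have "b n \<in> B" using b(1) by blast
    then have "e \<le> dist \<zeta> (b n)" using e(2)[of "b n"] by (simp add: dist_commute)
    then show "2 * r \<le> dist \<zeta> (b n)" by (auto simp: r_def min_def)
  qed
  have fb: "f \<in> ortho (zero_space (range b))" using fB by (simp only: b(1))
  obtain F where F: "F holomorphic_on ball \<zeta> r"
    "\<And>w. w \<in> ball \<zeta> r \<Longrightarrow> cmod w < 1 \<Longrightarrow> F w = hardy_eval f w"
    using ortho_zero_space_extension[OF b1 b(2) fb one r] by (elim exE conjE) simp
  have F0: "F w = 0" if "w \<in> ball \<zeta> r" for w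
  proof (rule analytic_continuation[OF F(1), of "A \<inter> ball \<zeta> r" \<zeta>])
    show "\<zeta> islimpt A \<inter> ball \<zeta> r"
      unfolding islimpt_eq_infinite_ball
    proof (intro allI impI)
      fix \<epsilon> :: real assume "0 < \<epsilon>"
      then have "0 < min r \<epsilon>" using r(1) by simp
      with limA have "infinite (A \<inter> ball \<zeta> (min r \<epsilon>))"
        unfolding islimpt_eq_infinite_ball by blast
      moreover have "A \<inter> ball \<zeta> (min r \<epsilon>) = A \<inter> ball \<zeta> r \<inter> ball \<zeta> \<epsilon>" by auto
      ultimately show "infinite (A \<inter> ball \<zeta> r \<inter> ball \<zeta> \<epsilon>)" by simp
    qed
    show "F z = 0" if "z \<in> A \<inter> ball \<zeta> r" for z
      using that F(2)[of z] A(1) fA by (auto simp: zero_space_def)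
  qed (use r(1) that in auto)
  have "hardy_eval f z = 0" if z: "cmod z < 1" for z
  proof (rule analytic_continuation_open[of "ball \<zeta> r \<inter> ball 0 1" "ball 0 1" "hardy_eval f" "\<lambda>_. 0"])
    \<comment> \<open>A point of the radius towards \<open>\<zeta>\<close> shows that the two balls
      overlap, so that \<open>f = 0\<close> spreads from the overlap to the whole disk.\<close>
    have "(1 - complex_of_real (r / 2)) * \<zeta> \<in> ball \<zeta> r \<inter> ball 0 1"
    proof -
      have "dist \<zeta> ((1 - complex_of_real (r / 2)) * \<zeta>) = cmod (complex_of_real (r / 2) * \<zeta>)"
        by (simp add: dist_norm algebra_simps)
      moreover have "cmod ((1 - complex_of_real (r / 2)) * \<zeta>) = \<bar>1 - r / 2\<bar>"
      proof -
        have "1 - complex_of_real (r / 2) = complex_of_real (1 - r / 2)" by simp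
        then show ?thesis by (simp only: norm_mult norm_of_real one mult_1_right)
      qed
      ultimately show ?thesis using r(1,2) one by (simp add: norm_mult)
    qed
    then show "ball \<zeta> r \<inter> ball 0 1 \<noteq> {}" by blast
    show "hardy_eval f w = 0" if "w \<in> ball \<zeta> r \<inter> ball 0 1" for w
      using that F(2)[of w] F0[of w] by simp
  qed (use z in \<open>auto intro: hardy_holomorphic\<close>)
  then show ?thesis by (intro hardy_eval_eqI) simp
qed

theorem corollary5p3:
  fixes A B :: "complex set"
  assumes "A \<subseteq> ball 0 1" and "B \<subseteq> ball 0 1"
    and "infinite A" and "infinite B" and "A \<inter> B = {}"
    and "blaschke A" and "blaschke B"
    and "\<not> lim_set A \<subseteq> lim_set B" and "\<not> lim_set B \<subseteq> lim_set A"
  shows "(\<exists>!\<delta>. minimal_geodesic \<delta> (zero_space A) (zero_space B)) \<and>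
    (\<exists>!X. self_adjoint X \<and> norm X \<le> pi / 2 \<and>
       co_diagonal X (zero_space A) \<and> co_diagonal X (zero_space B) \<and>
       op_apply (exp_i X) ` zero_space A = zero_space B)"
proof (rule unique_minimal_geodesic[OF zero_space_Gr zero_space_Gr])
  show "f = 0" if "f \<in> zero_space A" "f \<in> ortho (zero_space B)" for f
    using assms(1,3,6) assms(2,4,7) assms(8) that by (rule zero_space_ortho_trivial)
  show "f = 0" if "f \<in> zero_space B" "f \<in> ortho (zero_space A)" for f
    using assms(2,4,7) assms(1,3,6) assms(9) that by (rule zero_space_ortho_trivial)
qed

end
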